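(* Let $G\in H^\infty_{m\times p}$ and $K\in H^\infty_{m\times q}$ be rational matrix functions with $T_GT_G^*-T_KT_K^*\ge0$, and define the rational matrix function $R\in L^\infty_{m\times m}$ by $R(e^{it})=G(e^{it})G(e^{it})^*-K(e^{it})K(e^{it})^*$. Then the following statements are equivalent: (i) $\operatorname{rank}(T_GT_G^*-T_KT_K^* )<\infty$; (ii) $T_R=0$; (iii) $G(e^{it})G(e^{it})^*=K(e^{it})K(e^{it})^*$ for all $t\in[0,2\pi]$. Moreover, in this case $$T_GT_G^*-T_KT_K^*=H_KH_K^*-H_GH_G^*$$ and $$\delta(G)\le\delta(K),\qquad \delta(K)-\delta(G)\le\operatorname{rank}(T_GT_G^*-T_KT_K^* )\le\delta(K),$$ where $\delta(G)$ and $\delta(K)$ denote the McMillan degrees of $G$ and $K$, respectively.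
   Context: $\mathbb D$ is the open unit disc, $\mathbb T$ the unit circle. $H^\infty_{m\times p}$ is the space of bounded analytic $m\times p$ matrix-valued functions on $\mathbb D$, and $L^\infty_{m\times p}$ the space of essentially bounded measurable $m\times p$ matrix functions on $\mathbb T$; $H^\infty_{m\times p}$ is viewed as a subspace of $L^\infty_{m\times p}$ via boundary values. $\ell^2_+(\mathbb C^k)$ is the Hilbert space of square summable unilateral sequences in $\mathbb C^k$. For $Z\in L^\infty_{m\times p}$ with Fourier coefficients $(Z_j)_{j\in\mathbb Z}$, $T_Z=[Z_{i-j}]_{i,j\ge0}$ is the Toeplitz operator, and for $V\in H^\infty_{m\times p}$ with Taylor coefficients $V_0,V_1,\dots$, $H_V=[V_{i+j+1}]_{i,j\ge0}$ is the Hankel operator; both are bounded operators $\ell^2_+(\mathbb C^p)\to\ell^2_+(\mathbb C^m)$. $T\ge0$ means $\langle Tu,u\rangle\ge0$ for all $u$. The McMillan degree $\delta(Z)$ of a rational matrix function $Z$ is the sum over $w\in\mathbb C\cup\{\infty\}$ of the local degrees $\delta(Z,w)$, where for $w\in\mathbb C$ with Laurent expansion $Z(z)=\sum_j(z-w)^jC_j$ near $w$, $\delta(Z,w)$ is the rank of the block Hankel matrix $[C_{-(i+j+1)}]_{i,j\ge0}$, and $\delta(Z,\infty)$ is the local degree at $0$ of $z\mapsto Z(1/z)$. For rational $V\in H^\infty_{m\times p}$ one has $\delta(V)=\operatorname{rank}H_V$. *)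

theory Defs
  imports
    "HOL-Complex_Analysis.Complex_Analysis"
    "HOL-Library.Function_Algebras"
    "HOL-Library.Extended_Nat"
begin

section \<open>Matrix functions\<close>

definition mat_adj :: "complex ^ 'p ^ 'm \<Rightarrow> complex ^ 'm ^ 'p"
  where "mat_adj A = (\<chi> i j. cnj (A $ j $ i))"

text \<open>
  A rational matrix function is represented by its pointwise values.  Writing each entry in
  lowest terms means that removable singularities are filled in and that (because of
  \<open>x / 0 = 0\<close>) the value \<open>0\<close> is assigned at poles, so that the function on the plane and the
  rational function determine each other.
\<close>
definition rational_matrix_fun :: "(complex \<Rightarrow> complex ^ 'p ^ 'm) \<Rightarrow> bool"
  where "rational_matrix_fun Z \<longleftrightarrow>
    (\<forall>i j. \<exists>P Q :: complex poly. Q \<noteq> 0 \<and> coprime P Q \<and>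
       (\<forall>z. Z z $ i $ j = poly P z / poly Q z))"

definition H_infty :: "(complex \<Rightarrow> complex ^ 'p ^ 'm) set"
  where "H_infty = {Z. (\<forall>i j. (\<lambda>z. Z z $ i $ j) holomorphic_on ball 0 1) \<and>
                       bounded (Z ` ball 0 1)}"

text \<open>
  The boundary values of a rational function in \<open>H_infty\<close> are just its values on the unit
  circle, since it has no poles there.
\<close>
lemma rational_H_infty_continuous_on_cball:
  assumes "rational_matrix_fun Z" "Z \<in> H_infty"
  shows "continuous_on (cball 0 1) Z"
proof -
  have "continuous_on (cball 0 1) (\<lambda>z. Z z $ i $ j)" for i j
  proof -
    obtain P Q where Q: "Q \<noteq> 0" and cop: "coprime P Q"
      and eq: "\<And>z. Z z $ i $ j = poly P z / poly Q z"
      using assms(1) unfolding rational_matrix_fun_def by blast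
    obtain B where B: "\<And>z. z \<in> ball 0 1 \<Longrightarrow> norm (Z z) \<le> B"
      using assms(2) unfolding H_infty_def bounded_iff by blast
    have bd: "norm (poly P z) \<le> B * norm (poly Q z)" if z: "z \<in> ball 0 1" "poly Q z \<noteq> 0" for z
    proof -
      have "norm (Z z $ i $ j) \<le> B"
        using B[OF z(1)] Finite_Cartesian_Product.norm_nth_le[of "Z z" i]
          Finite_Cartesian_Product.norm_nth_le[of "Z z $ i" j] by linarith
      then show ?thesis using z(2) by (simp add: eq norm_divide field_simps)
    qed
    have nz: "poly Q w \<noteq> 0" if w: "w \<in> cball 0 1" for w
    proof
      assume Qw: "poly Q w = 0"
      have fin: "finite {z. poly Q z = 0}" using Q poly_roots_finite by blast
      let ?S = "ball 0 1 - {z. poly Q z = 0}"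
      have "closure (- {z. poly Q z = 0}) = UNIV"
        using fin by (simp add: closure_complement empty_interior_finite)
      then have "closure ?S = cball 0 1"
        using closure_open_Int_superset[of "ball 0 1" "- {z. poly Q z = 0}"]
        by (simp add: Diff_eq)
      then have "w \<in> closure ?S" using w by simp
      moreover have "closed {z. norm (poly P z) \<le> B * norm (poly Q z)}"
        by (intro closed_Collect_le continuous_intros)
      moreover have "?S \<subseteq> {z. norm (poly P z) \<le> B * norm (poly Q z)}"
        using bd by auto
      ultimately have "norm (poly P w) \<le> B * norm (poly Q w)"
        using closure_minimal[of ?S "{z. norm (poly P z) \<le> B * norm (poly Q z)}"] by auto
      then have "poly P w = 0" using Qw by simp
      then have "[:-w, 1:] dvd P" "[:-w, 1:] dvd Q"
        using Qw by (simp_all add: poly_eq_0_iff_dvd)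
      then have "is_unit [:-w, 1:]" using coprime_common_divisor[OF cop] by simp
      then show False by (simp add: is_unit_pCons_iff)
    qed
    show ?thesis unfolding eq using nz by (intro continuous_intros) auto
  qed
  then have "continuous_on (cball 0 1) (\<lambda>z. \<chi> i j. Z z $ i $ j)"
    by (intro continuous_on_vec_lambda)
  then show ?thesis by simp
qed

definition fourier_coeff :: "(complex \<Rightarrow> complex ^ 'p ^ 'm) \<Rightarrow> int \<Rightarrow> complex ^ 'p ^ 'm"
  where "fourier_coeff Z n = (\<chi> i j.
    (LINT t:{0..2 * pi}|lebesgue. Z (cis t) $ i $ j * cis (- (of_int n * t))) / of_real (2 * pi))"

definition taylor_coeff :: "(complex \<Rightarrow> complex ^ 'p ^ 'm) \<Rightarrow> nat \<Rightarrow> complex ^ 'p ^ 'm"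
  where "taylor_coeff V n = (\<chi> i j. fps_nth (fps_expansion (\<lambda>z. V z $ i $ j) 0) n)"

definition laurent_coeff :: "(complex \<Rightarrow> complex ^ 'p ^ 'm) \<Rightarrow> complex \<Rightarrow> int \<Rightarrow> complex ^ 'p ^ 'm"
  where "laurent_coeff Z w n = (\<chi> i j. fls_nth (laurent_expansion (\<lambda>z. Z z $ i $ j) w) n)"


section \<open>Square summable sequences and operators\<close>

text \<open>
  Operators between these spaces are functions on arbitrary sequences of which only the
  restriction to \<open>ell2\<close> is meaningful.
\<close>
definition ell2 :: "(nat \<Rightarrow> complex ^ 'k) set"
  where "ell2 = {u. summable (\<lambda>n. (norm (u n))\<^sup>2)}"

definition ell2_inner :: "(nat \<Rightarrow> complex ^ 'k) \<Rightarrow> (nat \<Rightarrow> complex ^ 'k) \<Rightarrow> complex"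
  where "ell2_inner u v = (\<Sum>n. \<Sum>i\<in>UNIV. u n $ i * cnj (v n $ i))"

definition ell2_adj ::
    "((nat \<Rightarrow> complex ^ 'p) \<Rightarrow> (nat \<Rightarrow> complex ^ 'm)) \<Rightarrow> (nat \<Rightarrow> complex ^ 'm) \<Rightarrow> (nat \<Rightarrow> complex ^ 'p)"
  where "ell2_adj T v = (THE w. w \<in> ell2 \<and> (\<forall>u\<in>ell2. ell2_inner (T u) v = ell2_inner u w))"

definition ell2_nonneg :: "((nat \<Rightarrow> complex ^ 'k) \<Rightarrow> (nat \<Rightarrow> complex ^ 'k)) \<Rightarrow> bool"
  where "ell2_nonneg T \<longleftrightarrow> (\<forall>u\<in>ell2. ell2_inner (T u) u \<in> \<real>\<^sub>\<ge>\<^sub>0)"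

definition block_op ::
    "(nat \<Rightarrow> nat \<Rightarrow> complex ^ 'p ^ 'm) \<Rightarrow> (nat \<Rightarrow> complex ^ 'p) \<Rightarrow> (nat \<Rightarrow> complex ^ 'm)"
  where "block_op A u = (\<lambda>i. \<Sum>j. A i j *v u j)"

definition toeplitz ::
    "(complex \<Rightarrow> complex ^ 'p ^ 'm) \<Rightarrow> (nat \<Rightarrow> complex ^ 'p) \<Rightarrow> (nat \<Rightarrow> complex ^ 'm)"
  where "toeplitz Z = block_op (\<lambda>i j. fourier_coeff Z (int i - int j))"

definition hankel ::
    "(complex \<Rightarrow> complex ^ 'p ^ 'm) \<Rightarrow> (nat \<Rightarrow> complex ^ 'p) \<Rightarrow> (nat \<Rightarrow> complex ^ 'm)"
  where "hankel V = block_op (\<lambda>i j. taylor_coeff V (i + j + 1))"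


section \<open>Ranks and McMillan degree\<close>

global_interpretation cseq: vector_space "\<lambda>(c::complex) (u::nat \<Rightarrow> complex ^ 'k) n. c *s u n"
  by unfold_locales (auto simp: fun_eq_iff vec_eq_iff algebra_simps)

text \<open>The complex dimension of the linear span; \<open>cseq.dim\<close> alone is \<open>0\<close> in infinite dimension.\<close>
definition cseq_edim :: "(nat \<Rightarrow> complex ^ 'k) set \<Rightarrow> enat"
  where "cseq_edim S = (if \<exists>B. finite B \<and> S \<subseteq> cseq.span B then enat (cseq.dim S) else \<infinity>)"

definition ell2_rank :: "((nat \<Rightarrow> complex ^ 'p) \<Rightarrow> (nat \<Rightarrow> complex ^ 'm)) \<Rightarrow> enat"
  where "ell2_rank T = cseq_edim (T ` ell2)"

text \<open>The rank of an infinite block matrix: the dimension of the span of its columns.\<close>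
definition block_rank :: "(nat \<Rightarrow> nat \<Rightarrow> complex ^ 'p ^ 'm) \<Rightarrow> enat"
  where "block_rank A = cseq_edim (range (\<lambda>(j, k). \<lambda>i. column k (A i j)))"

definition local_degree :: "(complex \<Rightarrow> complex ^ 'p ^ 'm) \<Rightarrow> complex \<Rightarrow> enat"
  where "local_degree Z w = block_rank (\<lambda>i j. laurent_coeff Z w (- int (i + j + 1)))"

text \<open>
  For rational \<open>Z\<close> only the finitely many poles contribute to the sum over the plane; the last
  term is the local degree at infinity.
\<close>
definition mcmillan_degree :: "(complex \<Rightarrow> complex ^ 'p ^ 'm) \<Rightarrow> enat"
  where "mcmillan_degree Z =
    (\<Sum>w | local_degree Z w \<noteq> 0. local_degree Z w) + local_degree (\<lambda>z. Z (1 / z)) 0"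

end

theory Submission
  imports Defs "HOL-Computational_Algebra.Fundamental_Theorem_Algebra"
begin

text \<open>
  Write \<open>T\<^sub>Z\<close> and \<open>H\<^sub>Z\<close> for the Toeplitz and Hankel
  operators. The entry \<open>(i, j)\<close> of \<open>T\<^sub>G T\<^sub>G\<^sup>*\<close> is
  the sum of \<open>G\<^sub>i\<^sub>-\<^sub>m G\<^sub>j\<^sub>-\<^sub>m\<^sup>*\<close> over
  \<open>m \<ge> 0\<close>, and that of \<open>H\<^sub>G H\<^sub>G\<^sup>*\<close> is the sum of
  the same terms over \<open>m < 0\<close>. So the two products add up to the Toeplitz operator
  with symbol \<open>G G\<^sup>*\<close> (\<open>toeplitz_plus_hankel_gram\<close>), and
  \<open>D = T\<^sub>G T\<^sub>G\<^sup>* - T\<^sub>K T\<^sub>K\<^sup>*\<close> satisfies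
  \<open>T\<^sub>R = D - (H\<^sub>K H\<^sub>K\<^sup>* - H\<^sub>G H\<^sub>G\<^sup>*)\<close>.

  Hankel operators of rational functions have finite rank, so \<open>D\<close> has finite rank
  exactly if \<open>T\<^sub>R\<close> has. A Toeplitz operator of finite rank is
  \<open>0\<close>: its columns tend to \<open>0\<close> coordinatewise, hence uniformly in a
  finite-dimensional space, although each diagonal is constant
  (\<open>finite_rank_toeplitz_zero\<close>). And \<open>T\<^sub>R = 0\<close> says that all
  Fourier coefficients of \<open>R\<close> vanish, which means that \<open>R\<close> vanishes on
  the circle (\<open>row_products_equal\<close>).

  In this case \<open>D = H\<^sub>K H\<^sub>K\<^sup>* - H\<^sub>G H\<^sub>G\<^sup>*\<close>. On
  the orthogonal complement of the range of \<open>H\<^sub>K\<close> the nonnegative operators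
  \<open>D\<close> and \<open>H\<^sub>G H\<^sub>G\<^sup>*\<close> have sum \<open>0\<close> in
  the sense of quadratic forms, so they vanish there and their ranks are at most that of
  \<open>H\<^sub>K\<close>; the remaining inequality is the subadditivity of the rank
  (\<open>rank_gram_difference\<close>).

  The ranks of the Hankel operators are the McMillan degrees
  (\<open>mcmillan_degree_eq_block_rank\<close>). The columns of the Hankel matrix of
  \<open>V\<close> span a module over the backward shift. Expanding \<open>V\<close> into
  partial fractions splits its generators into generalised eigenvectors of the shift, with
  eigenvalue \<open>1 / w\<close> for a pole \<open>w\<close> and \<open>0\<close> for infinity,
  and by the Bezout identity for polynomials the module splits accordingly
  (\<open>edim_orbit_sum\<close>). The component of \<open>w\<close> is isomorphic to the span
  of the columns of the local Hankel matrix at \<open>w\<close>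
  (\<open>edim_orbit_pole_map\<close>).

  The analysis stays elementary because the Taylor coefficients of a bounded rational function
  on the disc are absolutely summable: all block matrices involved pass the Schur test, which
  gives boundedness, adjoints and the interchange of summations at once.
\<close>

section \<open>Dimension of spans of sequences\<close>

(* From here on the dollar sign denotes vector components only. *)
no_notation fps_nth (infixl "$" 75)

lemma sum_seq_apply: "(\<Sum>q\<in>Q. f q) n = (\<Sum>q\<in>Q. f q (n :: nat) :: 'a :: comm_monoid_add)"
  by (induction Q rule: infinite_finite_induct) auto

abbreviation cscale :: "complex \<Rightarrow> (nat \<Rightarrow> complex ^ 'k) \<Rightarrow> (nat \<Rightarrow> complex ^ 'k)"
  where "cscale c u \<equiv> (\<lambda>n. c *s u n)"

lemma sum_cscale_nth: "(\<Sum>q\<in>Q. cscale (g q) (b q)) n $ k = (\<Sum>q\<in>Q. g q * b q n $ k)"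
  by (simp add: sum_seq_apply)

text \<open>
  Operators given by infinite series are additive only where the series converge, so linearity
  is a property relative to a set of sequences.
\<close>
definition linear_on_set ::
    "(nat \<Rightarrow> complex ^ 'k) set \<Rightarrow> ((nat \<Rightarrow> complex ^ 'k) \<Rightarrow> (nat \<Rightarrow> complex ^ 'l)) \<Rightarrow> bool"
  where "linear_on_set V T \<longleftrightarrow>
    (\<forall>u\<in>V. \<forall>v\<in>V. T (u + v) = T u + T v) \<and> (\<forall>c. \<forall>u\<in>V. T (cscale c u) = cscale c (T u))"

lemma linear_on_set_subset: "linear_on_set V T \<Longrightarrow> W \<subseteq> V \<Longrightarrow> linear_on_set W T"
  unfolding linear_on_set_def by blast

lemma linear_on_setD:
  assumes "linear_on_set V T"
  shows "u \<in> V \<Longrightarrow> v \<in> V \<Longrightarrow> T (u + v) = T u + T v"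
    and "u \<in> V \<Longrightarrow> T (cscale c u) = cscale c (T u)"
  using assms unfolding linear_on_set_def by blast+

lemma linear_on_set_0:
  assumes "linear_on_set V T" "cseq.subspace V"
  shows "T 0 = 0"
proof -
  have "T (cscale 0 0) = cscale 0 (T 0)"
    by (rule linear_on_setD(2)[OF assms(1)]) (rule cseq.subspace_0[OF assms(2)])
  moreover have "cscale 0 (0 :: nat \<Rightarrow> complex ^ 'a) = 0" "cscale 0 (T 0) = 0"
    by (auto simp: fun_eq_iff)
  ultimately show ?thesis by simp
qed

lemma linear_on_set_diff:
  assumes "linear_on_set V T" "cseq.subspace V" "u \<in> V" "v \<in> V"
  shows "T (u - v) = T u - T v"
proof -
  have "T (u - v) + T v = T ((u - v) + v)"
    using linear_on_setD(1)[OF assms(1), of "u - v" v] cseq.subspace_diff[OF assms(2)] assms by simp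
  then show ?thesis by (simp add: algebra_simps)
qed

lemma linear_on_set_span_image:
  assumes T: "linear_on_set V T" and V: "cseq.subspace V" and S: "S \<subseteq> V"
  shows "T ` cseq.span S = cseq.span (T ` S)"
proof (rule antisym)
  have sp: "cseq.span S \<subseteq> V" by (rule cseq.span_minimal[OF S V])
  show "T ` cseq.span S \<subseteq> cseq.span (T ` S)"
  proof (rule image_subsetI)
    fix x assume "x \<in> cseq.span S"
    then have "x \<in> V \<and> T x \<in> cseq.span (T ` S)"
    proof (induction rule: cseq.span_induct_alt)
      case base
      show ?case using linear_on_set_0[OF T V] cseq.subspace_0[OF V] cseq.span_zero
        by (simp add: zero_fun_def)
    next
      case (step c x y)
      then have x: "x \<in> V" "cscale c x \<in> V" using S V cseq.subspace_scale by blast+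
      then have "T (cscale c x + y) = cscale c (T x) + T y"
        using step linear_on_setD[OF T] by auto
      moreover have "cscale c (T x) + T y \<in> cseq.span (T ` S)"
        using step by (intro cseq.span_add cseq.span_scale[OF cseq.span_base]) auto
      moreover have "cscale c x + y \<in> V" using cseq.subspace_add[OF V] x(2) step by blast
      ultimately show ?case by (simp del: plus_fun_apply)
    qed
    then show "T x \<in> cseq.span (T ` S)" by blast
  qed
  show "cseq.span (T ` S) \<subseteq> T ` cseq.span S"
  proof (rule cseq.span_minimal)
    show "T ` S \<subseteq> T ` cseq.span S" using cseq.span_superset by blast
    show "cseq.subspace (T ` cseq.span S)"
    proof (rule cseq.subspaceI)
      show "0 \<in> T ` cseq.span S"
        using linear_on_set_0[OF T V] cseq.span_zero[of S] by (intro image_eqI[of _ _ 0]) auto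
    next
      fix x y assume "x \<in> T ` cseq.span S" "y \<in> T ` cseq.span S"
      then obtain a b where ab: "a \<in> cseq.span S" "b \<in> cseq.span S" "x = T a" "y = T b" by blast
      then have "x + y = T (a + b)" using linear_on_setD(1)[OF T, of a b] subsetD[OF sp] by simp
      then show "x + y \<in> T ` cseq.span S" using ab cseq.span_add by blast
    next
      fix c x assume "x \<in> T ` cseq.span S"
      then obtain a where a: "a \<in> cseq.span S" "x = T a" by blast
      then have "cscale c x = T (cscale c a)" using linear_on_setD(2)[OF T, of a] sp by auto
      then show "cscale c x \<in> T ` cseq.span S" using a cseq.span_scale by blast
    qed
  qed
qed

lemma subspace_linear_image:
  assumes "linear_on_set V T" "cseq.subspace V"
  shows "cseq.subspace (T ` V)"
  using linear_on_set_span_image[OF assms order_refl] cseq.span_eq_iff[of V] assms(2)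
    cseq.subspace_span by metis

lemma cseq_edim_le_card:
  assumes "finite B" "S \<subseteq> cseq.span B"
  shows "cseq_edim S \<le> enat (card B)"
  using assms cseq.dim_le_card unfolding cseq_edim_def by auto

lemma cseq_edim_basis:
  assumes "cseq_edim S \<noteq> \<infinity>"
  obtains B where "B \<subseteq> S" "finite B" "cseq.independent B" "S \<subseteq> cseq.span B"
    "cseq_edim S = enat (card B)"
proof -
  obtain C where C: "finite C" "S \<subseteq> cseq.span C"
    using assms unfolding cseq_edim_def by (auto split: if_splits)
  obtain B where B: "B \<subseteq> S" "cseq.independent B" "S \<subseteq> cseq.span B" "card B = cseq.dim S"
    using cseq.basis_exists by blast
  have "finite B" using cseq.independent_span_bound[OF C(1) B(2)] B(1) C(2) by auto
  moreover have "cseq_edim S = enat (card B)" using B(4) C unfolding cseq_edim_def by auto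
  ultimately show ?thesis using that B by blast
qed

lemma cseq_edim_mono_span:
  assumes "S \<subseteq> cseq.span T"
  shows "cseq_edim S \<le> cseq_edim T"
proof (cases "cseq_edim T = \<infinity>")
  case False
  then obtain B where B: "B \<subseteq> T" "finite B" "T \<subseteq> cseq.span B" "cseq_edim T = enat (card B)"
    by (rule cseq_edim_basis)
  have "cseq.span T \<subseteq> cseq.span B" using B(3) by (rule cseq.span_minimal) auto
  then show ?thesis using cseq_edim_le_card[OF B(2)] assms B(4) by auto
qed simp

lemma cseq_edim_cong_span: "cseq.span S = cseq.span T \<Longrightarrow> cseq_edim S = cseq_edim T"
  by (metis antisym cseq.span_superset cseq_edim_mono_span)

lemma cseq_edim_span [simp]: "cseq_edim (cseq.span S) = cseq_edim S"
  by (rule cseq_edim_cong_span) simp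

lemma cseq_edim_finite: "finite S \<Longrightarrow> cseq_edim S \<noteq> \<infinity>"
  unfolding cseq_edim_def using cseq.span_superset by auto

lemma cseq_edim_subset_zero: "S \<subseteq> {0} \<Longrightarrow> cseq_edim S = 0"
  using cseq_edim_le_card[of "{}" S] by (auto simp: zero_enat_def[symmetric])

lemma cseq_edim_independent:
  assumes "cseq.independent B" "finite B"
  shows "cseq_edim B = enat (card B)"
  using cseq.dim_eq_card_independent[OF assms(1)] assms(2) cseq.span_superset
  unfolding cseq_edim_def by auto

lemma cseq_edim_Un_le: "cseq_edim (S \<union> T) \<le> cseq_edim S + cseq_edim T"
proof (cases "cseq_edim S = \<infinity> \<or> cseq_edim T = \<infinity>")
  case False
  then obtain B C where B: "finite B" "S \<subseteq> cseq.span B" "cseq_edim S = enat (card B)"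
    and C: "finite C" "T \<subseteq> cseq.span C" "cseq_edim T = enat (card C)"
    by (metis cseq_edim_basis)
  have "S \<union> T \<subseteq> cseq.span (B \<union> C)"
    using B(2) C(2) cseq.span_mono[of B "B \<union> C"] cseq.span_mono[of C "B \<union> C"] by auto
  then have "cseq_edim (S \<union> T) \<le> enat (card (B \<union> C))"
    using B(1) C(1) by (intro cseq_edim_le_card) auto
  also have "\<dots> \<le> enat (card B + card C)" by (simp add: card_Un_le)
  finally show ?thesis using B(3) C(3) by simp
qed auto

text \<open>
  A basis of the second span extends a basis of the first one vector by vector: a dependency
  would put a nonzero vector into both spans.
\<close>
lemma cseq_edim_direct_sum:
  assumes disj: "cseq.span S \<inter> cseq.span T \<subseteq> {0}"
  shows "cseq_edim (S \<union> T) = cseq_edim S + cseq_edim T"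
proof (cases "cseq_edim S = \<infinity> \<or> cseq_edim T = \<infinity>")
  case True
  moreover have "cseq_edim S \<le> cseq_edim (S \<union> T)" "cseq_edim T \<le> cseq_edim (S \<union> T)"
    using cseq.span_superset[of "S \<union> T"] by (auto intro!: cseq_edim_mono_span)
  ultimately show ?thesis by auto
next
  case False
  then obtain B C where B: "B \<subseteq> S" "finite B" "cseq.independent B" "S \<subseteq> cseq.span B"
      "cseq_edim S = enat (card B)"
    and C: "C \<subseteq> T" "finite C" "cseq.independent C" "T \<subseteq> cseq.span C"
      "cseq_edim T = enat (card C)"
    by (metis cseq_edim_basis)
  have sp: "cseq.span B \<subseteq> cseq.span S" "cseq.span C \<subseteq> cseq.span T"
    using B(1) C(1) cseq.span_mono by blast+
  have "cseq.independent (B \<union> C') \<and> B \<inter> C' = {}" if "C' \<subseteq> C" for C'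
    using finite_subset[OF that C(2)] that
  proof (induction C' rule: finite_induct)
    case empty
    show ?case using B(3) by simp
  next
    case (insert c C')
    have "c \<notin> cseq.span C'"
      using insert C(3) by (metis cseq.independent_insert cseq.independent_mono insert_subset)
    have "c \<notin> cseq.span (B \<union> C')"
    proof
      assume "c \<in> cseq.span (B \<union> C')"
      then obtain s t where st: "c = s + t" "s \<in> cseq.span B" "t \<in> cseq.span C'"
        unfolding cseq.span_Un by blast
      have t: "t \<in> cseq.span C" using st(3) insert.prems cseq.span_mono by blast
      have "s = c - t" using st(1) by simp
      then have "s \<in> cseq.span C" using t insert.prems cseq.span_base cseq.span_diff
        by (metis insert_subset)
      then have "s = 0" using st(2) sp disj by blast
      then show False using st \<open>c \<notin> cseq.span C'\<close> by simp
    qed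
    then show ?case
      using insert cseq.independent_insertI[of c "B \<union> C'"] cseq.span_base[of c "B \<union> C'"] by auto
  qed
  from this[of C] have ind: "cseq.independent (B \<union> C)" "B \<inter> C = {}" by auto
  have "cseq.span (B \<union> C) = cseq.span (S \<union> T)"
  proof (rule antisym)
    show "cseq.span (B \<union> C) \<subseteq> cseq.span (S \<union> T)" using B(1) C(1) by (intro cseq.span_mono) auto
    have "S \<union> T \<subseteq> cseq.span (B \<union> C)"
      using B(4) C(4) cseq.span_mono[of B "B \<union> C"] cseq.span_mono[of C "B \<union> C"] by auto
    then show "cseq.span (S \<union> T) \<subseteq> cseq.span (B \<union> C)" by (rule cseq.span_minimal) auto
  qed
  then have "cseq_edim (S \<union> T) = cseq_edim (B \<union> C)" by (metis cseq_edim_cong_span)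
  also have "\<dots> = enat (card B + card C)"
    using cseq_edim_independent[OF ind(1)] B(2) C(2) ind(2) by (simp add: card_Un_disjoint)
  finally show ?thesis using B(5) C(5) by simp
qed

lemma cseq_edim_image_le:
  assumes T: "linear_on_set V T" and V: "cseq.subspace V" and S: "S \<subseteq> V"
  shows "cseq_edim (T ` S) \<le> cseq_edim S"
proof (cases "cseq_edim S = \<infinity>")
  case False
  then obtain B where B: "B \<subseteq> S" "finite B" "S \<subseteq> cseq.span B" "cseq_edim S = enat (card B)"
    by (rule cseq_edim_basis)
  have "T ` S \<subseteq> T ` cseq.span B" using B(3) by blast
  also have "\<dots> = cseq.span (T ` B)" using linear_on_set_span_image[OF T V] B(1) S by auto
  finally have "cseq_edim (T ` S) \<le> enat (card (T ` B))" using B(2) by (intro cseq_edim_le_card) auto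
  also have "\<dots> \<le> enat (card B)" using B(2) by (simp add: card_image_le)
  finally show ?thesis using B(4) by simp
qed simp

text \<open>
  The inverse of the map on the span is linear as well, so the dimension can neither grow nor
  drop.
\<close>
lemma cseq_edim_image_inj:
  assumes T: "linear_on_set V T" and V: "cseq.subspace V" and S: "S \<subseteq> V"
    and inj: "\<And>x. x \<in> cseq.span S \<Longrightarrow> T x = 0 \<Longrightarrow> x = 0"
  shows "cseq_edim (T ` S) = cseq_edim S"
proof (rule antisym)
  show "cseq_edim (T ` S) \<le> cseq_edim S" by (rule cseq_edim_image_le[OF T V S])
  define W where "W = cseq.span S"
  have WV: "W \<subseteq> V" unfolding W_def by (rule cseq.span_minimal[OF S V])
  have W: "cseq.subspace W" unfolding W_def by simp
  have TW: "linear_on_set W T" using T WV by (rule linear_on_set_subset)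
  have io: "inj_on T W"
  proof (rule inj_onI)
    fix x y assume xy: "x \<in> W" "y \<in> W" "T x = T y"
    then have "T (x - y) = 0" using linear_on_set_diff[OF TW W] by simp
    then show "x = y" using inj[of "x - y"] xy W W_def cseq.subspace_diff by auto
  qed
  define U where "U = inv_into W T"
  have UT: "U (T x) = x" if "x \<in> W" for x unfolding U_def using inv_into_f_f[OF io that] .
  have "linear_on_set (T ` W) U"
    unfolding linear_on_set_def
  proof (intro conjI ballI allI)
    fix u v assume "u \<in> T ` W" "v \<in> T ` W"
    then obtain a b where ab: "a \<in> W" "b \<in> W" "u = T a" "v = T b" by blast
    then have "u + v = T (a + b)" using linear_on_setD(1)[OF TW] by simp
    then show "U (u + v) = U u + U v" using ab UT cseq.subspace_add[OF W] by simp
  next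
    fix c u assume "u \<in> T ` W"
    then obtain a where a: "a \<in> W" "u = T a" by blast
    then have "cscale c u = T (cscale c a)" using linear_on_setD(2)[OF TW] by simp
    then show "U (cscale c u) = cscale c (U u)" using a UT cseq.subspace_scale[OF W] by simp
  qed
  moreover have "cseq.subspace (T ` W)"
    unfolding W_def using linear_on_set_span_image[OF T V S] by simp
  moreover have "T ` S \<subseteq> T ` W" unfolding W_def using cseq.span_superset by blast
  ultimately have "cseq_edim (U ` (T ` S)) \<le> cseq_edim (T ` S)" by (rule cseq_edim_image_le)
  moreover have "U ` (T ` S) = S"
    using UT cseq.span_superset[of S] unfolding W_def by (force simp: image_iff)
  ultimately show "cseq_edim S \<le> cseq_edim (T ` S)" by simp
qed

text \<open>
  Gaussian elimination: a finite-dimensional space of sequences has a reduced echelon form, so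
  that its elements are recovered from finitely many of their coordinates. Coordinatewise
  convergence inside the space is thereby convergence of the coefficients of a fixed finite
  family, which replaces all compactness arguments below.
\<close>
lemma echelon_coordinates:
  fixes W :: "(nat \<Rightarrow> complex ^ 'k) set"
  assumes W: "cseq.subspace W" and fin: "finite B" and WB: "W \<subseteq> cseq.span B"
  obtains Q b where "finite Q" "\<And>q. q \<in> Q \<Longrightarrow> b q \<in> W"
    "\<And>x. x \<in> W \<Longrightarrow> x = (\<Sum>q\<in>Q. cscale (x (fst q) $ snd q) (b q))"
proof -
  have "\<exists>Q b. finite Q \<and> (\<forall>q\<in>Q. b q \<in> W) \<and>
      (\<forall>x\<in>W. x = (\<Sum>q\<in>Q. cscale (x (fst q) $ snd q) (b q)))"
    using W WB
  proof (induction "cseq.dim W" arbitrary: W rule: less_induct)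
    case less
    show ?case
    proof (cases "W \<subseteq> {0}")
      case True
      then show ?thesis by (intro exI[of _ "{}"] exI[of _ "\<lambda>_. 0"]) auto
    next
      case False
      then obtain x0 where x0: "x0 \<in> W" "x0 \<noteq> 0" by blast
      then obtain i a where ia: "x0 i $ a \<noteq> 0" by (auto simp: fun_eq_iff vec_eq_iff)
      \<comment> \<open>The coordinate \<open>(i, a)\<close> serves as pivot; the rest of the space
        lives where it vanishes.\<close>
      define W' where "W' = {x\<in>W. x i $ a = 0}"
      have W': "cseq.subspace W'"
        unfolding W'_def using cseq.subspace_0[OF less.prems(1)] cseq.subspace_add[OF less.prems(1)]
          cseq.subspace_scale[OF less.prems(1)]
        by (intro cseq.subspaceI) (simp_all add: plus_fun_def zero_fun_def)
      have sub: "W' \<subseteq> W" unfolding W'_def by blast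
      obtain C where C: "C \<subseteq> W'" "cseq.independent C" "W' \<subseteq> cseq.span C" "card C = cseq.dim W'"
        using cseq.basis_exists by blast
      have spC: "cseq.span C \<subseteq> W'" by (rule cseq.span_minimal[OF C(1) W'])
      have "x0 \<notin> cseq.span C" using spC ia unfolding W'_def by auto
      then have ind: "cseq.independent (insert x0 C)" by (rule cseq.independent_insertI[OF _ C(2)])
      have finC: "finite C"
        using cseq.independent_span_bound[OF fin C(2)] C(1) sub less.prems(2) by auto
      obtain E where E: "E \<subseteq> W" "cseq.independent E" "W \<subseteq> cseq.span E" "card E = cseq.dim W"
        using cseq.basis_exists by blast
      have finE: "finite E"
        using cseq.independent_span_bound[OF fin E(2)] E(1) less.prems(2) by auto
      have "card (insert x0 C) \<le> card E"
        using cseq.independent_span_bound[OF finE ind] C(1) sub x0(1) E(3) by auto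
      moreover have "x0 \<notin> C" using \<open>x0 \<notin> cseq.span C\<close> cseq.span_base by blast
      ultimately have "cseq.dim W' < cseq.dim W" using finC C(4) E(4) by simp
      from less.hyps[OF this W'] sub less.prems(2) obtain Q b where Q: "finite Q" "\<forall>q\<in>Q. b q \<in> W'"
        "\<forall>x\<in>W'. x = (\<Sum>q\<in>Q. cscale (x (fst q) $ snd q) (b q))" by blast
      define r where "r = cscale (1 / x0 i $ a) x0"
      have r: "r \<in> W" "r i $ a = 1" unfolding r_def
        using cseq.subspace_scale[OF less.prems(1) x0(1)] ia by simp_all
      have key: "x = cscale (x i $ a) (r - (\<Sum>q\<in>Q. cscale (r (fst q) $ snd q) (b q)))
          + (\<Sum>q\<in>Q. cscale (x (fst q) $ snd q) (b q))" if x: "x \<in> W" for x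
      proof -
        let ?y = "x - cscale (x i $ a) r"
        have "?y \<in> W" by (intro cseq.subspace_diff cseq.subspace_scale less.prems(1) x r(1))
        then have "?y \<in> W'" unfolding W'_def using r(2) by simp
        then have "?y = (\<Sum>q\<in>Q. cscale (?y (fst q) $ snd q) (b q))" using Q(3) by blast
        also have "\<dots> = (\<Sum>q\<in>Q. cscale (x (fst q) $ snd q) (b q))
            - cscale (x i $ a) (\<Sum>q\<in>Q. cscale (r (fst q) $ snd q) (b q))"
          unfolding fun_eq_iff vec_eq_iff
          by (simp add: sum_seq_apply left_diff_distrib sum_subtractf sum_distrib_left mult.assoc)
        finally show ?thesis unfolding fun_eq_iff vec_eq_iff
          by (simp add: algebra_simps)
      qed
      define r' where "r' = r - (\<Sum>q\<in>Q. cscale (r (fst q) $ snd q) (b q))"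
      have Qb: "b q \<in> W" if "q \<in> Q" for q using Q(2) sub that by blast
      have r': "r' \<in> W" unfolding r'_def
        by (intro cseq.subspace_diff cseq.subspace_sum cseq.subspace_scale less.prems(1) r(1) Qb)
      show ?thesis
      proof (cases "(i, a) \<in> Q")
        \<comment> \<open>The pivot may recur among the coordinates of the smaller space; then the
          two contributions are merged.\<close>
        case True
        define b' where "b' = (\<lambda>q. if q = (i, a) then b q + r' else b q)"
        have "x = (\<Sum>q\<in>Q. cscale (x (fst q) $ snd q) (b' q))" if x: "x \<in> W" for x
        proof -
          have "(\<Sum>q\<in>Q. cscale (x (fst q) $ snd q) (b' q)) =
             (\<Sum>q\<in>Q. (if q = (i, a) then cscale (x i $ a) r' else 0) + cscale (x (fst q) $ snd q) (b q))"
            unfolding b'_def by (intro sum.cong refl ext) (simp add: vec.scale_right_distrib)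
          also have "\<dots> = cscale (x i $ a) r' + (\<Sum>q\<in>Q. cscale (x (fst q) $ snd q) (b q))"
            using True Q(1) by (simp add: sum.distrib)
          finally show ?thesis using key[OF x] unfolding r'_def by simp
        qed
        moreover have "\<forall>q\<in>Q. b' q \<in> W"
          using Qb r' cseq.subspace_add[OF less.prems(1)] unfolding b'_def
          by (simp del: plus_fun_apply)
        ultimately show ?thesis using Q(1) by blast
      next
        case False
        define b' where "b' = (\<lambda>q. if q = (i, a) then r' else b q)"
        have "x = (\<Sum>q\<in>insert (i, a) Q. cscale (x (fst q) $ snd q) (b' q))" if x: "x \<in> W" for x
        proof -
          have "(\<Sum>q\<in>Q. cscale (x (fst q) $ snd q) (b' q)) = (\<Sum>q\<in>Q. cscale (x (fst q) $ snd q) (b q))"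
            using False by (intro sum.cong) (auto simp: b'_def)
          then have "(\<Sum>q\<in>insert (i, a) Q. cscale (x (fst q) $ snd q) (b' q)) =
             cscale (x i $ a) r' + (\<Sum>q\<in>Q. cscale (x (fst q) $ snd q) (b q))"
            using False Q(1) by (simp add: b'_def)
          then show ?thesis using key[OF x] unfolding r'_def by simp
        qed
        moreover have "\<forall>q\<in>insert (i, a) Q. b' q \<in> W" using Qb r' by (auto simp: b'_def)
        ultimately show ?thesis using Q(1) by (intro exI[of _ "insert (i, a) Q"] exI[of _ b'] conjI ballI) (simp, simp, metis)
      qed
    qed
  qed
  then obtain Q b where Q: "finite Q" "\<forall>q\<in>Q. b q \<in> W"
      "\<forall>x\<in>W. x = (\<Sum>q\<in>Q. cscale (x (fst q) $ snd q) (b q))" by (elim exE conjE)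
  show ?thesis
  proof (rule that[of Q b])
    show "\<And>q. q \<in> Q \<Longrightarrow> b q \<in> W" using Q(2) by (rule bspec)
    show "\<And>x. x \<in> W \<Longrightarrow> x = (\<Sum>q\<in>Q. cscale (x (fst q) $ snd q) (b q))"
      using Q(3) by (rule bspec)
  qed (rule Q(1))
qed

section \<open>Bounded block matrices on square summable sequences\<close>

definition cdot :: "complex ^ 'k \<Rightarrow> complex ^ 'k \<Rightarrow> complex"
  where "cdot x y = (\<Sum>i\<in>UNIV. x $ i * cnj (y $ i))"

lemma norm_sum_mult_le_norm_vec:
  fixes x y :: "complex ^ 'k"
  shows "(\<Sum>i\<in>UNIV. cmod (x $ i) * cmod (y $ i)) \<le> norm x * norm y"
  using L2_set_mult_ineq[of "\<lambda>i. cmod (x $ i)" "\<lambda>i. cmod (y $ i)" UNIV]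
  by (simp add: norm_vec_def)

lemma norm_cdot_le: "cmod (cdot x y) \<le> norm x * norm y"
proof -
  have "cmod (cdot x y) \<le> (\<Sum>i\<in>UNIV. cmod (x $ i) * cmod (y $ i))"
    unfolding cdot_def by (rule order_trans[OF norm_sum]) (simp add: norm_mult)
  then show ?thesis using norm_sum_mult_le_norm_vec order_trans by blast
qed

lemma cdot_self: "cdot x x = of_real ((norm x)\<^sup>2)"
  by (simp add: cdot_def norm_vec_def L2_set_def sum_nonneg complex_norm_square del: of_real_power)

lemma cdot_add_left: "cdot (x + y) z = cdot x z + cdot y z"
  and cdot_diff_left: "cdot (x - y) z = cdot x z - cdot y z"
  and cdot_scale_left: "cdot (c *s x) z = c * cdot x z"
  and cdot_commute: "cdot y x = cnj (cdot x y)"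
  by (simp_all add: cdot_def algebra_simps sum.distrib sum_subtractf sum_distrib_left)

lemma cdot_axis_right: "cdot x (axis k 1) = x $ k"
  by (simp add: cdot_def axis_def if_distrib[of cnj] if_distrib[of "\<lambda>z. _ * z"] cong: if_cong)

lemma norm_matrix_vector_mult_le:
  fixes A :: "complex ^ 'p ^ 'm"
  shows "norm (A *v x) \<le> norm A * norm x"
proof -
  have "cmod ((A *v x) $ i) \<le> norm (A $ i) * norm x" for i
  proof -
    have "cmod ((A *v x) $ i) \<le> (\<Sum>j\<in>UNIV. cmod (A $ i $ j) * cmod (x $ j))"
      unfolding matrix_vector_mult_def by (simp, rule order_trans[OF norm_sum]) (simp add: norm_mult)
    then show ?thesis using norm_sum_mult_le_norm_vec order_trans by blast
  qed
  then have "norm (A *v x) \<le> L2_set (\<lambda>i. norm (A $ i) * norm x) UNIV"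
    unfolding norm_vec_def[of "A *v x"] by (intro L2_set_mono) auto
  also have "\<dots> = norm A * norm x"
    unfolding norm_vec_def[of A] by (simp add: L2_set_left_distrib)
  finally show ?thesis .
qed

lemma norm_mat_adj: "norm (mat_adj A) = norm A"
proof -
  have "(norm (mat_adj A))\<^sup>2 = (norm A)\<^sup>2"
    by (simp add: norm_vec_def L2_set_def sum_nonneg mat_adj_def) (rule sum.swap)
  then show ?thesis by simp
qed

lemma mat_adj_mat_adj [simp]: "mat_adj (mat_adj A) = A"
  by (simp add: mat_adj_def vec_eq_iff)

lemma cdot_mat_adj: "cdot (A *v x) y = cdot x (mat_adj A *v y)"
  unfolding cdot_def matrix_vector_mult_def mat_adj_def
  by (simp add: sum_distrib_left sum_distrib_right mult_ac) (rule sum.swap)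

text \<open>
  Bounded rectangular partial sums of the norms are what the Schur test delivers, hence this
  form of the Fubini theorem.
\<close>
lemma suminf_swap_nat:
  fixes f :: "nat \<Rightarrow> nat \<Rightarrow> 'a :: banach"
  assumes C: "\<And>I J. (\<Sum>i<I. \<Sum>j<J. norm (f i j)) \<le> C"
  shows "(\<Sum>i. \<Sum>j. f i j) = (\<Sum>j. \<Sum>i. f i j)"
proof -
  have "(\<lambda>x. norm (case x of (i, j) \<Rightarrow> f i j)) summable_on (UNIV \<times> UNIV)"
  proof (rule nonneg_bdd_above_summable_on)
    show "bdd_above (sum (\<lambda>x. norm (case x of (i, j) \<Rightarrow> f i j)) ` {F. F \<subseteq> UNIV \<times> UNIV \<and> finite F})"
    proof (rule bdd_aboveI2)
      fix F :: "(nat \<times> nat) set" assume "F \<in> {F. F \<subseteq> UNIV \<times> UNIV \<and> finite F}"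
      then have fin: "finite F" by simp
      obtain N where N: "\<And>x. x \<in> fst ` F \<union> snd ` F \<Longrightarrow> x < N"
        using finite_nat_bounded[of "fst ` F \<union> snd ` F"] fin by auto
      have "F \<subseteq> {..<N} \<times> {..<N}" using N by force
      then have "(\<Sum>x\<in>F. norm (case x of (i, j) \<Rightarrow> f i j))
          \<le> (\<Sum>x\<in>{..<N} \<times> {..<N}. norm (case x of (i, j) \<Rightarrow> f i j))"
        by (intro sum_mono2) auto
      also have "\<dots> = (\<Sum>i<N. \<Sum>j<N. norm (f i j))" by (simp add: sum.cartesian_product split_def)
      also have "\<dots> \<le> C" by (rule C)
      finally show "(\<Sum>x\<in>F. norm (case x of (i, j) \<Rightarrow> f i j)) \<le> C" .
    qed
  qed simp
  note abs = this
  then have ab: "(\<lambda>(i, j). f i j) summable_on (UNIV \<times> UNIV)" by (rule abs_summable_summable)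
  have abs': "(\<lambda>x. norm (case x of (j, i) \<Rightarrow> f i j)) summable_on (UNIV \<times> UNIV)"
    using abs summable_on_swap[of "\<lambda>x. norm (case x of (i, j) \<Rightarrow> f i j)" UNIV UNIV]
    by (simp add: split_def)
  then have ba: "(\<lambda>(j, i). f i j) summable_on (UNIV \<times> UNIV)" by (rule abs_summable_summable)
  have row: "f i summable_on UNIV" for i
    using abs Infinite_Sum.abs_summable_on_Sigma_iff[where f = "\<lambda>(i, j). f i j"
      and A = UNIV and B = "\<lambda>_. UNIV"]
    by (auto intro: abs_summable_summable)
  have col: "(\<lambda>i. f i j) summable_on UNIV" for j
    using abs' Infinite_Sum.abs_summable_on_Sigma_iff[where f = "\<lambda>(j, i). f i j"
      and A = UNIV and B = "\<lambda>_. UNIV"]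
    by (auto intro: abs_summable_summable)
  have conv: "infsum g UNIV = suminf g" if "g summable_on UNIV" for g :: "nat \<Rightarrow> 'a"
    using has_sum_imp_sums[OF has_sum_infsum[OF that]] by (simp add: sums_iff)
  have r2: "(\<lambda>i. infsum (f i) UNIV) summable_on UNIV" using summable_on_Sigma_banach[OF ab] by simp
  have c2: "(\<lambda>j. infsum (\<lambda>i. f i j) UNIV) summable_on UNIV" using summable_on_Sigma_banach[OF ba] by simp
  have "infsum (\<lambda>i. infsum (\<lambda>j. f i j) UNIV) UNIV = infsum (\<lambda>j. infsum (\<lambda>i. f i j) UNIV) UNIV"
    by (rule infsum_swap_banach) (use ab in simp)
  then show "(\<Sum>i. \<Sum>j. f i j) = (\<Sum>j. \<Sum>i. f i j)"
    using conv[OF r2] conv[OF c2] by (simp add: conv[OF row] conv[OF col])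
qed

subsection \<open>Square summable sequences\<close>

definition sqnorm :: "(nat \<Rightarrow> complex ^ 'k) \<Rightarrow> real"
  where "sqnorm u = (\<Sum>n. (norm (u n))\<^sup>2)"

lemma ell2_summable: "u \<in> ell2 \<Longrightarrow> summable (\<lambda>n. (norm (u n))\<^sup>2)"
  by (simp add: ell2_def)

lemma sum_le_sqnorm: "u \<in> ell2 \<Longrightarrow> (\<Sum>n<N. (norm (u n))\<^sup>2) \<le> sqnorm u"
  unfolding sqnorm_def by (intro sum_le_suminf ell2_summable) auto

lemma sqnorm_nonneg: "u \<in> ell2 \<Longrightarrow> 0 \<le> sqnorm u"
  unfolding sqnorm_def by (intro suminf_nonneg ell2_summable) auto

lemma norm_le_sqnorm: "u \<in> ell2 \<Longrightarrow> (norm (u n))\<^sup>2 \<le> sqnorm u"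
  using sum_le_suminf[OF ell2_summable, of u "{n}"] unfolding sqnorm_def by simp

lemma ell2I: "(\<And>N. (\<Sum>n<N. (norm (u n))\<^sup>2) \<le> C) \<Longrightarrow> u \<in> ell2"
  unfolding ell2_def mem_Collect_eq
  by (rule bounded_imp_summable[of _ C]) (simp_all only: lessThan_Suc_atMost[symmetric] zero_le_power2)

lemma mult_le_half_squares: "a * b \<le> (a\<^sup>2 + b\<^sup>2) / (2 :: real)"
  using sum_squares_bound[of a b] by simp

lemma ell2_product_summable:
  assumes "u \<in> ell2" "v \<in> ell2"
  shows "summable (\<lambda>n. norm (u n) * norm (v n))"
proof (rule summable_comparison_test')
  show "summable (\<lambda>n. ((norm (u n))\<^sup>2 + (norm (v n))\<^sup>2) / 2)"
    using assms by (intro summable_divide summable_add ell2_summable)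
  show "norm (norm (u n) * norm (v n)) \<le> ((norm (u n))\<^sup>2 + (norm (v n))\<^sup>2) / 2" for n
    using mult_le_half_squares[of "norm (u n)" "norm (v n)"] by simp
qed

lemma ell2_inner_cdot: "ell2_inner u v = (\<Sum>n. cdot (u n) (v n))"
  unfolding ell2_inner_def cdot_def ..

lemma cdot_summable:
  assumes "u \<in> ell2" "v \<in> ell2"
  shows "summable (\<lambda>n. cdot (u n) (v n))"
  by (rule summable_comparison_test'[OF ell2_product_summable[OF assms]]) (rule norm_cdot_le)

lemma ell2_subspace: "cseq.subspace ell2"
proof (rule cseq.subspaceI)
  show "0 \<in> ell2" by (simp add: ell2_def)
next
  fix u v :: "nat \<Rightarrow> complex ^ 'k" assume uv: "u \<in> ell2" "v \<in> ell2"
  have "norm ((norm ((u + v) n))\<^sup>2) \<le> 2 * ((norm (u n))\<^sup>2 + (norm (v n))\<^sup>2)" for n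
  proof -
    have "(norm ((u + v) n))\<^sup>2 \<le> (norm (u n) + norm (v n))\<^sup>2"
      by (intro power_mono) (auto intro: norm_triangle_ineq)
    then show ?thesis using sum_squares_bound[of "norm (u n)" "norm (v n)"] by (simp add: power2_sum)
  qed
  moreover have "summable (\<lambda>n. 2 * ((norm (u n))\<^sup>2 + (norm (v n))\<^sup>2))"
    using uv by (intro summable_mult summable_add ell2_summable)
  ultimately show "u + v \<in> ell2"
    unfolding ell2_def mem_Collect_eq by (rule summable_comparison_test'[rotated])
next
  fix c and u :: "nat \<Rightarrow> complex ^ 'k" assume "u \<in> ell2"
  moreover have "norm (c *s u n) = cmod c * norm (u n)" for n
    by (simp add: norm_vec_def norm_mult L2_set_right_distrib)
  ultimately show "cscale c u \<in> ell2"
    by (simp add: ell2_def power_mult_distrib summable_mult)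
qed

lemmas ell2_add = cseq.subspace_add[OF ell2_subspace]
  and ell2_diff = cseq.subspace_diff[OF ell2_subspace]
  and ell2_scale = cseq.subspace_scale[OF ell2_subspace]

lemma ell2_inner_add_left:
  "u \<in> ell2 \<Longrightarrow> v \<in> ell2 \<Longrightarrow> w \<in> ell2 \<Longrightarrow> ell2_inner (u + v) w = ell2_inner u w + ell2_inner v w"
  by (simp add: ell2_inner_cdot cdot_add_left suminf_add cdot_summable)

lemma ell2_inner_diff_left:
  "u \<in> ell2 \<Longrightarrow> v \<in> ell2 \<Longrightarrow> w \<in> ell2 \<Longrightarrow> ell2_inner (u - v) w = ell2_inner u w - ell2_inner v w"
  by (simp add: ell2_inner_cdot cdot_diff_left suminf_diff cdot_summable)

lemma ell2_inner_scale_left: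
  "u \<in> ell2 \<Longrightarrow> w \<in> ell2 \<Longrightarrow> ell2_inner (cscale c u) w = c * ell2_inner u w"
  by (simp add: ell2_inner_cdot cdot_scale_left suminf_mult cdot_summable)

lemma ell2_inner_commute:
  assumes "u \<in> ell2" "v \<in> ell2"
  shows "ell2_inner v u = cnj (ell2_inner u v)"
proof -
  have "(\<lambda>n. cdot (u n) (v n)) sums ell2_inner u v"
    unfolding ell2_inner_cdot using cdot_summable[OF assms] by (rule summable_sums)
  then have "(\<lambda>n. cnj (cdot (u n) (v n))) sums cnj (ell2_inner u v)" by (simp add: sums_cnj)
  then show ?thesis
    unfolding ell2_inner_cdot[of v u] cdot_commute[of "v _" "u _"] by (simp add: sums_iff)
qed

lemma ell2_inner_add_right:
  assumes "u \<in> ell2" "v \<in> ell2" "w \<in> ell2"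
  shows "ell2_inner w (u + v) = ell2_inner w u + ell2_inner w v"
  using ell2_inner_commute[of "u + v" w] ell2_inner_add_left[of u v w] assms
    ell2_inner_commute[of u w] ell2_inner_commute[of v w] ell2_add[of u v] by simp

lemma ell2_inner_scale_right:
  assumes "u \<in> ell2" "w \<in> ell2"
  shows "ell2_inner w (cscale c u) = cnj c * ell2_inner w u"
  using ell2_inner_commute[of "cscale c u" w] ell2_inner_scale_left[of u w c] assms
    ell2_inner_commute[of u w] ell2_scale[of u c] by simp

lemma ell2_inner_self: "u \<in> ell2 \<Longrightarrow> ell2_inner u u = of_real (sqnorm u)"
  unfolding ell2_inner_cdot sqnorm_def cdot_self by (intro suminf_of_real[symmetric] ell2_summable)

lemma sqnorm_eq_0D:
  assumes "u \<in> ell2" "sqnorm u = 0"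
  shows "u = 0"
proof (rule ext)
  fix n
  show "u n = 0 n" using norm_le_sqnorm[OF assms(1), of n] assms(2) by simp
qed

definition unit_seq :: "nat \<Rightarrow> 'k \<Rightarrow> nat \<Rightarrow> complex ^ 'k"
  where "unit_seq n k = (\<lambda>i. if i = n then axis k 1 else 0)"

lemma unit_seq_ell2: "unit_seq n k \<in> ell2"
  unfolding ell2_def mem_Collect_eq unit_seq_def
  by (rule summable_finite[of "{n}"]) auto

lemma ell2_inner_unit_seq: "ell2_inner u (unit_seq n k) = u n $ k"
proof -
  have "(\<Sum>i. cdot (u i) (unit_seq n k i)) = (\<Sum>i\<in>{n}. cdot (u i) (unit_seq n k i))"
    by (rule suminf_finite) (auto simp: unit_seq_def cdot_def)
  then show ?thesis by (simp add: ell2_inner_cdot unit_seq_def cdot_axis_right)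
qed

lemma ell2_tendsto_0:
  assumes "u \<in> ell2"
  shows "(\<lambda>n. u n) \<longlonglongrightarrow> 0"
proof -
  have "(\<lambda>n. sqrt ((norm (u n))\<^sup>2)) \<longlonglongrightarrow> sqrt 0"
    by (intro tendsto_real_sqrt summable_LIMSEQ_zero ell2_summable assms)
  then show ?thesis by (simp add: tendsto_norm_zero_iff)
qed

subsection \<open>The Schur test\<close>

text \<open>
  The hypothesis of the Schur test, with one bound for rows and columns so that it is preserved
  by the adjoint.
\<close>
definition schur_bounded :: "(nat \<Rightarrow> nat \<Rightarrow> complex ^ 'p ^ 'm) \<Rightarrow> real \<Rightarrow> bool"
  where "schur_bounded A M \<longleftrightarrow> 0 \<le> M \<and>
    (\<forall>i n. (\<Sum>j<n. norm (A i j)) \<le> M) \<and> (\<forall>j n. (\<Sum>i<n. norm (A i j)) \<le> M)"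

definition block_adj :: "(nat \<Rightarrow> nat \<Rightarrow> complex ^ 'p ^ 'm) \<Rightarrow> nat \<Rightarrow> nat \<Rightarrow> complex ^ 'm ^ 'p"
  where "block_adj A i j = mat_adj (A j i)"

lemma schur_bounded_adj: "schur_bounded A M \<Longrightarrow> schur_bounded (block_adj A) M"
  by (simp add: schur_bounded_def block_adj_def norm_mat_adj)

lemma block_adj_block_adj [simp]: "block_adj (block_adj A) = A"
  by (simp add: block_adj_def fun_eq_iff)

lemma schur_norm_le:
  assumes "schur_bounded A M"
  shows "norm (A i j) \<le> M"
proof -
  have "norm (A i j) \<le> (\<Sum>j<Suc j. norm (A i j))" by (simp add: sum_nonneg)
  also have "\<dots> \<le> M" using assms unfolding schur_bounded_def by blast
  finally show ?thesis .
qed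

lemma schur_row_summable:
  assumes "schur_bounded A M"
  shows "summable (\<lambda>j. norm (A i j))"
  using assms unfolding schur_bounded_def
  by (intro bounded_imp_summable[of _ M]) (simp_all only: lessThan_Suc_atMost[symmetric] norm_ge_zero)

lemma schur_summable:
  assumes A: "schur_bounded A M" and u: "u \<in> ell2"
  shows "summable (\<lambda>j. norm (A i j) * norm (u j))" "summable (\<lambda>j. A i j *v u j)"
proof -
  show s: "summable (\<lambda>j. norm (A i j) * norm (u j))"
  proof (rule summable_comparison_test')
    show "summable (\<lambda>j. norm (A i j) * (sqrt (sqnorm u)))"
      by (intro summable_mult2 schur_row_summable[OF A])
    show "norm (norm (A i j) * norm (u j)) \<le> norm (A i j) * sqrt (sqnorm u)" for j
      using real_le_rsqrt[OF norm_le_sqnorm[OF u]] by (simp add: mult_left_mono)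
  qed
  show "summable (\<lambda>j. A i j *v u j)"
    by (rule summable_comparison_test'[OF s]) (rule norm_matrix_vector_mult_le)
qed

text \<open>
  Writing \<open>a x\<close> as \<open>sqrt a * (sqrt a * x)\<close> and applying the
  Cauchy--Schwarz inequality to a row bounds the squared norm of an output by the row sum times
  \<open>\<Sum>j. norm (A i j) * (norm (u j))\<^sup>2\<close>; the column sums control the sum
  of the latter over all rows.
\<close>
lemma block_op_ell2:
  assumes A: "schur_bounded A M" and u: "u \<in> ell2"
  shows "block_op A u \<in> ell2"
proof -
  have M0: "0 \<le> M" using A by (simp add: schur_bounded_def)
  have s2: "summable (\<lambda>j. norm (A i j) * (norm (u j))\<^sup>2)" for i
  proof (rule summable_comparison_test')
    show "summable (\<lambda>j. M * (norm (u j))\<^sup>2)" by (intro summable_mult ell2_summable u)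
    show "norm (norm (A i j) * (norm (u j))\<^sup>2) \<le> M * (norm (u j))\<^sup>2" for j
      using schur_norm_le[OF A] by (simp add: mult_right_mono)
  qed
  have row: "(norm (block_op A u i))\<^sup>2 \<le> M * (\<Sum>j. norm (A i j) * (norm (u j))\<^sup>2)" for i
  proof -
    have part: "(norm (\<Sum>j<n. A i j *v u j))\<^sup>2 \<le> M * (\<Sum>j. norm (A i j) * (norm (u j))\<^sup>2)" for n
    proof -
      have "(norm (\<Sum>j<n. A i j *v u j)) \<le> (\<Sum>j<n. norm (A i j) * norm (u j))"
        by (intro order_trans[OF norm_sum] sum_mono norm_matrix_vector_mult_le)
      then have "(norm (\<Sum>j<n. A i j *v u j))\<^sup>2 \<le> (\<Sum>j<n. norm (A i j) * norm (u j))\<^sup>2"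
        by (intro power_mono) auto
      also have "\<dots> = (\<Sum>j<n. sqrt (norm (A i j)) * (sqrt (norm (A i j)) * norm (u j)))\<^sup>2"
        by (simp add: mult.assoc[symmetric])
      also have "\<dots> \<le> (\<Sum>j<n. (sqrt (norm (A i j)))\<^sup>2) * (\<Sum>j<n. (sqrt (norm (A i j)) * norm (u j))\<^sup>2)"
        by (rule Cauchy_Schwarz_ineq_sum)
      also have "\<dots> = (\<Sum>j<n. norm (A i j)) * (\<Sum>j<n. norm (A i j) * (norm (u j))\<^sup>2)"
        by (simp add: power_mult_distrib)
      also have "\<dots> \<le> M * (\<Sum>j. norm (A i j) * (norm (u j))\<^sup>2)"
        using A M0 by (intro mult_mono sum_le_suminf s2 sum_nonneg) (auto simp: schur_bounded_def)
      finally show ?thesis .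
    qed
    have "(\<lambda>n. (norm (\<Sum>j<n. A i j *v u j))\<^sup>2) \<longlonglongrightarrow> (norm (block_op A u i))\<^sup>2"
      unfolding block_op_def by (intro tendsto_intros summable_LIMSEQ schur_summable[OF A u])
    then show ?thesis by (rule LIMSEQ_le_const2) (use part in blast)
  qed
  have "(\<Sum>i<N. (norm (block_op A u i))\<^sup>2) \<le> M * (M * sqnorm u)" for N
  proof -
    have "(\<Sum>i<N. (norm (block_op A u i))\<^sup>2) \<le> (\<Sum>i<N. M * (\<Sum>j. norm (A i j) * (norm (u j))\<^sup>2))"
      by (intro sum_mono row)
    also have "\<dots> = M * (\<Sum>j. \<Sum>i<N. norm (A i j) * (norm (u j))\<^sup>2)"
      by (simp add: sum_distrib_left suminf_sum s2)
    also have "(\<Sum>j. \<Sum>i<N. norm (A i j) * (norm (u j))\<^sup>2) \<le> (\<Sum>j. M * (norm (u j))\<^sup>2)"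
    proof (rule suminf_le)
      show "(\<Sum>i<N. norm (A i j) * (norm (u j))\<^sup>2) \<le> M * (norm (u j))\<^sup>2" for j
        using A by (auto simp: sum_distrib_right[symmetric] schur_bounded_def intro!: mult_right_mono)
      show "summable (\<lambda>j. \<Sum>i<N. norm (A i j) * (norm (u j))\<^sup>2)" by (intro summable_sum s2)
      show "summable (\<lambda>j. M * (norm (u j))\<^sup>2)" by (intro summable_mult ell2_summable u)
    qed
    also have "\<dots> = M * sqnorm u" unfolding sqnorm_def by (intro suminf_mult ell2_summable u)
    finally show ?thesis using M0 by (simp add: mult_left_mono)
  qed
  then show ?thesis by (rule ell2I)
qed

text \<open>
  The double series converges absolutely because \<open>norm (A i j) * norm (u j) * norm (v
  i)\<close> is at most \<open>norm (A i j)\<close> times the mean of the two squares, which the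
  row and column bounds sum up.
\<close>
lemma ell2_inner_block_op:
  assumes A: "schur_bounded A M" and u: "u \<in> ell2" and v: "v \<in> ell2"
  shows "ell2_inner (block_op A u) v = ell2_inner u (block_op (block_adj A) v)"
proof -
  let ?f = "\<lambda>i j. cdot (A i j *v u j) (v i)"
  have M0: "0 \<le> M" using A by (simp add: schur_bounded_def)
  have bd: "(\<Sum>i<I. \<Sum>j<J. norm (?f i j)) \<le> M * sqnorm u / 2 + M * sqnorm v / 2" for I J
  proof -
    have "norm (?f i j) \<le> norm (A i j) * (norm (u j))\<^sup>2 / 2 + norm (A i j) * (norm (v i))\<^sup>2 / 2" for i j
    proof -
      have "norm (?f i j) \<le> norm (A i j) * norm (u j) * norm (v i)"
        by (intro order_trans[OF norm_cdot_le] mult_right_mono norm_matrix_vector_mult_le) auto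
      also have "\<dots> = norm (A i j) * (norm (u j) * norm (v i))" by simp
      also have "\<dots> \<le> norm (A i j) * (((norm (u j))\<^sup>2 + (norm (v i))\<^sup>2) / 2)"
        by (intro mult_left_mono mult_le_half_squares) auto
      finally show ?thesis by (simp add: algebra_simps add_divide_distrib)
    qed
    then have "(\<Sum>i<I. \<Sum>j<J. norm (?f i j)) \<le>
       (\<Sum>i<I. \<Sum>j<J. norm (A i j) * (norm (u j))\<^sup>2 / 2 + norm (A i j) * (norm (v i))\<^sup>2 / 2)"
      by (intro sum_mono)
    also have "\<dots> = (\<Sum>j<J. (\<Sum>i<I. norm (A i j)) * (norm (u j))\<^sup>2) / 2
        + (\<Sum>i<I. (\<Sum>j<J. norm (A i j)) * (norm (v i))\<^sup>2) / 2"
      by (simp add: sum.distrib sum_distrib_right sum_divide_distrib)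
        (rule sum.swap)
    also have "\<dots> \<le> (\<Sum>j<J. M * (norm (u j))\<^sup>2) / 2 + (\<Sum>i<I. M * (norm (v i))\<^sup>2) / 2"
      using A by (intro add_mono divide_right_mono sum_mono mult_right_mono)
        (auto simp: schur_bounded_def)
    also have "\<dots> = M * (\<Sum>j<J. (norm (u j))\<^sup>2) / 2 + M * (\<Sum>i<I. (norm (v i))\<^sup>2) / 2"
      by (simp add: sum_distrib_left)
    also have "\<dots> \<le> M * sqnorm u / 2 + M * sqnorm v / 2"
      using M0 by (intro add_mono divide_right_mono mult_left_mono sum_le_sqnorm u v) auto
    finally show ?thesis .
  qed
  have lin: "bounded_linear (\<lambda>x. cdot x y)" for y :: "complex ^ 'l"
    by (rule bounded_linear_intro[of _ "norm y"])
      (simp_all only: cdot_add_left norm_cdot_le, simp add: cdot_def scaleR_sum_right)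
  have "ell2_inner (block_op A u) v = (\<Sum>i. \<Sum>j. ?f i j)"
    unfolding ell2_inner_cdot block_op_def
    by (intro suminf_cong bounded_linear.suminf[OF lin] schur_summable[OF A u])
  also have "\<dots> = (\<Sum>j. \<Sum>i. ?f i j)" by (rule suminf_swap_nat[OF bd])
  also have "\<dots> = ell2_inner u (block_op (block_adj A) v)"
    unfolding ell2_inner_cdot
  proof (rule suminf_cong)
    fix j
    have "(\<Sum>i. ?f i j) = (\<Sum>i. cnj (cdot (block_adj A j i *v v i) (u j)))"
      by (simp add: cdot_mat_adj block_adj_def cdot_commute[of "u _"])
    also have "\<dots> = cnj (\<Sum>i. cdot (block_adj A j i *v v i) (u j))"
      by (rule bounded_linear.suminf[OF bounded_linear_cnj, symmetric])
        (rule bounded_linear.summable[OF lin schur_summable(2)[OF schur_bounded_adj[OF A] v]])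
    also have "(\<Sum>i. cdot (block_adj A j i *v v i) (u j)) = cdot (block_op (block_adj A) v j) (u j)"
      unfolding block_op_def
      by (rule bounded_linear.suminf[OF lin schur_summable(2)[OF schur_bounded_adj[OF A] v], symmetric])
    finally show "(\<Sum>i. ?f i j) = cdot (u j) (block_op (block_adj A) v j)"
      by (simp add: cdot_commute[of "u j"])
  qed
  finally show ?thesis .
qed

lemma ell2_adj_block_op:
  assumes A: "schur_bounded A M" and v: "v \<in> ell2"
  shows "ell2_adj (block_op A) v = block_op (block_adj A) v"
  unfolding ell2_adj_def
proof (rule the_equality)
  let ?w = "block_op (block_adj A) v"
  show 1: "?w \<in> ell2 \<and> (\<forall>u\<in>ell2. ell2_inner (block_op A u) v = ell2_inner u ?w)"
    using block_op_ell2[OF schur_bounded_adj[OF A] v] ell2_inner_block_op[OF A _ v] by blast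
  fix w assume w: "w \<in> ell2 \<and> (\<forall>u\<in>ell2. ell2_inner (block_op A u) v = ell2_inner u w)"
  then have "ell2_inner w (unit_seq n k) = ell2_inner ?w (unit_seq n k)" for n k
    using 1 unit_seq_ell2 ell2_inner_commute by metis
  then show "w = ?w" by (simp add: ell2_inner_unit_seq fun_eq_iff vec_eq_iff)
qed

lemma linear_on_ell2_block_op:
  assumes A: "schur_bounded A M"
  shows "linear_on_set ell2 (block_op A)"
  unfolding linear_on_set_def
proof (intro conjI ballI allI)
  fix u v :: "nat \<Rightarrow> complex ^ 'a" assume "u \<in> ell2" "v \<in> ell2"
  then show "block_op A (u + v) = block_op A u + block_op A v"
    by (simp add: block_op_def fun_eq_iff matrix_vector_right_distrib suminf_add schur_summable[OF A])
next
  fix c and u :: "nat \<Rightarrow> complex ^ 'a" assume u: "u \<in> ell2"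
  have lin: "bounded_linear (\<lambda>x :: complex ^ 'b. c *s x)"
  proof (rule bounded_linear_intro[of _ "cmod c"])
    show "norm (c *s x) \<le> norm x * cmod c" for x :: "complex ^ 'b"
      by (simp add: norm_vec_def norm_mult L2_set_right_distrib mult.commute)
  qed (auto simp: vec.scale_right_distrib vec_eq_iff)
  show "block_op A (cscale c u) = cscale c (block_op A u)"
    using bounded_linear.suminf[OF lin schur_summable(2)[OF A u]]
    by (simp add: block_op_def fun_eq_iff vec.scale)
qed

section \<open>Selfadjoint operators of finite rank\<close>

definition gram_op :: "(nat \<Rightarrow> nat \<Rightarrow> complex ^ 'p ^ 'm) \<Rightarrow> (nat \<Rightarrow> complex ^ 'm) \<Rightarrow> (nat \<Rightarrow> complex ^ 'm)"
  where "gram_op A u = block_op A (block_op (block_adj A) u)"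

lemma linear_on_set_compose:
  "linear_on_set V S \<Longrightarrow> S ` V \<subseteq> W \<Longrightarrow> linear_on_set W T \<Longrightarrow> linear_on_set V (\<lambda>u. T (S u))"
  unfolding linear_on_set_def by (auto simp: image_subset_iff simp del: plus_fun_apply)

definition selfadjoint_op :: "((nat \<Rightarrow> complex ^ 'k) \<Rightarrow> (nat \<Rightarrow> complex ^ 'k)) \<Rightarrow> bool"
  where "selfadjoint_op E \<longleftrightarrow> E ` ell2 \<subseteq> ell2 \<and> linear_on_set ell2 E \<and>
    (\<forall>u\<in>ell2. \<forall>v\<in>ell2. ell2_inner (E u) v = ell2_inner u (E v))"

lemma selfadjoint_opD:
  assumes "selfadjoint_op E"
  shows "u \<in> ell2 \<Longrightarrow> E u \<in> ell2" "linear_on_set ell2 E"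
    "u \<in> ell2 \<Longrightarrow> v \<in> ell2 \<Longrightarrow> ell2_inner (E u) v = ell2_inner u (E v)"
  using assms unfolding selfadjoint_op_def by blast+

lemma selfadjoint_op_cong:
  assumes "selfadjoint_op F" and eq: "\<And>u. u \<in> ell2 \<Longrightarrow> E u = F u"
  shows "selfadjoint_op E"
  unfolding selfadjoint_op_def linear_on_set_def
proof (intro conjI ballI allI image_subsetI)
  fix u :: "nat \<Rightarrow> complex ^ 'a" assume u: "u \<in> ell2"
  note F = selfadjoint_opD[OF assms(1)]
  show "E u \<in> ell2" unfolding eq[OF u] by (rule F(1)[OF u])
  show "E (cscale c u) = cscale c (E u)" for c
    unfolding eq[OF u] eq[OF ell2_scale[OF u]] by (rule linear_on_setD(2)[OF F(2) u])
  fix v :: "nat \<Rightarrow> complex ^ 'a" assume v: "v \<in> ell2"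
  show "E (u + v) = E u + E v"
    unfolding eq[OF u] eq[OF v] eq[OF ell2_add[OF u v]] by (rule linear_on_setD(1)[OF F(2) u v])
  show "ell2_inner (E u) v = ell2_inner u (E v)"
    unfolding eq[OF u] eq[OF v] by (rule F(3)[OF u v])
qed

lemma selfadjoint_op_add:
  assumes E: "selfadjoint_op E" and F: "selfadjoint_op F"
  shows "selfadjoint_op (\<lambda>u. E u + F u)"
  unfolding selfadjoint_op_def linear_on_set_def
proof (intro conjI ballI allI image_subsetI)
  fix u :: "nat \<Rightarrow> complex ^ 'a" assume u: "u \<in> ell2"
  note EF = selfadjoint_opD(1)[OF E] selfadjoint_opD(1)[OF F]
  show "E u + F u \<in> ell2" by (intro ell2_add EF u)
  show "E (cscale c u) + F (cscale c u) = cscale c (E u + F u)" for c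
    unfolding linear_on_setD(2)[OF selfadjoint_opD(2)[OF E] u] linear_on_setD(2)[OF selfadjoint_opD(2)[OF F] u]
    by (simp add: fun_eq_iff vec.scale_right_distrib)
  fix v :: "nat \<Rightarrow> complex ^ 'a" assume v: "v \<in> ell2"
  show "E (u + v) + F (u + v) = E u + F u + (E v + F v)"
    unfolding linear_on_setD(1)[OF selfadjoint_opD(2)[OF E] u v] linear_on_setD(1)[OF selfadjoint_opD(2)[OF F] u v]
    by (simp add: algebra_simps)
  show "ell2_inner (E u + F u) v = ell2_inner u (E v + F v)"
    unfolding ell2_inner_add_left[OF EF[OF u] v] ell2_inner_add_right[OF EF[OF v] u]
    by (simp only: selfadjoint_opD(3)[OF E u v] selfadjoint_opD(3)[OF F u v])
qed

lemma selfadjoint_op_minus: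
  assumes E: "selfadjoint_op E"
  shows "selfadjoint_op (\<lambda>u. cscale (- 1) (E u))"
  unfolding selfadjoint_op_def linear_on_set_def
proof (intro conjI ballI allI image_subsetI)
  fix u :: "nat \<Rightarrow> complex ^ 'a" assume u: "u \<in> ell2"
  note Ee = selfadjoint_opD(1)[OF E]
  show "cscale (- 1) (E u) \<in> ell2" by (intro ell2_scale Ee u)
  show "cscale (- 1) (E (cscale c u)) = cscale c (cscale (- 1) (E u))" for c
    unfolding linear_on_setD(2)[OF selfadjoint_opD(2)[OF E] u] by (simp add: fun_eq_iff)
  fix v :: "nat \<Rightarrow> complex ^ 'a" assume v: "v \<in> ell2"
  show "cscale (- 1) (E (u + v)) = cscale (- 1) (E u) + cscale (- 1) (E v)"
    unfolding linear_on_setD(1)[OF selfadjoint_opD(2)[OF E] u v] by (simp add: fun_eq_iff)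
  show "ell2_inner (cscale (- 1) (E u)) v = ell2_inner u (cscale (- 1) (E v))"
    unfolding ell2_inner_scale_left[OF Ee[OF u] v] ell2_inner_scale_right[OF Ee[OF v] u]
    by (simp add: selfadjoint_opD(3)[OF E u v])
qed

lemma selfadjoint_op_diff:
  assumes E: "selfadjoint_op E" and F: "selfadjoint_op F"
  shows "selfadjoint_op (\<lambda>u. E u - F u)"
  using selfadjoint_op_add[OF E selfadjoint_op_minus[OF F]]
  by (rule selfadjoint_op_cong) (simp add: fun_eq_iff)

lemma gram_op_inner:
  assumes A: "schur_bounded A M" and u: "u \<in> ell2" and v: "v \<in> ell2"
  shows "ell2_inner (gram_op A u) v = ell2_inner (block_op (block_adj A) u) (block_op (block_adj A) v)"
  unfolding gram_op_def
  by (rule ell2_inner_block_op[OF A block_op_ell2[OF schur_bounded_adj[OF A] u] v])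

lemma selfadjoint_gram_op:
  assumes A: "schur_bounded A M"
  shows "selfadjoint_op (gram_op A)"
proof -
  note A' = schur_bounded_adj[OF A]
  have e: "gram_op A u \<in> ell2" if "u \<in> ell2" for u
    unfolding gram_op_def using block_op_ell2[OF A block_op_ell2[OF A' that]] .
  have "linear_on_set ell2 (gram_op A)"
    unfolding gram_op_def[abs_def]
    using linear_on_set_compose[OF linear_on_ell2_block_op[OF A'] _ linear_on_ell2_block_op[OF A]]
      block_op_ell2[OF A'] by blast
  moreover have "ell2_inner (gram_op A u) v = ell2_inner u (gram_op A v)" if "u \<in> ell2" "v \<in> ell2" for u v
  proof -
    have "ell2_inner u (gram_op A v) = cnj (ell2_inner (gram_op A v) u)"
      by (rule ell2_inner_commute[OF e[OF that(2)] that(1)])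
    also have "\<dots> = cnj (ell2_inner (block_op (block_adj A) v) (block_op (block_adj A) u))"
      by (simp only: gram_op_inner[OF A that(2,1)])
    also have "\<dots> = ell2_inner (block_op (block_adj A) u) (block_op (block_adj A) v)"
      by (rule ell2_inner_commute[symmetric]) (intro block_op_ell2[OF A'] that)+
    finally show ?thesis using gram_op_inner[OF A that] by simp
  qed
  ultimately show ?thesis using e unfolding selfadjoint_op_def by blast
qed

lemma ell2_inner_span_zero:
  assumes w: "w \<in> ell2" and B: "B \<subseteq> ell2" and 0: "\<forall>b\<in>B. ell2_inner w b = 0"
    and y: "y \<in> cseq.span B"
  shows "ell2_inner w y = 0"
proof -
  have "y \<in> ell2 \<and> ell2_inner w y = 0" using y
  proof (induction rule: cseq.span_induct_alt)
    case base
    show ?case using cseq.subspace_0[OF ell2_subspace]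
      by (auto simp: ell2_inner_cdot cdot_def zero_fun_def)
  next
    case (step c z v)
    then have z: "z \<in> ell2" using B by blast
    have "ell2_inner w (cscale c z + v) = cnj c * ell2_inner w z + ell2_inner w v"
      using ell2_inner_add_right[OF ell2_scale[OF z] _ w] ell2_inner_scale_right[OF z w]
        step by simp
    then show ?case using step 0 ell2_add[OF ell2_scale[OF z, of c], of v]
      by (simp del: plus_fun_apply)
  qed
  then show ?thesis by simp
qed

text \<open>
  Gram--Schmidt: the part \<open>d\<close> of the new vector that is orthogonal to the old ones
  is the only direction in which the approximation has to be corrected.
\<close>
lemma orthogonal_decomposition:
  assumes "finite B" "B \<subseteq> ell2" "u \<in> ell2"
  shows "\<exists>x\<in>cseq.span B. \<forall>b\<in>B. ell2_inner (u - x) b = 0"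
  using assms
proof (induction B arbitrary: u rule: finite_induct)
  case empty
  then show ?case using cseq.span_zero by auto
next
  case (insert b B)
  have sub: "cseq.span B \<subseteq> ell2" using insert.prems by (intro cseq.span_minimal ell2_subspace) auto
  have mono: "cseq.span B \<subseteq> cseq.span (insert b B)" by (intro cseq.span_mono) auto
  have b: "b \<in> ell2" and B: "B \<subseteq> ell2" using insert.prems by auto
  obtain y where y: "y \<in> cseq.span B" "\<forall>c\<in>B. ell2_inner (b - y) c = 0" using insert.IH[OF B b] by blast
  obtain x where x: "x \<in> cseq.span B" "\<forall>c\<in>B. ell2_inner (u - x) c = 0"
    using insert.IH[OF B insert.prems(2)] by blast
  define d where "d = b - y"
  have de: "d \<in> ell2" and xe: "x \<in> ell2" and ye: "y \<in> ell2"
    unfolding d_def using b x y sub by (auto intro: ell2_diff)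
  have ux: "u - x \<in> ell2" using insert.prems xe by (intro ell2_diff)
  have orth: "ell2_inner w y = 0" if "w \<in> ell2" "\<forall>c\<in>B. ell2_inner w c = 0" for w
    by (rule ell2_inner_span_zero[OF that(1) B that(2) y(1)])
  \<comment> \<open>If \<open>d = 0\<close> the new vector is redundant and no correction is
    needed.\<close>
  define t where "t = (if sqnorm d = 0 then 0 else ell2_inner (u - x) b / ell2_inner d b)"
  have db: "ell2_inner d b = of_real (sqnorm d)"
  proof -
    have "ell2_inner d d + ell2_inner d y = ell2_inner d (d + y)"
      using ell2_inner_add_right[OF de ye de] by simp
    moreover have "d + y = b" unfolding d_def by simp
    moreover have "ell2_inner d y = 0" using orth[OF de] y(2) unfolding d_def by blast
    ultimately show ?thesis using ell2_inner_self[OF de] by simp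
  qed
  let ?x = "x + cscale t d"
  have e: "ell2_inner (u - ?x) w = ell2_inner (u - x) w - t * ell2_inner d w" if "w \<in> ell2" for w
  proof -
    have "u - ?x = (u - x) - cscale t d" by (simp add: fun_eq_iff)
    then have "ell2_inner (u - ?x) w = ell2_inner ((u - x) - cscale t d) w" by (rule arg_cong)
    also have "\<dots> = ell2_inner (u - x) w - ell2_inner (cscale t d) w"
      by (rule ell2_inner_diff_left[OF ux ell2_scale[OF de] that])
    also have "\<dots> = ell2_inner (u - x) w - t * ell2_inner d w"
      by (simp only: ell2_inner_scale_left[OF de that])
    finally show ?thesis .
  qed
  have "ell2_inner (u - ?x) b = 0"
  proof (cases "sqnorm d = 0")
    case True
    then have "d = 0" using sqnorm_eq_0D[OF de] by blast
    then have "b = y" unfolding d_def by simp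
    then have "ell2_inner (u - x) b = 0" using orth[OF ux] x(2) by simp
    then show ?thesis using e[OF b] True db by simp
  next
    case False
    then show ?thesis using e[OF b] db unfolding t_def by simp
  qed
  moreover have "ell2_inner (u - ?x) c = 0" if "c \<in> B" for c
    using e[of c] that B x(2) y(2) unfolding d_def by auto
  moreover have "?x \<in> cseq.span (insert b B)"
    unfolding d_def using x(1) y(1) mono
    by (intro cseq.span_add cseq.span_scale cseq.span_diff) (auto intro: cseq.span_base)
  ultimately show ?case by blast
qed

text \<open>
  If \<open>X\<close> has finite dimension, every vector is the sum of one in the span of
  \<open>X\<close> and one orthogonal to \<open>X\<close>, and the operator does not see the
  latter.
\<close>
lemma edim_image_le_of_orthogonal_kernel:
  fixes X :: "(nat \<Rightarrow> complex ^ 'k) set"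
  assumes T: "linear_on_set ell2 T" and X: "X \<subseteq> ell2"
    and ker: "\<And>u. u \<in> ell2 \<Longrightarrow> (\<And>x. x \<in> X \<Longrightarrow> ell2_inner u x = 0) \<Longrightarrow> T u = 0"
  shows "cseq_edim (T ` ell2) \<le> cseq_edim X"
    and "cseq_edim X \<noteq> \<infinity> \<Longrightarrow> T ` ell2 = T ` cseq.span X"
proof -
  have *: "T ` ell2 = T ` cseq.span X \<and> cseq_edim (T ` ell2) \<le> cseq_edim X" if fin: "cseq_edim X \<noteq> \<infinity>"
  proof -
    obtain B where B: "B \<subseteq> X" "finite B" "X \<subseteq> cseq.span B"
      using cseq_edim_basis[OF fin] by metis
    have BE: "B \<subseteq> ell2" using B X by blast
    have sub: "cseq.span X \<subseteq> ell2" by (rule cseq.span_minimal[OF X ell2_subspace])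
    have spBX: "cseq.span B \<subseteq> cseq.span X" using B(1) by (rule cseq.span_mono)
    have "T u \<in> T ` cseq.span X" if u: "u \<in> ell2" for u
    proof -
      obtain x where x: "x \<in> cseq.span B" "\<forall>b\<in>B. ell2_inner (u - x) b = 0"
        using orthogonal_decomposition[OF B(2) BE u] by blast
      have xe: "x \<in> ell2" using x(1) spBX sub by blast
      have uxe: "u - x \<in> ell2" using u xe by (rule ell2_diff)
      have "ell2_inner (u - x) y = 0" if "y \<in> X" for y
        using ell2_inner_span_zero[OF uxe BE x(2)] that B(3) by blast
      then have "T (u - x) = 0" using ker[OF uxe] by blast
      then have "T u = T x" using linear_on_set_diff[OF T ell2_subspace u xe] by simp
      then show ?thesis using x(1) spBX by blast
    qed
    then have eq: "T ` ell2 = T ` cseq.span X" using sub by blast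
    have "cseq_edim (T ` cseq.span X) \<le> cseq_edim (cseq.span X)"
      by (rule cseq_edim_image_le[OF T ell2_subspace sub])
    then show ?thesis using eq by simp
  qed
  then show "cseq_edim (T ` ell2) \<le> cseq_edim X" by (cases "cseq_edim X = \<infinity>") auto
  show "cseq_edim X \<noteq> \<infinity> \<Longrightarrow> T ` ell2 = T ` cseq.span X" using * by blast
qed

lemma block_op_orthogonal_range:
  assumes A: "schur_bounded A M" and u: "u \<in> ell2"
    and orth: "\<And>x. x \<in> block_op A ` ell2 \<Longrightarrow> ell2_inner u x = 0"
  shows "block_op (block_adj A) u = 0"
proof (rule sqnorm_eq_0D)
  let ?w = "block_op (block_adj A) u"
  show w: "?w \<in> ell2" by (rule block_op_ell2[OF schur_bounded_adj[OF A] u])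
  have "ell2_inner ?w ?w = ell2_inner u (block_op A ?w)"
    using ell2_inner_block_op[OF schur_bounded_adj[OF A] u w] by simp
  also have "\<dots> = 0" using orth w by blast
  finally show "sqnorm ?w = 0" using ell2_inner_self[OF w] by simp
qed

lemma block_op_0: "block_op A 0 = 0"
  by (simp add: block_op_def fun_eq_iff)

text \<open>
  Every vector orthogonal to the range of \<open>A\<close> is killed by the adjoint, so only the
  range itself matters; there \<open>A A\<^sup>*\<close> is injective because \<open>A A\<^sup>*
  x = 0\<close> forces \<open>x\<close> to be orthogonal to the range.
\<close>
lemma rank_gram_op:
  assumes A: "schur_bounded A M"
  shows "ell2_rank (block_op A) \<noteq> \<infinity> \<Longrightarrow> ell2_rank (gram_op A) = ell2_rank (block_op A)"
proof -
  assume fin: "ell2_rank (block_op A) \<noteq> \<infinity>"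
  let ?X = "block_op A ` ell2"
  note lin = selfadjoint_opD(2)[OF selfadjoint_gram_op[OF A]]
  have X: "?X \<subseteq> ell2" using block_op_ell2[OF A] by blast
  have sub: "cseq.subspace ?X"
    by (rule subspace_linear_image[OF linear_on_ell2_block_op[OF A] ell2_subspace])
  have spX: "cseq.span ?X = ?X" using sub by simp
  have "gram_op A u = 0" if "u \<in> ell2" "\<And>x. x \<in> ?X \<Longrightarrow> ell2_inner u x = 0" for u
    unfolding gram_op_def using block_op_orthogonal_range[OF A that] block_op_0 by simp
  from edim_image_le_of_orthogonal_kernel(2)[OF lin X this] fin
  have "gram_op A ` ell2 = gram_op A ` ?X" unfolding ell2_rank_def using spX by simp
  moreover have "cseq_edim (gram_op A ` ?X) = cseq_edim ?X"
  proof (rule cseq_edim_image_inj[OF lin ell2_subspace X])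
    fix x assume "x \<in> cseq.span ?X" and 0: "gram_op A x = 0"
    then obtain v where v: "v \<in> ell2" "x = block_op A v" using spX by auto
    have x: "x \<in> ell2" using v block_op_ell2[OF A] by blast
    let ?w = "block_op (block_adj A) x"
    have w: "?w \<in> ell2" by (rule block_op_ell2[OF schur_bounded_adj[OF A] x])
    have "ell2_inner ?w ?w = ell2_inner 0 x" using gram_op_inner[OF A x x] 0 by simp
    then have "?w = 0" using ell2_inner_self[OF w] sqnorm_eq_0D[OF w]
      by (simp add: ell2_inner_cdot cdot_def)
    have "ell2_inner x x = ell2_inner v ?w" using ell2_inner_block_op[OF A v(1) x] v(2) by simp
    also have "\<dots> = 0" using \<open>?w = 0\<close> by (simp add: ell2_inner_cdot cdot_def)
    finally show "x = 0" using ell2_inner_self[OF x] sqnorm_eq_0D[OF x] by simp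
  qed
  ultimately show ?thesis unfolding ell2_rank_def by simp
qed

text \<open>
  The Cauchy--Schwarz inequality for the semidefinite form of \<open>E\<close>: perturbing
  \<open>u\<close> by \<open>t E u\<close> adds a term linear in \<open>t\<close> to the form,
  which would dominate for small negative \<open>t\<close>.
\<close>
lemma nonneg_hermitian_kernel:
  assumes sa: "selfadjoint_op E"
    and nn: "ell2_nonneg E" and u: "u \<in> ell2" and 0: "ell2_inner (E u) u = 0"
  shows "E u = 0"
proof (rule sqnorm_eq_0D)
  let ?v = "E u"
  note E = selfadjoint_opD(2,1)[OF sa] and herm = selfadjoint_opD(3)[OF sa]
  show v: "?v \<in> ell2" by (rule E(2)[OF u])
  obtain b where b: "ell2_inner (E ?v) ?v = of_real b" "b \<ge> 0"
    using nn v unfolding ell2_nonneg_def by (auto elim!: nonneg_Reals_cases)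
  have pos: "0 \<le> 2 * t * sqnorm ?v + t\<^sup>2 * b" for t :: real
  proof -
    let ?c = "complex_of_real t"
    let ?w = "u + cscale ?c ?v"
    note cv = ell2_scale[OF v, of ?c]
    have w: "?w \<in> ell2" by (rule ell2_add[OF u cv])
    have Ew: "E ?w = E u + cscale ?c (E ?v)"
      using linear_on_setD[OF E(1)] u v cv by simp
    have "ell2_inner (E ?w) ?w = ell2_inner (E u) ?w + ?c * ell2_inner (E ?v) ?w"
      unfolding Ew using ell2_inner_add_left[OF v ell2_scale[OF E(2)[OF v]] w]
        ell2_inner_scale_left[OF E(2)[OF v] w] by simp
    also have "ell2_inner (E u) ?w = ?c * ell2_inner (E u) ?v"
      using ell2_inner_add_right[OF u cv v] ell2_inner_scale_right[OF v v, of ?c] 0 by simp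
    also have "ell2_inner (E ?v) ?w = ell2_inner (E ?v) u + ?c * ell2_inner (E ?v) ?v"
      using ell2_inner_add_right[OF u cv E(2)[OF v]] ell2_inner_scale_right[OF v E(2)[OF v], of ?c] by simp
    also have "ell2_inner (E ?v) u = ell2_inner ?v ?v" using herm[OF v u] by simp
    also have "?c * ell2_inner ?v ?v + ?c * (ell2_inner ?v ?v + ?c * ell2_inner (E ?v) ?v) =
        of_real (2 * t * sqnorm ?v + t\<^sup>2 * b)"
      unfolding ell2_inner_self[OF v] b(1) by (simp add: power2_eq_square algebra_simps)
    finally have "ell2_inner (E ?w) ?w = of_real (2 * t * sqnorm ?v + t\<^sup>2 * b)" .
    moreover have "ell2_inner (E ?w) ?w \<in> \<real>\<^sub>\<ge>\<^sub>0" using nn w unfolding ell2_nonneg_def by blast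
    ultimately show ?thesis by (simp add: complex_nonneg_Reals_iff)
  qed
  have s: "0 \<le> sqnorm ?v" by (rule sqnorm_nonneg[OF v])
  show "sqnorm ?v = 0"
  proof (rule ccontr)
    assume "sqnorm ?v \<noteq> 0"
    then have s: "0 < sqnorm ?v" using s by simp
    \<comment> \<open>With \<open>b + 1\<close> instead of the optimal \<open>b\<close> the quotient
      makes sense also for \<open>b = 0\<close>.\<close>
    define t where "t = - sqnorm ?v / (b + 1)"
    have "2 * t * sqnorm ?v + t\<^sup>2 * b = - (sqnorm ?v)\<^sup>2 * (b + 2) / (b + 1)\<^sup>2"
      unfolding t_def using b(2) by (simp add: divide_simps power2_eq_square) (simp add: algebra_simps)
    also have "\<dots> < 0" using s b(2) by (simp add: divide_simps)
    finally show False using pos[of t] by simp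
  qed
qed

text \<open>
  On the orthogonal complement of the range of \<open>B\<close> the nonnegative forms of
  \<open>E\<close> and \<open>A A\<^sup>*\<close> add up to that of \<open>B B\<^sup>*\<close>,
  which is zero; so both operators vanish there and their ranks are at most that of
  \<open>B\<close>. The last inequality is the subadditivity of the rank.
\<close>
lemma rank_gram_difference:
  fixes A :: "nat \<Rightarrow> nat \<Rightarrow> complex ^ 'p ^ 'm" and B :: "nat \<Rightarrow> nat \<Rightarrow> complex ^ 'q ^ 'm"
  assumes A: "schur_bounded A M" and B: "schur_bounded B N"
    and E: "\<And>u. u \<in> ell2 \<Longrightarrow> E u = gram_op B u - gram_op A u" and nn: "ell2_nonneg E"
    and finA: "ell2_rank (block_op A) \<noteq> \<infinity>" and finB: "ell2_rank (block_op B) \<noteq> \<infinity>"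
  shows "ell2_rank (block_op A) \<le> ell2_rank (block_op B)"
    and "ell2_rank E \<le> ell2_rank (block_op B)"
    and "ell2_rank (block_op B) \<le> ell2_rank E + ell2_rank (block_op A)"
proof -
  note sA = selfadjoint_gram_op[OF A] and sB = selfadjoint_gram_op[OF B]
  let ?X = "block_op B ` ell2"
  have X: "?X \<subseteq> ell2" using block_op_ell2[OF B] by blast
  have sE: "selfadjoint_op E" using selfadjoint_op_diff[OF sB sA] E by (rule selfadjoint_op_cong)
  have ker: "E u = 0 \<and> gram_op A u = 0"
    if u: "u \<in> ell2" and orth: "\<And>x. x \<in> ?X \<Longrightarrow> ell2_inner u x = 0" for u
  proof -
    have "gram_op B u = 0"
      unfolding gram_op_def using block_op_orthogonal_range[OF B u orth] block_op_0 by simp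
    then have eq: "E u = - gram_op A u" using E[OF u] by simp
    let ?w = "block_op (block_adj A) u"
    have w: "?w \<in> ell2" by (rule block_op_ell2[OF schur_bounded_adj[OF A] u])
    have "ell2_inner (E u) u = - ell2_inner (gram_op A u) u"
      using ell2_inner_diff_left[OF cseq.subspace_0[OF ell2_subspace] selfadjoint_opD(1)[OF sA u] u] eq
      by (simp add: ell2_inner_cdot cdot_def)
    also have "\<dots> = - of_real (sqnorm ?w)"
      using gram_op_inner[OF A u u] ell2_inner_self[OF w] by simp
    finally have e: "ell2_inner (E u) u = - of_real (sqnorm ?w)" .
    moreover have "ell2_inner (E u) u \<in> \<real>\<^sub>\<ge>\<^sub>0" using nn u unfolding ell2_nonneg_def by blast
    ultimately have "sqnorm ?w = 0" using sqnorm_nonneg[OF w] by (simp add: complex_nonneg_Reals_iff)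
    then have "E u = 0" using nonneg_hermitian_kernel[OF sE nn u] e by simp
    then show ?thesis using eq by simp
  qed
  have "cseq_edim (gram_op A ` ell2) \<le> cseq_edim ?X"
    using ker by (intro edim_image_le_of_orthogonal_kernel(1)[OF selfadjoint_opD(2)[OF sA] X]) blast
  then show "ell2_rank (block_op A) \<le> ell2_rank (block_op B)"
    using rank_gram_op[OF A finA] unfolding ell2_rank_def by simp
  show "ell2_rank E \<le> ell2_rank (block_op B)"
    unfolding ell2_rank_def
    using ker by (intro edim_image_le_of_orthogonal_kernel(1)[OF selfadjoint_opD(2)[OF sE] X]) blast
  have "gram_op B ` ell2 \<subseteq> cseq.span (E ` ell2 \<union> gram_op A ` ell2)"
  proof (rule image_subsetI)
    fix u :: "nat \<Rightarrow> complex ^ 'm" assume u: "u \<in> ell2"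
    have "gram_op B u = E u + gram_op A u" using E[OF u] by simp
    then show "gram_op B u \<in> cseq.span (E ` ell2 \<union> gram_op A ` ell2)"
      using u cseq.span_add[OF cseq.span_base cseq.span_base] by (metis UnI1 UnI2 image_eqI)
  qed
  then have "cseq_edim (gram_op B ` ell2) \<le> cseq_edim (E ` ell2 \<union> gram_op A ` ell2)"
    by (rule cseq_edim_mono_span)
  also have "\<dots> \<le> cseq_edim (E ` ell2) + cseq_edim (gram_op A ` ell2)" by (rule cseq_edim_Un_le)
  finally show "ell2_rank (block_op B) \<le> ell2_rank E + ell2_rank (block_op A)"
    using rank_gram_op[OF A finA] rank_gram_op[OF B finB] unfolding ell2_rank_def by simp
qed

section \<open>Modules over the backward shift\<close>

text \<open>
  The columns of the block Hankel matrix with entries \<open>C (i + j + 1)\<close> are the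
  backward shifts of finitely many sequences, one for each column of the blocks. Their span is a
  module over the polynomials in the shift.
\<close>
definition shift_orbit :: "('i \<Rightarrow> nat \<Rightarrow> complex ^ 'k) \<Rightarrow> (nat \<Rightarrow> complex ^ 'k) set"
  where "shift_orbit f = range (\<lambda>(j, k). \<lambda>n. f k (n + j))"

abbreviation bshift :: "(nat \<Rightarrow> complex ^ 'k) \<Rightarrow> nat \<Rightarrow> complex ^ 'k"
  where "bshift u \<equiv> (\<lambda>n. u (Suc n))"

definition shift_invariant :: "(nat \<Rightarrow> complex ^ 'k) set \<Rightarrow> bool"
  where "shift_invariant W \<longleftrightarrow> cseq.subspace W \<and> (\<forall>u\<in>W. bshift u \<in> W)"

lemma shift_invariantD:
  "shift_invariant W \<Longrightarrow> cseq.subspace W"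
  "shift_invariant W \<Longrightarrow> u \<in> W \<Longrightarrow> bshift u \<in> W"
  by (simp_all add: shift_invariant_def)

lemma shift_invariant_span_orbit: "shift_invariant (cseq.span (shift_orbit f))"
  unfolding shift_invariant_def
proof (intro conjI ballI)
  fix u assume "u \<in> cseq.span (shift_orbit f)"
  then show "bshift u \<in> cseq.span (shift_orbit f)"
  proof (induction rule: cseq.span_induct_alt)
    case base
    show ?case using cseq.span_zero by (simp add: zero_fun_def)
  next
    case (step c x y)
    then obtain j k where "x = (\<lambda>n. f k (n + j))" by (auto simp: shift_orbit_def)
    then have "bshift x = (\<lambda>n. f k (n + Suc j))" by simp
    then have "bshift x \<in> shift_orbit f" unfolding shift_orbit_def by (intro image_eqI[of _ _ "(Suc j, k)"]) auto
    then have "cscale c (bshift x) + bshift y \<in> cseq.span (shift_orbit f)"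
      using step by (intro cseq.span_add cseq.span_scale[OF cseq.span_base])
    then show ?case by (simp add: plus_fun_def)
  qed
qed simp

lemma generator_in_span_orbit: "f k \<in> cseq.span (shift_orbit f)"
  by (rule cseq.span_base) (auto simp: shift_orbit_def intro!: image_eqI[of _ _ "(0, k)"])

lemma span_orbit_minimal:
  assumes W: "shift_invariant W" and f: "\<And>k. f k \<in> W"
  shows "cseq.span (shift_orbit f) \<subseteq> W"
proof (rule cseq.span_minimal[OF _ shift_invariantD(1)[OF W]])
  have "(\<lambda>n. f k (n + j)) \<in> W" for j k
  proof (induction j)
    case (Suc j)
    then show ?case using shift_invariantD(2)[OF W Suc] by simp
  qed (use f in simp)
  then show "shift_orbit f \<subseteq> W" by (auto simp: shift_orbit_def)
qed

definition shift_poly :: "complex poly \<Rightarrow> (nat \<Rightarrow> complex ^ 'k) \<Rightarrow> nat \<Rightarrow> complex ^ 'k"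
  where "shift_poly p u n = (\<Sum>i\<le>degree p. coeff p i *s u (n + i))"

lemma shift_poly_bound: "degree p \<le> N \<Longrightarrow> shift_poly p u n = (\<Sum>i\<le>N. coeff p i *s u (n + i))"
  unfolding shift_poly_def by (intro sum.mono_neutral_left) (auto simp: coeff_eq_0)

lemma shift_poly_0 [simp]: "shift_poly 0 u = 0"
  by (simp add: shift_poly_def fun_eq_iff)

lemma shift_poly_pCons: "shift_poly (pCons a p) u = cscale a u + shift_poly p (bshift u)"
proof (rule ext)
  fix n
  have "shift_poly (pCons a p) u n = (\<Sum>i\<le>Suc (degree p). coeff (pCons a p) i *s u (n + i))"
    by (rule shift_poly_bound) (rule degree_pCons_le)
  also have "\<dots> = a *s u n + (\<Sum>i\<le>degree p. coeff p i *s u (n + Suc i))"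
    by (subst sum.atMost_Suc_shift) simp
  finally show "shift_poly (pCons a p) u n = (cscale a u + shift_poly p (bshift u)) n"
    by (simp add: shift_poly_def)
qed

lemma shift_poly_add_poly: "shift_poly (p + q) u = shift_poly p u + shift_poly q u"
proof (rule ext)
  fix n
  have d: "degree p \<le> max (degree p) (degree q)" "degree q \<le> max (degree p) (degree q)" by auto
  show "shift_poly (p + q) u n = (shift_poly p u + shift_poly q u) n"
    using shift_poly_bound[OF d(1), of u n] shift_poly_bound[OF d(2), of u n]
      shift_poly_bound[OF degree_add_le_max, of p q u n]
    by (simp add: sum.distrib vec.scale_left_distrib)
qed

lemma shift_poly_smult: "shift_poly (smult c p) u = cscale c (shift_poly p u)"
  by (rule ext, subst shift_poly_bound[OF degree_smult_le]) (simp add: shift_poly_def vec.scale_sum_right)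

lemma shift_poly_add: "shift_poly p (u + v) = shift_poly p u + shift_poly p v"
  by (simp add: shift_poly_def fun_eq_iff sum.distrib vec.scale_right_distrib)

lemma shift_poly_scale: "shift_poly p (cscale c u) = cscale c (shift_poly p u)"
  by (simp add: shift_poly_def fun_eq_iff vec.scale_sum_right mult.commute)

lemma shift_poly_zero [simp]: "shift_poly p 0 = 0" "shift_poly p (\<lambda>n. 0) = 0"
  by (simp_all add: shift_poly_def fun_eq_iff)

lemma shift_poly_bshift: "shift_poly p (bshift u) = bshift (shift_poly p u)"
  by (simp add: shift_poly_def fun_eq_iff)

lemma shift_poly_1 [simp]: "shift_poly 1 u = u"
  by (simp add: shift_poly_def fun_eq_iff)

lemma shift_poly_mult: "shift_poly (p * q) u = shift_poly p (shift_poly q u)"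
proof (induction p arbitrary: u)
  case (pCons a p)
  have "shift_poly (pCons a p * q) u = shift_poly (smult a q) u + shift_poly (pCons 0 (p * q)) u"
    by (simp only: mult_pCons_left shift_poly_add_poly)
  also have "shift_poly (pCons 0 (p * q)) u = shift_poly (p * q) (bshift u)"
    by (simp add: shift_poly_pCons fun_eq_iff)
  also have "shift_poly (smult a q) u + shift_poly (p * q) (bshift u) = shift_poly (pCons a p) (shift_poly q u)"
    by (simp only: shift_poly_pCons shift_poly_smult pCons.IH shift_poly_bshift)
  finally show ?case .
qed simp

lemma shift_poly_in_invariant:
  assumes W: "shift_invariant W" and u: "u \<in> W"
  shows "shift_poly p u \<in> W"
  using u
proof (induction p arbitrary: u)
  case 0
  show ?case using cseq.subspace_0[OF shift_invariantD(1)[OF W]] by (simp add: zero_fun_def)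
next
  case (pCons a p)
  have "cscale a u + shift_poly p (bshift u) \<in> W"
    using cseq.subspace_add cseq.subspace_scale shift_invariantD[OF W] pCons by blast
  then show ?case by (simp only: shift_poly_pCons)
qed

lemma shift_invariant_kernel: "shift_invariant {u. shift_poly p u = 0}"
  unfolding shift_invariant_def
proof (intro conjI ballI)
  show "cseq.subspace {u. shift_poly p u = 0}"
    by (rule cseq.subspaceI)
      (simp_all del: plus_fun_apply add: shift_poly_add shift_poly_scale, simp_all add: fun_eq_iff)
qed (simp add: shift_poly_bshift fun_eq_iff)

definition comaximal :: "complex poly \<Rightarrow> complex poly \<Rightarrow> bool"
  where "comaximal p q \<longleftrightarrow> (\<exists>a b. a * p + b * q = 1)"

lemma comaximal_mult:
  assumes "comaximal p q" "comaximal p r"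
  shows "comaximal p (q * r)"
proof -
  obtain a b c d where 1: "a * p + b * q = 1" "c * p + d * r = 1"
    using assms unfolding comaximal_def by blast
  have "(a * p + b * q) * (c * p + d * r) = 1" using 1 by simp
  then have "(a * c * p + a * d * r + b * q * c) * p + (b * d) * (q * r) = 1"
    by (simp add: algebra_simps)
  then show ?thesis unfolding comaximal_def by blast
qed

lemma comaximal_sym: "comaximal p q \<Longrightarrow> comaximal q p"
  unfolding comaximal_def by (metis add.commute)

lemma comaximal_1: "comaximal p 1"
  unfolding comaximal_def by (rule exI[of _ 0], rule exI[of _ 1]) simp

lemma comaximal_power: "comaximal p q \<Longrightarrow> comaximal p (q ^ n)"
  by (induction n) (auto intro: comaximal_mult comaximal_1)

lemma comaximal_prod: "(\<And>i. i \<in> I \<Longrightarrow> comaximal p (q i)) \<Longrightarrow> comaximal p (prod q I)"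
  by (induction I rule: infinite_finite_induct) (auto intro: comaximal_mult comaximal_1)

lemma comaximal_linear:
  assumes "c \<noteq> d"
  shows "comaximal ([:- c, 1:] ^ m) ([:- d, 1:] ^ n)"
proof -
  have "[:1 / (d - c):] * [:- c, 1:] + [:- 1 / (d - c):] * [:- d, 1:] = 1"
    using assms by (simp add: one_pCons diff_divide_distrib[symmetric])
  then have "comaximal [:- c, 1:] [:- d, 1:]" unfolding comaximal_def by blast
  then show ?thesis by (intro comaximal_power comaximal_sym[OF comaximal_power[OF comaximal_sym]])
qed

lemma comaximal_identity:
  assumes "a * p + b * q = 1"
  shows "u = shift_poly a (shift_poly p u) + shift_poly b (shift_poly q u)"
  using shift_poly_add_poly[of "a * p" "b * q" u] assms by (simp add: shift_poly_mult)

text \<open>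
  A polynomial in the shift that is \<open>1\<close> modulo \<open>p\<close> and
  \<open>0\<close> modulo \<open>q\<close> extracts \<open>x k\<close> from \<open>x k + y
  k\<close>, so the module of the sums contains both modules and is their direct sum.
\<close>
lemma edim_orbit_add:
  fixes x y :: "'i \<Rightarrow> nat \<Rightarrow> complex ^ 'k"
  assumes pq: "comaximal p q"
    and x: "\<And>k. shift_poly p (x k) = 0" and y: "\<And>k. shift_poly q (y k) = 0"
  shows "cseq_edim (shift_orbit (\<lambda>k. x k + y k)) = cseq_edim (shift_orbit x) + cseq_edim (shift_orbit y)"
proof -
  obtain a b where ab: "a * p + b * q = 1" using pq unfolding comaximal_def by blast
  let ?Mx = "cseq.span (shift_orbit x)" and ?My = "cseq.span (shift_orbit y)"
  let ?M = "cseq.span (shift_orbit (\<lambda>k. x k + y k))"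
  have kx: "?Mx \<subseteq> {u. shift_poly p u = 0}" and ky: "?My \<subseteq> {u. shift_poly q u = 0}"
    by (rule span_orbit_minimal[OF shift_invariant_kernel], use x y in simp)+
  have "?Mx \<inter> ?My \<subseteq> {0}"
  proof
    fix u assume "u \<in> ?Mx \<inter> ?My"
    then have "shift_poly p u = 0" "shift_poly q u = 0" using kx ky by blast+
    then show "u \<in> {0}" using comaximal_identity[OF ab, of u] by simp
  qed
  then have direct: "cseq_edim (shift_orbit x \<union> shift_orbit y) =
      cseq_edim (shift_orbit x) + cseq_edim (shift_orbit y)"
    by (rule cseq_edim_direct_sum)
  have "cseq.span (shift_orbit x \<union> shift_orbit y) = ?M"
  proof (rule antisym)
    have xy: "x k \<in> ?M \<and> y k \<in> ?M" for k
    proof -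
      have g: "x k + y k \<in> ?M" by (rule generator_in_span_orbit[of "\<lambda>k. x k + y k" k])
      have "x k = shift_poly b (shift_poly q (x k))"
        using comaximal_identity[OF ab, of "x k"] x by simp
      also have "\<dots> = shift_poly b (shift_poly q (x k + y k))"
        by (simp only: shift_poly_add y) simp
      finally have xe: "shift_poly b (shift_poly q (x k + y k)) = x k" ..
      have "y k = shift_poly a (shift_poly p (y k))"
        using comaximal_identity[OF ab, of "y k"] y by simp
      also have "\<dots> = shift_poly a (shift_poly p (x k + y k))"
        by (simp only: shift_poly_add x) simp
      finally have ye: "shift_poly a (shift_poly p (x k + y k)) = y k" ..
      have "shift_poly r (shift_poly s (x k + y k)) \<in> ?M" for r s
        by (intro shift_poly_in_invariant[OF shift_invariant_span_orbit] g)
      from this[of b q] this[of a p] show ?thesis unfolding xe ye by blast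
    qed
    then have "?Mx \<subseteq> ?M" "?My \<subseteq> ?M"
      by (intro span_orbit_minimal[OF shift_invariant_span_orbit], blast)+
    then have "shift_orbit x \<union> shift_orbit y \<subseteq> ?M" using cseq.span_superset by blast
    then show "cseq.span (shift_orbit x \<union> shift_orbit y) \<subseteq> ?M" by (rule cseq.span_minimal) simp
    have "shift_orbit (\<lambda>k. x k + y k) \<subseteq> cseq.span (shift_orbit x \<union> shift_orbit y)"
    proof
      fix u assume "u \<in> shift_orbit (\<lambda>k. x k + y k)"
      then obtain j k where u: "u = (\<lambda>n. x k (n + j)) + (\<lambda>n. y k (n + j))"
        by (auto simp: shift_orbit_def fun_eq_iff)
      have "(\<lambda>n. x k (n + j)) \<in> shift_orbit x" "(\<lambda>n. y k (n + j)) \<in> shift_orbit y"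
        by (auto simp: shift_orbit_def)
      then show "u \<in> cseq.span (shift_orbit x \<union> shift_orbit y)"
        unfolding u by (intro cseq.span_add cseq.span_base) auto
    qed
    then show "?M \<subseteq> cseq.span (shift_orbit x \<union> shift_orbit y)" by (rule cseq.span_minimal) simp
  qed
  from cseq_edim_cong_span[OF this] have
    "cseq_edim (shift_orbit x \<union> shift_orbit y) = cseq_edim (shift_orbit (\<lambda>k. x k + y k))" .
  with direct show ?thesis by (simp only:)
qed

text \<open>
  The primary decomposition: components with different eigenvalues of the shift contribute
  independently to the dimension.
\<close>
lemma edim_orbit_sum:
  fixes x :: "'j \<Rightarrow> 'i \<Rightarrow> nat \<Rightarrow> complex ^ 'k"
  assumes "finite J" and inj: "inj_on e J"
    and x: "\<And>w k. w \<in> J \<Longrightarrow> shift_poly ([:- e w, 1:] ^ N) (x w k) = 0"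
  shows "cseq_edim (shift_orbit (\<lambda>k. \<Sum>w\<in>J. x w k)) = (\<Sum>w\<in>J. cseq_edim (shift_orbit (x w)))"
  using assms
proof (induction J rule: finite_induct)
  case empty
  have "cseq_edim (shift_orbit (\<lambda>k :: 'i. 0 :: nat \<Rightarrow> complex ^ 'k)) = 0"
    by (rule cseq_edim_subset_zero) (auto simp: shift_orbit_def fun_eq_iff)
  then show ?case by (simp add: zero_fun_def)
next
  case (insert w J)
  let ?q = "\<Prod>v\<in>J. [:- e v, 1:] ^ N"
  have "comaximal ([:- e w, 1:] ^ N) ?q"
    using insert by (intro comaximal_prod comaximal_linear) (auto simp: inj_on_def)
  moreover have "shift_poly ?q (\<Sum>v\<in>J. x v k) = 0" for k
  proof -
    have "(\<Sum>v\<in>J. x v k) \<in> {u. shift_poly ?q u = 0}"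
    proof (rule cseq.subspace_sum[OF shift_invariantD(1)[OF shift_invariant_kernel]])
      fix v assume v: "v \<in> J"
      have "?q = (\<Prod>v\<in>J - {v}. [:- e v, 1:] ^ N) * [:- e v, 1:] ^ N"
        using insert.hyps(1) v by (simp add: prod.remove mult.commute)
      then show "x v k \<in> {u. shift_poly ?q u = 0}"
        using insert.prems(2)[of v k] v by (simp add: shift_poly_mult)
    qed
    then show ?thesis by simp
  qed
  ultimately have "cseq_edim (shift_orbit (\<lambda>k. x w k + (\<Sum>v\<in>J. x v k))) =
      cseq_edim (shift_orbit (x w)) + cseq_edim (shift_orbit (\<lambda>k. \<Sum>v\<in>J. x v k))"
    using insert.prems(2) by (intro edim_orbit_add) auto
  moreover have "cseq_edim (shift_orbit (\<lambda>k. \<Sum>v\<in>J. x v k)) = (\<Sum>v\<in>J. cseq_edim (shift_orbit (x v)))"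
    using insert.prems by (intro insert.IH) (auto simp: inj_on_def)
  ultimately show ?case by (simp only: sum.insert[OF insert.hyps])
qed

subsection \<open>Principal parts and their power series\<close>

text \<open>
  The coefficient of \<open>z ^ (i + 1)\<close> in the power series of \<open>(z - w) ^ (- (l +
  1))\<close> at \<open>0\<close>, for \<open>w \<noteq> 0\<close>. The constant term is left
  out because it does not enter a Hankel matrix.
\<close>
definition pole_coeff :: "complex \<Rightarrow> nat \<Rightarrow> nat \<Rightarrow> complex"
  where "pole_coeff w l i = fps_nth (inverse (fps_X - fps_const w) ^ Suc l) (Suc i)"

lemma pole_coeff_rec:
  assumes "w \<noteq> 0"
  shows "pole_coeff w l i - w * pole_coeff w l (Suc i) = (if l = 0 then 0 else pole_coeff w (l - 1) (Suc i))"
proof -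
  let ?d = "fps_X - fps_const w"
  have "?d * inverse ?d = 1" using assms by (intro inverse_mult_eq_1') simp
  then have "?d * inverse ?d ^ Suc l = inverse ?d ^ l"
    by (simp only: power_Suc mult.assoc[symmetric] mult_1_left)
  then have "fps_nth (?d * inverse ?d ^ Suc l) (Suc (Suc i)) = fps_nth (inverse ?d ^ l) (Suc (Suc i))"
    by (rule arg_cong)
  moreover have "fps_nth (?d * H) (Suc (Suc i)) = fps_nth H (Suc i) - w * fps_nth H (Suc (Suc i))" for H
    by (simp add: left_diff_distrib)
  ultimately have "pole_coeff w l i - w * pole_coeff w l (Suc i) = fps_nth (inverse ?d ^ l) (Suc (Suc i))"
    unfolding pole_coeff_def by (simp only:)
  then show ?thesis unfolding pole_coeff_def by (cases l) (simp_all only: power_0, simp_all)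
qed

text \<open>
  The power series at \<open>0\<close>, without its constant term, of the principal part
  \<open>\<Sum>l<N. h l * (z - w) ^ (- (l + 1))\<close> at \<open>w\<close>.
\<close>
definition pole_map :: "nat \<Rightarrow> complex \<Rightarrow> (nat \<Rightarrow> complex ^ 'k) \<Rightarrow> nat \<Rightarrow> complex ^ 'k"
  where "pole_map N w h i = (\<Sum>l<N. pole_coeff w l i *s h l)"

lemma linear_pole_map: "linear_on_set V (pole_map N w)"
  by (auto simp: linear_on_set_def pole_map_def fun_eq_iff vec.scale_right_distrib sum.distrib
      vec.scale_sum_right mult.commute)

text \<open>
  Multiplication by \<open>z - w\<close> shifts the sequence of principal part coefficients, and
  multiplication by \<open>z\<close> inverts the shift of the power series up to its constant
  term.
\<close>
lemma pole_map_rec: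
  assumes w: "w \<noteq> 0" and h: "\<And>l. N \<le> l \<Longrightarrow> h l = 0"
  shows "pole_map N w h = cscale w (bshift (pole_map N w h)) + bshift (pole_map N w (bshift h))"
proof (rule ext)
  fix i
  have "pole_map N w h i - w *s pole_map N w h (Suc i) =
      (\<Sum>l<N. (pole_coeff w l i - w * pole_coeff w l (Suc i)) *s h l)"
    by (simp add: pole_map_def sum_subtractf vec.scale_left_diff_distrib vec.scale_sum_right)
  also have "\<dots> = (\<Sum>l<N. (if l = 0 then 0 else pole_coeff w (l - 1) (Suc i)) *s h l)"
    by (simp only: pole_coeff_rec[OF w])
  also have "\<dots> = (\<Sum>l<Suc N. (if l = 0 then 0 else pole_coeff w (l - 1) (Suc i)) *s h l)"
    using h by simp
  also have "\<dots> = pole_map N w (bshift h) (Suc i)"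
    by (subst sum.lessThan_Suc_shift) (simp add: pole_map_def)
  finally show "pole_map N w h i = (cscale w (bshift (pole_map N w h)) + bshift (pole_map N w (bshift h))) i"
    by (simp add: algebra_simps)
qed

text \<open>
  By the recursion, \<open>shift - 1 / w\<close> lowers the order of the pole: power series of
  functions with a pole at \<open>w\<close> are generalised eigenvectors of the shift for the
  eigenvalue \<open>1 / w\<close>.
\<close>
lemma pole_map_annihilated:
  assumes w: "w \<noteq> 0" and nN: "n \<le> N" and h: "\<And>l. n \<le> l \<Longrightarrow> h l = 0"
  shows "shift_poly ([:- inverse w, 1:] ^ n) (pole_map N w h) = 0"
  using nN h
proof (induction n arbitrary: h)
  case 0
  then have "h = 0" by (simp add: fun_eq_iff)
  then show ?case by (simp add: pole_map_def fun_eq_iff shift_poly_def)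
next
  case (Suc n)
  let ?P = "pole_map N w h" and ?Q = "pole_map N w (bshift h)"
  have rec: "?P = cscale w (bshift ?P) + bshift ?Q"
    using Suc.prems by (intro pole_map_rec[OF w]) auto
  have "shift_poly [:- inverse w, 1:] ?P = cscale (- inverse w) (bshift ?Q)"
  proof (rule ext)
    fix i
    have "?P i = w *s ?P (Suc i) + ?Q (Suc i)" using fun_cong[OF rec, of i] by simp
    then show "shift_poly [:- inverse w, 1:] ?P i = cscale (- inverse w) (bshift ?Q) i"
      using w by (simp add: shift_poly_pCons vec.scale_right_distrib)
  qed
  then have "shift_poly ([:- inverse w, 1:] ^ Suc n) ?P =
      cscale (- inverse w) (bshift (shift_poly ([:- inverse w, 1:] ^ n) ?Q))"
    by (simp only: power_Suc2 shift_poly_mult shift_poly_scale shift_poly_bshift)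
  also have "shift_poly ([:- inverse w, 1:] ^ n) ?Q = 0"
    using Suc.prems by (intro Suc.IH) auto
  finally show ?case by (simp add: fun_eq_iff)
qed

text \<open>
  Shifting the principal part down to its leading coefficient reduces the claim to a simple
  pole.
\<close>
lemma pole_map_injective:
  assumes w: "w \<noteq> 0" and h: "\<And>l. N \<le> l \<Longrightarrow> h l = 0" and 0: "pole_map N w h = 0"
  shows "h = 0"
proof (rule ccontr)
  assume "h \<noteq> 0"
  then obtain l0 where l0: "h l0 \<noteq> 0" by (auto simp: fun_eq_iff)
  define L where "L = Max {l. h l \<noteq> 0}"
  have sub: "{l. h l \<noteq> 0} \<subseteq> {..<N}" using h by (force simp: not_less[symmetric])
  then have fin: "finite {l. h l \<noteq> 0}" by (rule finite_subset) simp
  have L: "h L \<noteq> 0" "\<And>l. L < l \<Longrightarrow> h l = 0"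
    using Max_in[OF fin] l0 Max_ge[OF fin] unfolding L_def by (auto simp: not_less[symmetric])
  have *: "pole_map N w (\<lambda>l. h (l + r)) (i + r) = 0" for r i
  proof (induction r arbitrary: i)
    case (Suc r)
    let ?P = "pole_map N w (\<lambda>l. h (l + r))"
    have "?P = cscale w (bshift ?P) + bshift (pole_map N w (bshift (\<lambda>l. h (l + r))))"
      using h by (intro pole_map_rec[OF w]) auto
    from fun_cong[OF this, of "i + r"]
    have "?P (i + r) = w *s ?P (Suc i + r) + pole_map N w (\<lambda>l. h (l + Suc r)) (i + Suc r)" by simp
    then show ?case using Suc[of i] Suc[of "Suc i"] by simp
  qed (use 0 in simp)
  have "L < N" using sub L(1) by blast
  have "pole_map N w (\<lambda>l. h (l + L)) (0 + L) = (\<Sum>l\<in>{0}. pole_coeff w l L *s h (l + L))"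
    unfolding pole_map_def using \<open>L < N\<close> L(2) by (intro sum.mono_neutral_cong_right) auto
  then have "pole_coeff w 0 L *s h L = 0" using *[of L 0] by simp
  moreover have "pole_coeff w 0 L \<noteq> 0"
  proof -
    have eq: "pole_coeff w 0 i = w * pole_coeff w 0 (Suc i)" for i
      using pole_coeff_rec[OF w, of 0 i] by simp
    have "fps_nth ((fps_X - fps_const w) * inverse (fps_X - fps_const w)) 1 = 0"
      using w by (subst inverse_mult_eq_1') simp_all
    then have "w * pole_coeff w 0 0 = fps_nth (inverse (fps_X - fps_const w)) 0"
      by (simp add: pole_coeff_def algebra_simps)
    then have "pole_coeff w 0 0 \<noteq> 0" using w by auto
    then have "pole_coeff w 0 i \<noteq> 0" for i
    proof (induction i)
      case (Suc i)
      then show ?case using eq[of i] by auto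
    qed simp
    then show ?thesis .
  qed
  ultimately show False using L(1) by simp
qed

text \<open>
  The local block Hankel matrix at a pole \<open>w \<noteq> 0\<close> and the Hankel matrix at
  \<open>0\<close> of the same principal part have the same rank. By \<open>pole_map_rec\<close>
  the shift \<open>S\<close> of power series corresponds to \<open>(w +
  M)\<^sup>-\<^sup>1\<close>, where \<open>M\<close> is the shift of principal parts. As
  \<open>M\<close> is nilpotent and \<open>S\<close> is invertible on the annihilated space,
  each is a polynomial in the other, so the injective map \<open>pole_map\<close> carries the
  module generated by \<open>h\<close> onto the module generated by the images.
\<close>
lemma edim_orbit_pole_map:
  fixes h :: "'i \<Rightarrow> nat \<Rightarrow> complex ^ 'k"
  assumes w: "w \<noteq> 0" and h: "\<And>k l. N \<le> l \<Longrightarrow> h k l = 0"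
  shows "cseq_edim (shift_orbit (\<lambda>k. pole_map N w (h k))) = cseq_edim (shift_orbit h)"
proof -
  let ?F = "pole_map N w :: (nat \<Rightarrow> complex ^ 'k) \<Rightarrow> nat \<Rightarrow> complex ^ 'k"
  define X0 where "X0 = cseq.span (shift_orbit h)"
  define X where "X = ?F ` X0"
  define Y where "Y = cseq.span (shift_orbit (\<lambda>k. ?F (h k)))"
  have iX0: "shift_invariant X0" unfolding X0_def by (rule shift_invariant_span_orbit)
  have iY: "shift_invariant Y" unfolding Y_def by (rule shift_invariant_span_orbit)
  have supp: "u l = 0" if "u \<in> X0" "N \<le> l" for u l
  proof -
    have "shift_invariant {u :: nat \<Rightarrow> complex ^ 'k. \<forall>l\<ge>N. u l = 0}"
      by (auto simp: shift_invariant_def intro!: cseq.subspaceI)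
    then have "X0 \<subseteq> {u. \<forall>l\<ge>N. u l = 0}" unfolding X0_def
      by (rule span_orbit_minimal) (use h in auto)
    then show ?thesis using that by blast
  qed
  have sX: "cseq.subspace X"
    unfolding X_def X0_def
    using linear_on_set_span_image[OF linear_pole_map cseq.subspace_UNIV, of "shift_orbit h" N w] by simp
  \<comment> \<open>Induction on the length of the principal part expresses \<open>S\<close> as a
    polynomial in \<open>M\<close>.\<close>
  have XS: "bshift (?F u) \<in> X" if "u \<in> X0" "\<And>l. n \<le> l \<Longrightarrow> u l = 0" for u n
    using that
  proof (induction n arbitrary: u)
    case 0
    then have "u = 0" by (simp add: fun_eq_iff)
    then have "bshift (?F u) = 0" by (simp add: pole_map_def fun_eq_iff)
    then show ?case using cseq.subspace_0[OF sX] by simp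
  next
    case (Suc n)
    have "bshift u \<in> X0" using iX0 Suc.prems(1) by (rule shift_invariantD)
    then have 1: "bshift (?F (bshift u)) \<in> X" using Suc.prems(2) by (intro Suc.IH) auto
    have 2: "?F u \<in> X" using Suc.prems(1) unfolding X_def by blast
    have rec: "?F u = cscale w (bshift (?F u)) + bshift (?F (bshift u))"
      using supp[OF Suc.prems(1)] by (rule pole_map_rec[OF w])
    have "w *s ?F u (Suc i) = ?F u i - ?F (bshift u) (Suc i)" for i
      using fun_cong[OF rec, of i] by simp
    from this[symmetric] have "bshift (?F u) = cscale (inverse w) (?F u - bshift (?F (bshift u)))"
      using w by (simp add: fun_eq_iff)
    moreover have "cscale (inverse w) (?F u - bshift (?F (bshift u))) \<in> X"
      by (intro cseq.subspace_scale[OF sX] cseq.subspace_diff[OF sX] 1 2)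
    ultimately show ?case by (simp only:)
  qed
  have iX: "shift_invariant X"
    unfolding shift_invariant_def
  proof (intro conjI ballI)
    fix v assume "v \<in> X"
    then obtain u where "u \<in> X0" "v = ?F u" unfolding X_def by blast
    then show "bshift v \<in> X" using XS[of u N] supp by blast
  qed (rule sX)
  have hX0: "h k \<in> X0" for k unfolding X0_def by (rule generator_in_span_orbit)
  have "Y \<subseteq> X" unfolding Y_def by (rule span_orbit_minimal[OF iX]) (use hX0 X_def in blast)
  moreover have "X \<subseteq> Y"
  proof -
    define Z where "Z = {u \<in> X0. ?F u \<in> Y}"
    have lin: "?F (u + v) = ?F u + ?F v" "?F (cscale c u) = cscale c (?F u)" for u v c
      using linear_pole_map[of UNIV N w] unfolding linear_on_set_def by blast+
    have "shift_invariant Z"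
      unfolding shift_invariant_def
    proof (intro conjI ballI)
      show "cseq.subspace Z"
      proof (rule cseq.subspaceI)
        have "?F 0 = 0" by (simp add: pole_map_def fun_eq_iff)
        then show "0 \<in> Z" unfolding Z_def
          using cseq.subspace_0 shift_invariantD(1)[OF iX0] shift_invariantD(1)[OF iY] by auto
      next
        fix u v assume "u \<in> Z" "v \<in> Z"
        then show "u + v \<in> Z" unfolding Z_def
          using cseq.subspace_add[OF shift_invariantD(1)[OF iX0]] cseq.subspace_add[OF shift_invariantD(1)[OF iY]]
          by (simp add: lin del: plus_fun_apply)
      next
        fix c u assume "u \<in> Z"
        then show "cscale c u \<in> Z" unfolding Z_def
          using cseq.subspace_scale[OF shift_invariantD(1)[OF iX0]] cseq.subspace_scale[OF shift_invariantD(1)[OF iY]]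
          by (simp add: lin)
      qed
    next
      fix u assume "u \<in> Z"
      then have u: "u \<in> X0" "?F u \<in> Y" unfolding Z_def by auto
      have su: "bshift u \<in> X0" using iX0 u(1) by (rule shift_invariantD)
      define v where "v = cscale w (?F u) + ?F (bshift u)"
      have rec: "?F u = cscale w (bshift (?F u)) + bshift (?F (bshift u))"
        using supp[OF u(1)] by (rule pole_map_rec[OF w])
      have Sv: "bshift v = ?F u" unfolding v_def by (rule trans[OF _ rec[symmetric]]) (simp add: fun_eq_iff)
      let ?p = "[:- inverse w, 1:] ^ N"
      have pv: "shift_poly ?p v = 0"
        unfolding v_def shift_poly_add shift_poly_scale
        using pole_map_annihilated[OF w order_refl, of N u] pole_map_annihilated[OF w order_refl, of N "bshift u"]
          supp[OF u(1)] supp[OF su] by (simp add: fun_eq_iff)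
      \<comment> \<open>The eigenvalue \<open>1 / w\<close> is not \<open>0\<close>, so a polynomial
        in \<open>S\<close> inverts \<open>S\<close> and recovers \<open>v\<close> from \<open>S
        v\<close>.\<close>
      have "comaximal ([:- 0, 1:] ^ 1) ?p" using w by (intro comaximal_linear) auto
      then obtain a b where ab: "a * [:0, 1:] + b * ?p = 1" unfolding comaximal_def by auto
      have "shift_poly [:0, 1:] v = bshift v" by (simp add: shift_poly_pCons fun_eq_iff)
      then have "v = shift_poly a (?F u)" using comaximal_identity[OF ab, of v] pv Sv by simp
      then have "v \<in> Y" using shift_poly_in_invariant[OF iY u(2)] by simp
      then have "v - cscale w (?F u) \<in> Y"
        using u(2) cseq.subspace_diff[OF shift_invariantD(1)[OF iY]] cseq.subspace_scale[OF shift_invariantD(1)[OF iY]]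
        by blast
      moreover have "v - cscale w (?F u) = ?F (bshift u)" unfolding v_def by simp
      ultimately show "bshift u \<in> Z" unfolding Z_def using su by simp
    qed
    moreover have "h k \<in> Z" for k
      unfolding Z_def Y_def using hX0 generator_in_span_orbit[of "\<lambda>k. ?F (h k)" k] by simp
    ultimately have "X0 \<subseteq> Z" unfolding X0_def by (rule span_orbit_minimal)
    then show ?thesis unfolding X_def Z_def by blast
  qed
  ultimately have "X = Y" by blast
  have "cseq_edim X = cseq_edim X0"
    unfolding X_def
  proof (rule cseq_edim_image_inj[OF linear_pole_map cseq.subspace_UNIV])
    fix u assume "u \<in> cseq.span X0" and 0: "?F u = 0"
    then have "u \<in> X0" unfolding X0_def by (simp only: cseq.span_span)
    then show "u = 0" using pole_map_injective[OF w _ 0] supp by blast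
  qed simp
  then show ?thesis using \<open>X = Y\<close> unfolding X0_def Y_def by simp
qed

section \<open>Partial fractions and Laurent coefficients\<close>

text \<open>
  The functions that are sums of monomials and pole terms up to finitely many points; the
  exceptional points absorb the values that are conventional at poles.
\<close>
inductive partial_fraction :: "(complex \<Rightarrow> complex) \<Rightarrow> bool" where
  monomial: "partial_fraction (\<lambda>z. c * z ^ n)"
| pole: "partial_fraction (\<lambda>z. c * inverse (z - w) ^ Suc l)"
| add: "partial_fraction f \<Longrightarrow> partial_fraction g \<Longrightarrow> partial_fraction (\<lambda>z. f z + g z)"
| cong: "partial_fraction f \<Longrightarrow> finite S \<Longrightarrow> (\<And>z. z \<notin> S \<Longrightarrow> f z = g z) \<Longrightarrow> partial_fraction g"

lemma partial_fraction_scale: "partial_fraction f \<Longrightarrow> partial_fraction (\<lambda>z. a * f z)"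
proof (induction rule: partial_fraction.induct)
  case (monomial c n)
  show ?case using partial_fraction.monomial[of "a * c" n] by (simp add: mult.assoc)
next
  case (pole c w l)
  show ?case using partial_fraction.pole[of "a * c" w l] by (simp add: mult.assoc)
next
  case (add f g)
  then show ?case using partial_fraction.add[OF add.IH] by (simp add: distrib_left)
next
  case (cong f S g)
  then show ?case by (intro partial_fraction.cong[OF cong.IH cong.hyps(2)]) simp
qed

lemma partial_fraction_poly: "partial_fraction (poly P)"
proof (induction P)
  case 0
  show ?case using partial_fraction.monomial[of 0 0] by simp
next
  case (pCons a P)
  have shift: "partial_fraction f \<Longrightarrow> f = poly P \<Longrightarrow> partial_fraction (\<lambda>z. z * f z)" for f
  proof -
    assume "f = poly P"
    have "partial_fraction (\<lambda>z. \<Sum>i\<in>I. c i * z ^ Suc i)" if "finite I" for I and c :: "nat \<Rightarrow> complex"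
      using that
    proof (induction I rule: finite_induct)
      case empty
      show ?case using partial_fraction.monomial[of 0 0] by simp
    next
      case (insert i I)
      show ?case
        using partial_fraction.add[OF partial_fraction.monomial[of "c i" "Suc i"] insert.IH] insert.hyps by simp
    qed
    from this[of "{..degree P}" "coeff P"] show "partial_fraction (\<lambda>z. z * f z)"
      unfolding \<open>f = poly P\<close> by (simp add: poly_altdef sum_distrib_left mult.left_commute)
  qed
  show ?case
    using partial_fraction.add[OF partial_fraction.monomial[of a 0] shift[OF pCons.IH refl]] by simp
qed

lemma inverse_mult_inverse_split:
  fixes z :: complex
  assumes "v \<noteq> w" "z \<noteq> v" "z \<noteq> w"
  shows "inverse (z - v) * inverse (z - w) = inverse (v - w) * inverse (z - v) - inverse (v - w) * inverse (z - w)"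
proof -
  have "inverse a * inverse b = inverse (b - a) * inverse a - inverse (b - a) * inverse b"
    if "a \<noteq> 0" "b \<noteq> 0" "b - a \<noteq> 0" for a b :: complex
    using that by (simp add: divide_simps)
  from this[of "z - v" "z - w"] show ?thesis using assms by simp
qed

text \<open>
  Division by a linear factor preserves partial fractions: it raises the order of a pole at the
  same point, and at another point \<open>inverse_mult_inverse_split\<close> lowers the order
  step by step.
\<close>
lemma partial_fraction_divide_linear:
  "partial_fraction f \<Longrightarrow> partial_fraction (\<lambda>z. f z * inverse (z - w))"
proof (induction rule: partial_fraction.induct)
  case (monomial c n)
  let ?P = "monom c n :: complex poly"
  have "partial_fraction (\<lambda>z. poly (synthetic_div ?P w) z + poly ?P w * inverse (z - w) ^ Suc 0)"
    by (intro partial_fraction.add partial_fraction_poly partial_fraction.pole)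
  then show ?case
  proof (rule partial_fraction.cong[of _ "{w}"])
    fix z assume z: "z \<notin> {w}"
    have "poly ?P z = poly ([:- w, 1:] * synthetic_div ?P w + [:poly ?P w:]) z"
      by (simp only: synthetic_div_correct')
    then have "c * z ^ n = (z - w) * poly (synthetic_div ?P w) z + poly ?P w"
      by (simp add: poly_monom algebra_simps)
    then show "poly (synthetic_div ?P w) z + poly ?P w * inverse (z - w) ^ Suc 0 = c * z ^ n * inverse (z - w)"
      using z by (simp add: field_simps)
  qed simp
next
  case (pole c v l)
  show ?case
  proof (cases "v = w")
    case True
    then show ?thesis using partial_fraction.pole[of c w "Suc l"] by (simp add: mult_ac)
  next
    case False
    have "partial_fraction (\<lambda>z. inverse (z - v) ^ Suc l * inverse (z - w))"
    proof (induction l)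
      case 0
      have "partial_fraction (\<lambda>z. inverse (v - w) * inverse (z - v) ^ Suc 0 + (- inverse (v - w)) * inverse (z - w) ^ Suc 0)"
        by (intro partial_fraction.add partial_fraction.pole)
      then show ?case
        by (rule partial_fraction.cong[of _ "{v, w}"])
          (use inverse_mult_inverse_split[OF False] in auto)
    next
      case (Suc l)
      have "partial_fraction (\<lambda>z. inverse (v - w) * inverse (z - v) ^ Suc (Suc l) +
          (- inverse (v - w)) * (inverse (z - v) ^ Suc l * inverse (z - w)))"
        by (intro partial_fraction.add partial_fraction.pole partial_fraction_scale[OF Suc])
      then show ?case
      proof (rule partial_fraction.cong[of _ "{v, w}"])
        fix z assume z: "z \<notin> {v, w}"
        have "inverse (z - v) * inverse (z - w) = inverse (v - w) * inverse (z - v) - inverse (v - w) * inverse (z - w)"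
          using z False by (intro inverse_mult_inverse_split) auto
        then have "inverse (z - v) ^ Suc l * (inverse (z - v) * inverse (z - w)) =
            inverse (z - v) ^ Suc l * (inverse (v - w) * inverse (z - v) - inverse (v - w) * inverse (z - w))"
          by simp
        then show "inverse (v - w) * inverse (z - v) ^ Suc (Suc l) +
          (- inverse (v - w)) * (inverse (z - v) ^ Suc l * inverse (z - w)) =
          inverse (z - v) ^ Suc (Suc l) * inverse (z - w)"
          by (simp add: algebra_simps)
      qed simp
    qed
    from partial_fraction_scale[OF this, of c] show ?thesis by (simp add: mult.assoc)
  qed
next
  case (add f g)
  then show ?case using partial_fraction.add[OF add.IH] by (simp add: distrib_right)
next
  case (cong f S g)
  then show ?case by (intro partial_fraction.cong[OF cong.IH cong.hyps(2)]) simp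
qed

lemma partial_fraction_rational:
  assumes "Q \<noteq> 0"
  shows "partial_fraction (\<lambda>z. poly P z / poly Q z)"
  using assms
proof (induction "degree Q" arbitrary: Q)
  case 0
  then obtain c where "Q = [:c:]" by (metis degree_eq_zeroE)
  then show ?case
    using partial_fraction_scale[OF partial_fraction_poly[of P], of "inverse c"] by (simp add: field_simps)
next
  case (Suc n)
  then have "\<not> (\<exists>a l. a \<noteq> 0 \<and> l = 0 \<and> Q = pCons a l)" by auto
  then obtain w where "poly Q w = 0" using fundamental_theorem_of_algebra_alt by blast
  then obtain Q' where Q: "Q = [:- w, 1:] * Q'" by (auto simp: poly_eq_0_iff_dvd)
  have "Q' \<noteq> 0" using Q Suc.prems by auto
  moreover have "degree Q = Suc (degree Q')"
    unfolding Q using degree_mult_eq[of "[:- w, 1:]" Q'] \<open>Q' \<noteq> 0\<close> by (simp del: mult_pCons_left)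
  ultimately have Q': "Q' \<noteq> 0" "degree Q' = n" using Suc.hyps(2) by simp_all
  from partial_fraction_divide_linear[OF Suc.hyps(1)[OF Q'(2)[symmetric] Q'(1)], of w]
  show ?case unfolding Q poly_mult by (simp add: divide_inverse mult_ac)
qed

text \<open>
  The outcome of a partial fraction expansion in terms of Laurent coefficients: outside the
  finite set \<open>F\<close> there are no principal parts, all orders are at most
  \<open>N\<close>, and the power series at \<open>0\<close> is obtained from the principal
  parts at infinity (from the expansion \<open>M\<close>) and at the points of \<open>F\<close>.
  The conditions are linear in the function for fixed \<open>F\<close> and \<open>N\<close>.
\<close>
definition pole_data :: "(complex \<Rightarrow> complex) \<Rightarrow> complex set \<Rightarrow> nat \<Rightarrow> bool"
  where "pole_data f F N \<longleftrightarrow> (\<exists>L M.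
    (\<forall>w. (\<lambda>z. f (w + z)) has_laurent_expansion L w) \<and> (\<lambda>z. f (1 / z)) has_laurent_expansion M \<and>
    (\<forall>w l. w \<notin> F \<or> N \<le> l \<longrightarrow> fls_nth (L w) (- int (l + 1)) = 0) \<and>
    (\<forall>l\<ge>N. fls_nth M (- int (l + 1)) = 0) \<and>
    (\<forall>i. fls_nth (L 0) (int (i + 1)) = fls_nth M (- int (i + 1)) +
       (\<Sum>w\<in>F - {0}. \<Sum>l<N. pole_coeff w l i * fls_nth (L w) (- int (l + 1)))))"

lemma pole_data_add:
  assumes "pole_data f F N" "pole_data g F N"
  shows "pole_data (\<lambda>z. f z + g z) F N"
proof -
  obtain L M where f: "\<forall>w. (\<lambda>z. f (w + z)) has_laurent_expansion L w" "(\<lambda>z. f (1 / z)) has_laurent_expansion M"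
    "\<forall>w l. w \<notin> F \<or> N \<le> l \<longrightarrow> fls_nth (L w) (- int (l + 1)) = 0"
    "\<forall>l\<ge>N. fls_nth M (- int (l + 1)) = 0"
    "\<forall>i. fls_nth (L 0) (int (i + 1)) = fls_nth M (- int (i + 1)) +
       (\<Sum>w\<in>F - {0}. \<Sum>l<N. pole_coeff w l i * fls_nth (L w) (- int (l + 1)))"
    using assms(1) unfolding pole_data_def by blast
  obtain L' M' where g: "\<forall>w. (\<lambda>z. g (w + z)) has_laurent_expansion L' w" "(\<lambda>z. g (1 / z)) has_laurent_expansion M'"
    "\<forall>w l. w \<notin> F \<or> N \<le> l \<longrightarrow> fls_nth (L' w) (- int (l + 1)) = 0"
    "\<forall>l\<ge>N. fls_nth M' (- int (l + 1)) = 0"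
    "\<forall>i. fls_nth (L' 0) (int (i + 1)) = fls_nth M' (- int (i + 1)) +
       (\<Sum>w\<in>F - {0}. \<Sum>l<N. pole_coeff w l i * fls_nth (L' w) (- int (l + 1)))"
    using assms(2) unfolding pole_data_def by blast
  show ?thesis
    unfolding pole_data_def
  proof (intro exI[of _ "\<lambda>w. L w + L' w"] exI[of _ "M + M'"] conjI allI)
    show "(\<lambda>z. f (w + z) + g (w + z)) has_laurent_expansion L w + L' w" for w
      using f(1) g(1) by (intro has_laurent_expansion_add) auto
    show "(\<lambda>z. f (1 / z) + g (1 / z)) has_laurent_expansion M + M'"
      using f(2) g(2) by (intro has_laurent_expansion_add) auto
  qed (use f(3-5) g(3-5) in \<open>auto simp: distrib_left sum.distrib\<close>)
qed

text \<open>
  Every larger \<open>F\<close> and \<open>N\<close> must be allowed too, so that the data of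
  two summands can be brought to common bounds.
\<close>
lemma partial_fraction_pole_data:
  "partial_fraction f \<Longrightarrow> \<exists>F N. finite F \<and> (\<forall>F' N'. finite F' \<longrightarrow> F \<subseteq> F' \<longrightarrow> N \<le> N' \<longrightarrow> pole_data f F' N')"
proof (induction rule: partial_fraction.induct)
  \<comment> \<open>Only infinity contributes.\<close>
  case (monomial c n)
  have "pole_data (\<lambda>z. c * z ^ n) F N" if "n \<le> N" for F N
    unfolding pole_data_def
  proof (intro exI[of _ "\<lambda>w. fps_to_fls (fps_const c * (fps_const w + fps_X) ^ n)"]
      exI[of _ "fls_const c * fls_X_inv ^ n"] conjI allI)
    show "(\<lambda>z. c * (w + z) ^ n) has_laurent_expansion fps_to_fls (fps_const c * (fps_const w + fps_X) ^ n)" for w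
      by (intro has_laurent_expansion_fps fps_expansion_intros)
    have "(\<lambda>z. c * inverse z ^ n) has_laurent_expansion fls_const c * fls_X_inv ^ n"
      by (intro laurent_expansion_intros)
    then show "(\<lambda>z. c * (1 / z) ^ n) has_laurent_expansion fls_const c * fls_X_inv ^ n"
      by (simp add: inverse_eq_divide)
  qed (use that in \<open>auto simp del: of_nat_Suc\<close>)
  then show ?case by (intro exI[of _ "{}"] exI[of _ n]) auto
next
  case (pole c w l)
  have "pole_data (\<lambda>z. c * inverse (z - w) ^ Suc l) F N" if F: "w \<in> F" "finite F" and N: "Suc l \<le> N" for F N
  proof -
    define L where "L = (\<lambda>v. if v = w then fls_const c * fls_X_inv ^ Suc l
       else fps_to_fls (fps_const c * inverse (fps_X - fps_const (w - v)) ^ Suc l))"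
    define M where "M = fps_to_fls (fps_const c * (fps_X * inverse (1 - fps_const w * fps_X)) ^ Suc l)"
    show ?thesis
      unfolding pole_data_def
    proof (intro exI[of _ L] exI[of _ M] conjI allI)
      fix v
      show "(\<lambda>z. c * inverse (v + z - w) ^ Suc l) has_laurent_expansion L v"
      proof (cases "v = w")
        case True
        have "(\<lambda>z. c * inverse z ^ Suc l) has_laurent_expansion fls_const c * fls_X_inv ^ Suc l"
          by (intro laurent_expansion_intros)
        then show ?thesis using True by (simp add: L_def)
      next
        case False
        have "(\<lambda>z. c * inverse (z - (w - v)) ^ Suc l) has_fps_expansion
            fps_const c * inverse (fps_X - fps_const (w - v)) ^ Suc l"
          using False by (intro fps_expansion_intros) auto
        then show ?thesis using False by (simp add: L_def has_laurent_expansion_fps algebra_simps)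
      qed
    next
      have "(\<lambda>z. c * (z * inverse (1 - w * z)) ^ Suc l) has_laurent_expansion M"
        unfolding M_def by (intro has_laurent_expansion_fps fps_expansion_intros) auto
      moreover have "eventually (\<lambda>z. c * (z * inverse (1 - w * z)) ^ Suc l = c * inverse (1 / z - w) ^ Suc l) (at 0)"
      proof -
        have "eventually (\<lambda>z :: complex. z \<noteq> 0) (at 0)" by (simp add: eventually_at_filter)
        then show ?thesis
        proof eventually_elim
          case (elim z)
          have "1 / z - w = (1 - w * z) / z" using elim by (simp add: field_simps)
          then show ?case by (simp add: divide_inverse mult.commute)
        qed
      qed
      ultimately show "(\<lambda>z. c * inverse (1 / z - w) ^ Suc l) has_laurent_expansion M"
        by (simp only: has_laurent_expansion_cong[OF _ refl])
    next
      fix v k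
      show "v \<notin> F \<or> N \<le> k \<longrightarrow> fls_nth (L v) (- int (k + 1)) = 0"
        using F N by (auto simp: L_def simp del: power_Suc)
      show "N \<le> k \<longrightarrow> fls_nth M (- int (k + 1)) = 0" by (simp add: M_def)
    next
      fix i
      have Ln: "fls_nth (L v) (- int (k + 1)) = (if v = w \<and> k = l then c else 0)" for v k
        by (simp add: L_def del: power_Suc)
      have "(\<Sum>v\<in>F - {0}. \<Sum>k<N. pole_coeff v k i * fls_nth (L v) (- int (k + 1))) =
          (\<Sum>v\<in>F - {0}. if v = w then pole_coeff w l i * c else 0)"
        unfolding Ln using N by (intro sum.cong) (auto simp: if_distrib cong: if_cong)
      also have "\<dots> = (if w = 0 then 0 else pole_coeff w l i * c)" using F by simp
      also have "\<dots> = fls_nth (L 0) (int (i + 1))"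
        by (auto simp: L_def pole_coeff_def mult.commute simp del: of_nat_Suc of_nat_add power_Suc)
      finally show "fls_nth (L 0) (int (i + 1)) = fls_nth M (- int (i + 1)) +
         (\<Sum>v\<in>F - {0}. \<Sum>k<N. pole_coeff v k i * fls_nth (L v) (- int (k + 1)))"
        by (simp add: M_def)
    qed
  qed
  then show ?case by (intro exI[of _ "{w}"] exI[of _ "Suc l"]) auto
next
  case (add f g)
  then obtain F N F' N' where "finite F" "finite F'"
    and f: "\<And>F1 N1. finite F1 \<Longrightarrow> F \<subseteq> F1 \<Longrightarrow> N \<le> N1 \<Longrightarrow> pole_data f F1 N1"
    and g: "\<And>F1 N1. finite F1 \<Longrightarrow> F' \<subseteq> F1 \<Longrightarrow> N' \<le> N1 \<Longrightarrow> pole_data g F1 N1"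
    by metis
  then show ?case
    by (intro exI[of _ "F \<union> F'"] exI[of _ "max N N'"]) (auto intro!: pole_data_add)
next
  case (cong f S g)
  have "pole_data g F N" if "pole_data f F N" for F N
  proof -
    have "((\<lambda>z. f (w + z)) has_laurent_expansion L) = ((\<lambda>z. g (w + z)) has_laurent_expansion L)" for w L
    proof (rule has_laurent_expansion_cong')
      have "eventually (\<lambda>z. z \<in> - (S - {w})) (at w)"
        using open_Compl[OF finite_imp_closed[of "S - {w}"]] cong.hyps(2)
        by (intro eventually_at_in_open') auto
      moreover have "eventually (\<lambda>z. z \<noteq> w) (at w)" by (simp add: eventually_at_filter)
      ultimately show "eventually (\<lambda>z. f z = g z) (at w)"
        by eventually_elim (use cong.hyps(3) in auto)
    qed auto
    moreover have "((\<lambda>z. f (1 / z)) has_laurent_expansion L) = ((\<lambda>z. g (1 / z)) has_laurent_expansion L)" for L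
    proof (rule has_laurent_expansion_cong)
      \<comment> \<open>Near \<open>0\<close> the reciprocals avoid the finite exceptional
        set.\<close>
      have "eventually (\<lambda>z. z \<in> - ((\<lambda>s. 1 / s) ` S - {0})) (at 0)"
        using open_Compl[OF finite_imp_closed[of "(\<lambda>s. 1 / s) ` S - {0}"]] cong.hyps(2)
        by (intro eventually_at_in_open') auto
      moreover have "eventually (\<lambda>z :: complex. z \<noteq> 0) (at 0)" by (simp add: eventually_at_filter)
      ultimately show "eventually (\<lambda>z. f (1 / z) = g (1 / z)) (at 0)"
      proof eventually_elim
        case (elim z)
        then have "1 / z \<notin> S" by force
        then show ?case using cong.hyps(3) by auto
      qed
    qed auto
    ultimately show ?thesis using that unfolding pole_data_def by simp
  qed
  then show ?case using cong.IH by (elim ex_forward) simp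
qed

section \<open>The McMillan degree as the rank of the Hankel matrix\<close>

lemma block_rank_orbit:
  fixes C :: "nat \<Rightarrow> complex ^ 'p ^ 'm"
  shows "block_rank (\<lambda>i j. C (i + j + 1)) = cseq_edim (shift_orbit (\<lambda>k n. column k (C (n + 1))))"
  unfolding block_rank_def shift_orbit_def by simp

lemma rational_matrix_pole_data:
  fixes V :: "complex \<Rightarrow> complex ^ 'p ^ 'm"
  assumes "rational_matrix_fun V"
  obtains F N where "finite F" "\<And>a k. pole_data (\<lambda>z. V z $ a $ k) F N"
proof -
  have "\<exists>F N. finite F \<and> (\<forall>F' N'. finite F' \<longrightarrow> F \<subseteq> F' \<longrightarrow> N \<le> N' \<longrightarrow> pole_data (\<lambda>z. V z $ a $ k) F' N')" for a k
  proof (rule partial_fraction_pole_data)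
    obtain P Q where "Q \<noteq> 0" "\<And>z. V z $ a $ k = poly P z / poly Q z"
      using assms unfolding rational_matrix_fun_def by blast
    then show "partial_fraction (\<lambda>z. V z $ a $ k)" using partial_fraction_rational by simp
  qed
  then obtain F N where FN: "\<And>a k. finite (F a k)"
    "\<And>a k F' N'. finite F' \<Longrightarrow> F a k \<subseteq> F' \<Longrightarrow> N a k \<le> N' \<Longrightarrow> pole_data (\<lambda>z. V z $ a $ k) F' N'"
    by metis
  show ?thesis
  proof (rule that)
    show "finite (\<Union>(a, k). F a k)" using FN(1) by auto
    fix a k
    have "N a k = (\<lambda>(a, k). N a k) (a, k)" by simp
    also have "\<dots> \<le> Max (range (\<lambda>(a, k). N a k))" by (intro Max_ge) auto
    finally show "pole_data (\<lambda>z. V z $ a $ k) (\<Union>(a, k). F a k) (Max (range (\<lambda>(a, k). N a k)))"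
      using FN(1) by (intro FN(2)) auto
  qed
qed

text \<open>
  Kronecker's theorem. The sequence of Taylor coefficients (from index \<open>1\<close> on) is
  the sum of the contributions of the poles; a pole \<open>w\<close> contributes a generalised
  eigenvector of the shift for \<open>1 / w\<close>, and infinity one for \<open>0\<close>. The
  primary decomposition turns the rank of the Hankel matrix into a sum over the poles, and each
  summand is the rank of the local Hankel matrix.
\<close>
lemma mcmillan_degree_eq_block_rank:
  fixes V :: "complex \<Rightarrow> complex ^ 'p ^ 'm"
  assumes rat: "rational_matrix_fun V" and hol: "V \<in> H_infty"
  shows "mcmillan_degree V = block_rank (\<lambda>i j. taylor_coeff V (i + j + 1))"
    and "mcmillan_degree V \<noteq> \<infinity>"
proof -
  obtain F0 N where F0: "finite F0" and pd: "\<And>a k. pole_data (\<lambda>z. V z $ a $ k) F0 N"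
    using rational_matrix_pole_data[OF rat] by blast
  \<comment> \<open>Since \<open>V\<close> is analytic at \<open>0\<close>, the point
    \<open>0\<close> is free to index the contribution of infinity, and \<open>inverse 0 = 0\<close>
    is then the right eigenvalue.\<close>
  define F where "F = F0 - {0}"
  have F: "finite F" "0 \<notin> F" using F0 unfolding F_def by auto
  define lau where "lau w = (\<lambda>k n. column k (laurent_coeff V w (- int (n + 1))))" for w
  define inf where "inf = (\<lambda>k n. column k (laurent_coeff (\<lambda>z. V (1 / z)) 0 (- int (n + 1))))"
  have key: "(w \<notin> F \<or> N \<le> l \<longrightarrow> lau w k l $ a = 0) \<and> (N \<le> l \<longrightarrow> inf k l $ a = 0) \<and>
     taylor_coeff V (i + 1) $ a $ k = inf k i $ a + (\<Sum>w\<in>F. \<Sum>l<N. pole_coeff w l i * lau w k l $ a)"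
    for w l k a i
  proof -
    let ?f = "\<lambda>z. V z $ a $ k"
    obtain L M where L: "\<And>w. (\<lambda>z. ?f (w + z)) has_laurent_expansion L w" "(\<lambda>z. ?f (1 / z)) has_laurent_expansion M"
      "\<And>w l. w \<notin> F0 \<or> N \<le> l \<Longrightarrow> fls_nth (L w) (- int (l + 1)) = 0"
      "\<And>l. l \<ge> N \<Longrightarrow> fls_nth M (- int (l + 1)) = 0"
      "\<And>i. fls_nth (L 0) (int (i + 1)) = fls_nth M (- int (i + 1)) +
         (\<Sum>w\<in>F0 - {0}. \<Sum>l<N. pole_coeff w l i * fls_nth (L w) (- int (l + 1)))"
      using pd[of a k] unfolding pole_data_def by blast
    have le: "laurent_expansion ?f w = L w" for w using L(1) by (rule laurent_expansion_eqI)
    have li: "laurent_expansion (\<lambda>z. V (1 / z) $ a $ k) 0 = M" using L(2) by (rule laurent_expansion_0_eqI)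
    have la: "lau w k l $ a = fls_nth (L w) (- int (l + 1))" for w l
      by (simp add: lau_def column_def laurent_coeff_def le)
    have ia: "inf k l $ a = fls_nth M (- int (l + 1))" for l
      by (simp add: inf_def column_def laurent_coeff_def li)
    have "?f holomorphic_on ball 0 1" using hol unfolding H_infty_def by blast
    then have "?f analytic_on {0}" by (auto simp: analytic_at intro!: exI[of _ "ball 0 1"])
    then have "?f has_fps_expansion fps_expansion ?f 0" by (rule analytic_at_imp_has_fps_expansion_0)
    then have "L 0 = fps_to_fls (fps_expansion ?f 0)"
      using has_laurent_expansion_unique[OF _ has_laurent_expansion_fps] L(1)[of 0] by auto
    then have t: "taylor_coeff V n $ a $ k = fls_nth (L 0) (int n)" "fls_nth (L 0) (- int (n + 1)) = 0" for n
      by (simp_all add: taylor_coeff_def del: of_nat_Suc of_nat_add)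
    show ?thesis
      using L(3)[of w l] L(4)[of l] L(5)[of i] t(2)[of l] unfolding la ia t(1) F_def by (auto simp del: of_nat_Suc of_nat_add)
  qed
  have lau0: "lau w k l = 0" if "w \<notin> F \<or> N \<le> l" for w k l using key that by (simp add: vec_eq_iff)
  have inf0: "inf k l = 0" if "N \<le> l" for k l using key that by (simp add: vec_eq_iff)
  have ld: "local_degree V w = cseq_edim (shift_orbit (lau w))" for w
    unfolding local_degree_def lau_def by (rule block_rank_orbit[of "\<lambda>n. laurent_coeff V w (- int n)"])
  have li: "local_degree (\<lambda>z. V (1 / z)) 0 = cseq_edim (shift_orbit inf)"
    unfolding local_degree_def inf_def
    by (rule block_rank_orbit[of "\<lambda>n. laurent_coeff (\<lambda>z. V (1 / z)) 0 (- int n)"])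
  have fin: "cseq_edim (shift_orbit h) \<noteq> \<infinity>" if "\<And>k l. N \<le> l \<Longrightarrow> h k l = 0" for h :: "'p \<Rightarrow> nat \<Rightarrow> complex ^ 'm"
  proof -
    have "shift_orbit h \<subseteq> insert 0 ((\<lambda>(j, k). \<lambda>n. h k (n + j)) ` ({..<N} \<times> UNIV))"
    proof
      fix u assume "u \<in> shift_orbit h"
      then obtain j k where u: "u = (\<lambda>n. h k (n + j))" by (auto simp: shift_orbit_def)
      show "u \<in> insert 0 ((\<lambda>(j, k). \<lambda>n. h k (n + j)) ` ({..<N} \<times> UNIV))"
      proof (cases "j < N")
        case False
        then have "u = 0" using that unfolding u by (simp add: fun_eq_iff)
        then show ?thesis by simp
      qed (auto simp: u)
    qed
    then have "finite (shift_orbit h)" by (rule finite_subset) auto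
    then show ?thesis by (rule cseq_edim_finite)
  qed
  have plane: "(\<Sum>w\<in>F. cseq_edim (shift_orbit (lau w))) = (\<Sum>w | local_degree V w \<noteq> 0. local_degree V w)"
    unfolding ld
  proof (rule sum.mono_neutral_right[OF F(1)])
    have "cseq_edim (shift_orbit (lau w)) = 0" if "w \<notin> F" for w
      using lau0 that by (intro cseq_edim_subset_zero) (auto simp: shift_orbit_def fun_eq_iff)
    then show "{w. cseq_edim (shift_orbit (lau w)) \<noteq> 0} \<subseteq> F" by blast
  qed auto
  define x where "x w = (if w = 0 then inf else (\<lambda>k. pole_map N w (lau w k)))" for w
  have "(\<lambda>k n. column k (taylor_coeff V (n + 1))) = (\<lambda>k. \<Sum>w\<in>insert 0 F. x w k)"
  proof (intro ext)
    fix k n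
    have "column k (taylor_coeff V (n + 1)) $ a = inf k n $ a + (\<Sum>w\<in>F. pole_map N w (lau w k) n) $ a" for a
      using key by (simp add: column_def pole_map_def)
    moreover have "(\<Sum>w\<in>F. x w k) = (\<Sum>w\<in>F. pole_map N w (lau w k))"
      using F by (intro sum.cong) (auto simp: x_def)
    ultimately show "column k (taylor_coeff V (n + 1)) = (\<Sum>w\<in>insert 0 F. x w k) n"
      using F by (simp add: vec_eq_iff x_def sum_seq_apply)
  qed
  then have "block_rank (\<lambda>i j. taylor_coeff V (i + j + 1)) = cseq_edim (shift_orbit (\<lambda>k. \<Sum>w\<in>insert 0 F. x w k))"
    by (simp only: block_rank_orbit)
  also have "\<dots> = (\<Sum>w\<in>insert 0 F. cseq_edim (shift_orbit (x w)))"
  proof (rule edim_orbit_sum)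
    show "inj_on inverse (insert 0 F)" by (auto simp: inj_on_def)
    fix w k assume "w \<in> insert 0 F"
    show "shift_poly ([:- inverse w, 1:] ^ N) (x w k) = 0"
    proof (cases "w = 0")
      case True
      have "[:0, 1:] ^ N = monom (1::complex) N" by (simp add: monom_altdef)
      then show ?thesis using True inf0
        by (simp add: x_def shift_poly_def fun_eq_iff degree_monom_eq if_distrib[of "\<lambda>c. c *s _"] cong: if_cong)
    next
      case False
      then show ?thesis
        using pole_map_annihilated[OF False order_refl, of N "lau w k"] lau0 by (simp add: x_def)
    qed
  qed (use F in auto)
  also have "\<dots> = cseq_edim (shift_orbit inf) + (\<Sum>w\<in>F. cseq_edim (shift_orbit (lau w)))"
  proof -
    have "cseq_edim (shift_orbit (x w)) = cseq_edim (shift_orbit (lau w))" if "w \<in> F" for w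
      using edim_orbit_pole_map[of w N "lau w"] lau0 that F by (auto simp: x_def)
    then have "(\<Sum>w\<in>F. cseq_edim (shift_orbit (x w))) = (\<Sum>w\<in>F. cseq_edim (shift_orbit (lau w)))"
      by (intro sum.cong) auto
    then show ?thesis using F by (simp add: x_def)
  qed
  also have "(\<Sum>w\<in>F. cseq_edim (shift_orbit (lau w))) = (\<Sum>w | local_degree V w \<noteq> 0. local_degree V w)"
    by (rule plane)
  finally show "mcmillan_degree V = block_rank (\<lambda>i j. taylor_coeff V (i + j + 1))"
    unfolding mcmillan_degree_def li by (simp add: add.commute)
  have "(\<Sum>w\<in>F. cseq_edim (shift_orbit (lau w))) \<noteq> \<infinity>" using F(1)
  proof (induction F rule: finite_induct)
    case (insert w F')
    then show ?case using fin[of "lau w"] lau0 by auto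
  qed simp
  then have "(\<Sum>w | local_degree V w \<noteq> 0. local_degree V w) \<noteq> \<infinity>" unfolding plane .
  then show "mcmillan_degree V \<noteq> \<infinity>"
    unfolding mcmillan_degree_def li using fin[of inf] inf0 by (simp add: plus_eq_infty_iff_enat)
qed

text \<open>
  In echelon form the coefficients of a vector are among its coordinates, hence they converge
  with it.
\<close>
lemma finite_span_pointwise_closed:
  fixes W :: "(nat \<Rightarrow> complex ^ 'k) set"
  assumes W: "cseq.subspace W" and fin: "cseq_edim W \<noteq> \<infinity>"
    and u: "\<And>n. u n \<in> W" and lim: "\<And>i. (\<lambda>n. u n i) \<longlonglongrightarrow> v i"
  shows "v \<in> W"
proof -
  obtain B where B: "finite B" "W \<subseteq> cseq.span B" using cseq_edim_basis[OF fin] by metis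
  obtain Q b where Q: "finite Q" "\<And>q. q \<in> Q \<Longrightarrow> b q \<in> W"
    "\<And>x. x \<in> W \<Longrightarrow> x = (\<Sum>q\<in>Q. cscale (x (fst q) $ snd q) (b q))"
    using echelon_coordinates[OF W B] by blast
  define x where "x = (\<Sum>q\<in>Q. cscale (v (fst q) $ snd q) (b q))"
  have "v i $ a = x i $ a" for i a
  proof (rule LIMSEQ_unique)
    show "(\<lambda>n. u n i $ a) \<longlonglongrightarrow> v i $ a" by (intro tendsto_vec_nth lim)
    have "u n i $ a = (\<Sum>q\<in>Q. u n (fst q) $ snd q * b q i $ a)" for n
      using arg_cong[OF Q(3)[OF u[of n]], of "\<lambda>y. y i $ a"]
        sum_cscale_nth[of "\<lambda>q. u n (fst q) $ snd q" b Q i a] by (rule trans)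
    then show "(\<lambda>n. u n i $ a) \<longlonglongrightarrow> x i $ a"
      unfolding x_def sum_cscale_nth by (simp only:) (intro tendsto_intros tendsto_vec_nth lim)
  qed
  then have "v = x" by (simp add: fun_eq_iff vec_eq_iff)
  moreover have "x \<in> W" unfolding x_def
    by (intro cseq.subspace_sum[OF W] cseq.subspace_scale[OF W] Q(2))
  ultimately show ?thesis by simp
qed

lemma matrix_vector_mult_axis: "(A :: complex ^ 'p ^ 'm) *v axis k 1 = column k A"
  by (simp add: matrix_vector_mult_def column_def axis_def if_distrib[of "\<lambda>z. _ * z"] cong: if_cong)

text \<open>
  Columns are images of unit sequences; conversely an image is a pointwise limit of combinations
  of columns.
\<close>
lemma ell2_rank_block_op:
  fixes A :: "nat \<Rightarrow> nat \<Rightarrow> complex ^ 'p ^ 'm"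
  assumes A: "schur_bounded A M" and fin: "block_rank A \<noteq> \<infinity>"
  shows "ell2_rank (block_op A) = block_rank A"
proof -
  let ?C = "range (\<lambda>(j, k). \<lambda>i. column k (A i j))"
  let ?W = "cseq.span ?C"
  have "block_op A ` ell2 \<subseteq> ?W"
  proof (rule image_subsetI)
    fix u :: "nat \<Rightarrow> complex ^ 'p" assume u: "u \<in> ell2"
    show "block_op A u \<in> ?W"
    proof (rule finite_span_pointwise_closed)
      show "cseq_edim ?W \<noteq> \<infinity>" using fin unfolding block_rank_def by simp
      have "(\<lambda>i. \<Sum>j<n. A i j *v u j) = (\<Sum>j<n. \<Sum>k\<in>UNIV. cscale (u j $ k) (\<lambda>i. column k (A i j)))" for n
        by (simp add: fun_eq_iff sum_seq_apply matrix_mult_sum)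
      then show "(\<lambda>i. \<Sum>j<n. A i j *v u j) \<in> ?W" for n
        by (simp only:) (intro cseq.span_sum cseq.span_scale cseq.span_base, auto)
      show "(\<lambda>n. \<Sum>j<n. A i j *v u j) \<longlonglongrightarrow> block_op A u i" for i
        unfolding block_op_def by (intro summable_LIMSEQ schur_summable[OF A u])
    qed simp
  qed
  then have "ell2_rank (block_op A) \<le> block_rank A"
    unfolding ell2_rank_def block_rank_def by (rule cseq_edim_mono_span)
  moreover have "?C \<subseteq> cseq.span (block_op A ` ell2)"
  proof (rule image_subsetI, clarify)
    fix j k
    have "(\<Sum>l. A i l *v unit_seq j k l) = A i j *v unit_seq j k j" for i
      by (subst suminf_finite[of "{j}"]) (auto simp: unit_seq_def)
    then have "(\<lambda>i. column k (A i j)) = block_op A (unit_seq j k)"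
      by (simp add: block_op_def unit_seq_def matrix_vector_mult_axis fun_eq_iff)
    then show "(\<lambda>i. column k (A i j)) \<in> cseq.span (block_op A ` ell2)"
      using unit_seq_ell2 by (intro cseq.span_base) blast
  qed
  then have "block_rank A \<le> ell2_rank (block_op A)"
    unfolding ell2_rank_def block_rank_def by (rule cseq_edim_mono_span)
  ultimately show ?thesis by simp
qed

section \<open>Taylor and Fourier coefficients\<close>

definition abs_power_series :: "(nat \<Rightarrow> complex) \<Rightarrow> (real \<Rightarrow> complex) \<Rightarrow> bool"
  where "abs_power_series a f \<longleftrightarrow>
    summable (\<lambda>n. cmod (a n)) \<and> (\<forall>t. (\<lambda>n. a n * cis (real n * t)) sums f t)"

text \<open>
  By continuity up to the boundary the identity \<open>Z Q = P\<close> holds at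
  \<open>w\<close>, so a zero of the denominator would be one of the numerator.
\<close>
lemma rational_H_infty_no_pole:
  assumes rat: "rational_matrix_fun Z" and hol: "Z \<in> H_infty"
    and Q: "Q \<noteq> 0" and cop: "coprime P Q" and eq: "\<And>z. Z z $ i $ j = poly P z / poly Q z"
    and w: "w \<in> cball 0 1"
  shows "poly Q w \<noteq> 0"
proof
  assume Qw: "poly Q w = 0"
  let ?S = "ball 0 1 - {z. poly Q z = 0}"
  have fin: "finite {z. poly Q z = 0}" using Q poly_roots_finite by blast
  have "closure (- {z. poly Q z = 0}) = UNIV" using fin by (simp add: closure_complement empty_interior_finite)
  then have cl: "closure ?S = cball 0 1"
    using closure_open_Int_superset[of "ball 0 1" "- {z. poly Q z = 0}"] by (simp add: Diff_eq)
  have cont: "continuous_on (closure ?S) (\<lambda>z. Z z $ i $ j * poly Q z - poly P z)"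
    unfolding cl using rational_H_infty_continuous_on_cball[OF rat hol] by (intro continuous_intros)
  have zero: "Z z $ i $ j * poly Q z - poly P z = 0" if "z \<in> ?S" for z
    using that by (simp add: eq)
  have "Z w $ i $ j * poly Q w - poly P w = 0"
    using w by (intro continuous_constant_on_closure[OF cont zero]) (simp_all only: cl)
  then have "poly P w = 0" using Qw by simp
  then have "[:-w, 1:] dvd P" "[:-w, 1:] dvd Q" using Qw by (simp_all add: poly_eq_0_iff_dvd)
  then have "is_unit [:-w, 1:]" using coprime_common_divisor[OF cop] by simp
  then show False by (simp add: is_unit_pCons_iff)
qed

text \<open>
  All poles lie outside the closed disc, so the power series converges absolutely in a larger
  disc.
\<close>
lemma taylor_abs_power_series:
  fixes V :: "complex \<Rightarrow> complex ^ 'p ^ 'm"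
  assumes rat: "rational_matrix_fun V" and hol: "V \<in> H_infty"
  shows "abs_power_series (\<lambda>n. taylor_coeff V n $ i $ j) (\<lambda>t. V (cis t) $ i $ j)"
proof -
  let ?f = "\<lambda>z. V z $ i $ j"
  obtain P Q where PQ: "Q \<noteq> 0" "coprime P Q" "\<And>z. ?f z = poly P z / poly Q z"
    using rat unfolding rational_matrix_fun_def by blast
  have fin: "finite {z. poly Q z = 0}" using PQ(1) poly_roots_finite by blast
  define r where "r = Min (insert 2 (norm ` {z. poly Q z = 0}))"
  have r1: "1 < r"
  proof -
    have "1 < norm z" if "poly Q z = 0" for z
    proof (rule ccontr)
      assume "\<not> 1 < norm z"
      then have "z \<in> cball 0 1" by simp
      then show False using rational_H_infty_no_pole[OF rat hol PQ] that by blast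
    qed
    then show ?thesis unfolding r_def using fin by auto
  qed
  have "poly Q z \<noteq> 0" if "z \<in> ball 0 r" for z
  proof
    assume "poly Q z = 0"
    then have "r \<le> norm z" unfolding r_def using fin by (intro Min_le) auto
    then show False using that by simp
  qed
  then have hol_r: "?f holomorphic_on ball 0 r" unfolding PQ(3) by (intro holomorphic_intros) auto
  have an: "?f analytic_on {0}" using hol_r r1 by (auto simp: analytic_at intro!: exI[of _ "ball 0 r"])
  then have fps: "?f has_fps_expansion fps_expansion ?f 0" by (rule analytic_at_imp_has_fps_expansion_0)
  have hol_e: "?f holomorphic_on eball 0 (ereal r)" using hol_r by simp
  have t: "taylor_coeff V n $ i $ j = fps_nth (fps_expansion ?f 0) n" for n by (simp add: taylor_coeff_def)
  show ?thesis
    unfolding abs_power_series_def t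
  proof (intro conjI allI)
    have "ereal r \<le> fps_conv_radius (fps_expansion ?f 0)"
      by (rule holomorphic_on_imp_fps_conv_radius_ge[OF fps hol_e])
    moreover have "ereal (norm (1 :: complex)) < ereal r" using r1 by simp
    ultimately have "ereal (norm (1 :: complex)) < fps_conv_radius (fps_expansion ?f 0)" by (rule less_le_trans[rotated])
    then show "summable (\<lambda>n. cmod (fps_nth (fps_expansion ?f 0) n))" using norm_summable_fps by fastforce
    show "(\<lambda>n. fps_nth (fps_expansion ?f 0) n * cis (real n * t)) sums V (cis t) $ i $ j" for t
      using has_fps_expansion_imp_sums_complex[OF fps hol_e, of "cis t"] r1 by (simp add: Complex.DeMoivre)
  qed
qed

definition circle_coeff :: "(real \<Rightarrow> complex) \<Rightarrow> int \<Rightarrow> complex"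
  where "circle_coeff f n = integral {0..2 * pi} (\<lambda>t. f t * cis (- (of_int n * t))) / of_real (2 * pi)"

lemma fourier_coeff_circle_coeff:
  assumes "continuous_on {0..2 * pi} (\<lambda>t. Z (cis t) $ i $ j)"
  shows "fourier_coeff Z n $ i $ j = circle_coeff (\<lambda>t. Z (cis t) $ i $ j) n"
proof -
  have "continuous_on {0..2 * pi} (\<lambda>t. Z (cis t) $ i $ j * cis (- (of_int n * t)))"
    by (intro continuous_on_mult assms) (intro continuous_intros)
  then have "(\<lambda>t. Z (cis t) $ i $ j * cis (- (of_int n * t))) absolutely_integrable_on {0..2 * pi}"
    by (rule absolutely_integrable_continuous_real)
  then show ?thesis
    by (simp add: fourier_coeff_def circle_coeff_def set_lebesgue_integral_eq_integral(2))
qed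

lemma abs_power_series_uniform:
  assumes f: "abs_power_series a f" and F: "continuous_on {0..2 * pi} F"
  shows "uniform_limit {0..2 * pi} (\<lambda>N t. \<Sum>n<N. a n * cis (real n * t) * F t) (\<lambda>t. f t * F t) sequentially"
proof -
  have "bounded (F ` {0..2 * pi})" using F by (intro compact_imp_bounded compact_continuous_image) auto
  then obtain B where B: "\<And>t. t \<in> {0..2 * pi} \<Longrightarrow> norm (F t) \<le> B" unfolding bounded_iff by blast
  have "uniform_limit {0..2 * pi} (\<lambda>N t. \<Sum>n<N. a n * cis (real n * t) * F t)
      (\<lambda>t. \<Sum>n. a n * cis (real n * t) * F t) sequentially"
  proof (rule Weierstrass_m_test_ev)
    show "\<forall>\<^sub>F n in sequentially. \<forall>t\<in>{0..2 * pi}. norm (a n * cis (real n * t) * F t) \<le> cmod (a n) * B"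
      using B by (auto simp: norm_mult intro!: always_eventually mult_left_mono)
    show "summable (\<lambda>n. cmod (a n) * B)"
      using f by (intro summable_mult2) (simp add: abs_power_series_def)
  qed
  moreover have "(\<Sum>n. a n * cis (real n * t) * F t) = f t * F t" for t
    using f sums_mult2[of "\<lambda>n. a n * cis (real n * t)" "f t" "F t"]
    by (simp add: abs_power_series_def sums_iff)
  ultimately show ?thesis by simp
qed

lemma abs_power_series_continuous:
  assumes f: "abs_power_series a f"
  shows "continuous_on {0..2 * pi} f"
proof -
  have "continuous_on {0..2 * pi} (\<lambda>t. f t * 1)"
    by (rule uniform_limit_theorem[OF _ abs_power_series_uniform[OF f continuous_on_const]])
      (auto intro!: always_eventually continuous_intros)
  then show ?thesis by simp
qed

text \<open>
  The series converges uniformly on the circle and may be integrated term by term against the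
  continuous factor.
\<close>
lemma circle_coeff_mult_series:
  assumes f: "abs_power_series a f" and F: "continuous_on {0..2 * pi} F"
  shows "(\<lambda>k. a k * circle_coeff F (n - int k)) sums circle_coeff (\<lambda>t. f t * F t) n"
proof -
  let ?F = "\<lambda>t. F t * cis (- (of_int n * t))"
  have F': "continuous_on {0..2 * pi} ?F" using F by (intro continuous_intros)
  have term_integral: "integral {0..2 * pi} (\<lambda>t. a k * cis (real k * t) * ?F t) = a k * circle_coeff F (n - int k) * of_real (2 * pi)" for k
  proof -
    have "integral {0..2 * pi} (\<lambda>t. a k * cis (real k * t) * ?F t) =
        integral {0..2 * pi} (\<lambda>t. a k * (F t * cis (- (of_int (n - int k) * t))))"
    proof (rule integral_cong)
      fix t
      have "cis (real k * t) * cis (- (of_int n * t)) = cis (- (of_int (n - int k) * t))"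
        by (simp add: cis_mult left_diff_distrib)
      then show "a k * cis (real k * t) * ?F t = a k * (F t * cis (- (of_int (n - int k) * t)))"
        by (metis mult.assoc mult.left_commute)
    qed
    then show ?thesis by (simp add: circle_coeff_def)
  qed
  have cont: "continuous_on {0..2 * pi} (\<lambda>t. a k * cis (real k * t) * ?F t)" for k
    by (rule continuous_on_mult[OF _ F']) (intro continuous_intros)
  obtain I J where IJ: "\<And>N. ((\<lambda>t. \<Sum>k<N. a k * cis (real k * t) * ?F t) has_integral I N) {0..2 * pi}"
    "((\<lambda>t. f t * ?F t) has_integral J) {0..2 * pi}" "I \<longlonglongrightarrow> J"
  proof (rule uniform_limit_integral[OF abs_power_series_uniform[OF f F']])
    show "continuous_on {0..2 * pi} (\<lambda>t. \<Sum>k<N. a k * cis (real k * t) * ?F t)" for N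
      by (intro continuous_on_sum cont)
  qed auto
  have "I N = (\<Sum>k<N. a k * circle_coeff F (n - int k) * of_real (2 * pi))" for N
  proof -
    have "I N = integral {0..2 * pi} (\<lambda>t. \<Sum>k<N. a k * cis (real k * t) * ?F t)"
      by (rule integral_unique[OF IJ(1), symmetric])
    also have "\<dots> = (\<Sum>k<N. integral {0..2 * pi} (\<lambda>t. a k * cis (real k * t) * ?F t))"
      by (intro integral_sum integrable_continuous_real cont) auto
    finally show ?thesis unfolding term_integral .
  qed
  then have "I = (\<lambda>N. \<Sum>k<N. a k * circle_coeff F (n - int k) * of_real (2 * pi))" by (rule ext)
  then have "(\<lambda>k. a k * circle_coeff F (n - int k) * of_real (2 * pi)) sums J"
    unfolding sums_def using IJ(3) by (simp only:)
  then have "(\<lambda>k. a k * circle_coeff F (n - int k) * of_real (2 * pi) / of_real (2 * pi)) sums (J / of_real (2 * pi))"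
    by (rule sums_divide)
  moreover have "J / of_real (2 * pi) = circle_coeff (\<lambda>t. f t * F t) n"
    using IJ(2) by (simp add: circle_coeff_def integral_unique mult.assoc)
  ultimately show ?thesis by simp
qed

lemma integral_cis: "integral {0..2 * pi} (\<lambda>t. cis (of_int k * t)) = (if k = 0 then of_real (2 * pi) else 0)"
proof (cases "k = 0")
  case True
  then show ?thesis by (simp add: cis_zero scaleR_conv_of_real)
next
  case False
  define c where "c = \<i> * of_int k"
  have c: "c \<noteq> 0" using False by (simp add: c_def)
  have e: "cis (of_int k * t) = exp (c * of_real t)" for t
    by (simp add: cis_conv_exp c_def mult_ac)
  have "((\<lambda>t. exp (c * of_real t)) has_integral (exp (c * of_real (2 * pi)) / c - exp (c * of_real 0) / c)) {0..2 * pi}"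
  proof (rule fundamental_theorem_of_calculus)
    fix t :: real
    have "((\<lambda>z. exp (c * z) / c) has_field_derivative exp (c * of_real t)) (at (of_real t))"
      using c by (auto intro!: derivative_eq_intros)
    then show "((\<lambda>t. exp (c * of_real t) / c) has_vector_derivative exp (c * of_real t)) (at t within {0..2 * pi})"
      by (rule has_vector_derivative_real_field)
  qed simp
  moreover have "exp (c * of_real (2 * pi)) = 1"
    using e[of "2 * pi"] cis_multiple_2pi[of "of_int k"] by (simp add: mult_ac)
  ultimately show ?thesis using False by (simp add: e integral_unique)
qed

lemma circle_coeff_1: "circle_coeff (\<lambda>t. 1) n = (if n = 0 then 1 else 0)"
  using integral_cis[of "- n"] by (simp add: circle_coeff_def)

lemma circle_coeff_series:
  assumes "abs_power_series a f"
  shows "circle_coeff f n = (if 0 \<le> n then a (nat n) else 0)"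
proof -
  have 1: "(\<lambda>k. a k * (if n - int k = 0 then 1 else 0)) sums circle_coeff f n"
    using circle_coeff_mult_series[OF assms continuous_on_const, of 1 n] by (simp add: circle_coeff_1)
  have 2: "(\<lambda>k. a k * (if n - int k = 0 then 1 else 0)) =
      (\<lambda>k. if k = nat n then (if 0 \<le> n then a (nat n) else 0) else 0)"
    by (auto simp: fun_eq_iff)
  show ?thesis using 1 unfolding 2 by (rule sums_unique2[OF _ sums_single])
qed

lemma circle_coeff_cnj: "circle_coeff (\<lambda>t. cnj (f t)) n = cnj (circle_coeff f (- n))"
  by (simp add: circle_coeff_def integral_cnj cis_cnj)

lemma circle_coeff_diff:
  assumes "continuous_on {0..2 * pi} f" "continuous_on {0..2 * pi} g"
  shows "circle_coeff (\<lambda>t. f t - g t) n = circle_coeff f n - circle_coeff g n"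
proof -
  have "integral {0..2 * pi} (\<lambda>t. f t * cis (- (of_int n * t)) - g t * cis (- (of_int n * t))) =
     integral {0..2 * pi} (\<lambda>t. f t * cis (- (of_int n * t))) - integral {0..2 * pi} (\<lambda>t. g t * cis (- (of_int n * t)))"
    using assms by (intro integral_diff integrable_continuous_real continuous_intros)
  then show ?thesis by (simp add: circle_coeff_def left_diff_distrib diff_divide_distrib)
qed

lemma circle_coeff_sum:
  assumes "\<And>i. i \<in> I \<Longrightarrow> continuous_on {0..2 * pi} (f i)" "finite I"
  shows "circle_coeff (\<lambda>t. \<Sum>i\<in>I. f i t) n = (\<Sum>i\<in>I. circle_coeff (f i) n)"
proof -
  have "integral {0..2 * pi} (\<lambda>t. \<Sum>i\<in>I. f i t * cis (- (of_int n * t))) =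
     (\<Sum>i\<in>I. integral {0..2 * pi} (\<lambda>t. f i t * cis (- (of_int n * t))))"
    using assms by (intro integral_sum integrable_continuous_real continuous_intros)
  then show ?thesis by (simp add: circle_coeff_def sum_distrib_right sum_divide_distrib)
qed

text \<open>
  Continuous functions all of whose Fourier coefficients vanish form a module over the
  absolutely convergent power series and their conjugates. This makes \<open>cnj F * F\<close>
  integrate to \<open>0\<close> when \<open>F\<close> is itself built from such series, without
  any completeness theorem for the trigonometric system.
\<close>
lemma circle_coeff_zero_mult:
  assumes f: "abs_power_series a f" and F: "continuous_on {0..2 * pi} F" and 0: "\<And>n. circle_coeff F n = 0"
  shows "circle_coeff (\<lambda>t. f t * F t) n = 0" "circle_coeff (\<lambda>t. cnj (f t) * F t) n = 0"
proof -
  show 1: "circle_coeff (\<lambda>t. f t * F t) n = 0"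
    using circle_coeff_mult_series[OF f F, of n] by (simp add: 0 sums_iff)
  have F': "continuous_on {0..2 * pi} (\<lambda>t. cnj (F t))" using F by (intro continuous_intros)
  have "circle_coeff (\<lambda>t. f t * cnj (F t)) (- n) = 0"
    using circle_coeff_mult_series[OF f F', of "- n"] by (simp add: circle_coeff_cnj 0 sums_iff)
  then show "circle_coeff (\<lambda>t. cnj (f t) * F t) n = 0"
    using circle_coeff_cnj[of "\<lambda>t. f t * cnj (F t)" n] by simp
qed

lemma circle_coeff_zero_imp:
  assumes F: "continuous_on {0..2 * pi} F" and 0: "circle_coeff (\<lambda>t. cnj (F t) * F t) 0 = 0"
    and t: "t \<in> {0..2 * pi}"
  shows "F t = 0"
proof -
  have c: "continuous_on {0..2 * pi} (\<lambda>t. (cmod (F t))\<^sup>2)" using F by (intro continuous_intros)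
  have "((\<lambda>t. complex_of_real ((cmod (F t))\<^sup>2)) has_integral of_real (integral {0..2 * pi} (\<lambda>t. (cmod (F t))\<^sup>2))) {0..2 * pi}"
    by (intro has_integral_of_real integrable_integral integrable_continuous_real c)
  moreover have "(\<lambda>t. complex_of_real ((cmod (F t))\<^sup>2)) = (\<lambda>t. cnj (F t) * F t)"
    by (simp only: complex_norm_square mult.commute)
  ultimately have "complex_of_real (integral {0..2 * pi} (\<lambda>t. (cmod (F t))\<^sup>2)) = integral {0..2 * pi} (\<lambda>t. cnj (F t) * F t)"
    by (simp add: integral_unique)
  also have "\<dots> = 0" using 0 by (simp add: circle_coeff_def)
  finally have "integral {0..2 * pi} (\<lambda>t. (cmod (F t))\<^sup>2) = 0" by simp
  then have "\<forall>t\<in>{0..2 * pi}. (cmod (F t))\<^sup>2 = 0"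
    using integral_eq_0_iff[OF c] by simp
  then show ?thesis using t by simp
qed

section \<open>Toeplitz and Hankel operators\<close>

definition toeplitz_matrix :: "(complex \<Rightarrow> complex ^ 'p ^ 'm) \<Rightarrow> nat \<Rightarrow> nat \<Rightarrow> complex ^ 'p ^ 'm"
  where "toeplitz_matrix Z i j = fourier_coeff Z (int i - int j)"

definition hankel_matrix :: "(complex \<Rightarrow> complex ^ 'p ^ 'm) \<Rightarrow> nat \<Rightarrow> nat \<Rightarrow> complex ^ 'p ^ 'm"
  where "hankel_matrix V i j = taylor_coeff V (i + j + 1)"

lemma toeplitz_eq: "toeplitz Z = block_op (toeplitz_matrix Z)"
  unfolding toeplitz_def toeplitz_matrix_def[abs_def] ..

lemma hankel_eq: "hankel V = block_op (hankel_matrix V)"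
  unfolding hankel_def hankel_matrix_def[abs_def] ..

context
  fixes V :: "complex \<Rightarrow> complex ^ 'p ^ 'm"
  assumes rat: "rational_matrix_fun V" and hol: "V \<in> H_infty"
begin

lemma fourier_coeff_H_infty: "fourier_coeff V n = (if 0 \<le> n then taylor_coeff V (nat n) else 0)"
  using fourier_coeff_circle_coeff[OF abs_power_series_continuous[OF taylor_abs_power_series[OF rat hol]]]
    circle_coeff_series[OF taylor_abs_power_series[OF rat hol]]
  by (simp add: vec_eq_iff)

lemma hankel_matrix_fourier: "hankel_matrix V i j = fourier_coeff V (int (i + j + 1))"
  by (simp add: hankel_matrix_def fourier_coeff_H_infty nat_add_distrib)

lemma schur_bounded_toeplitz_hankel:
  obtains M where "schur_bounded (toeplitz_matrix V) M" "schur_bounded (hankel_matrix V) M"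
proof -
  have norm_le: "norm A \<le> (\<Sum>i\<in>UNIV. \<Sum>j\<in>UNIV. cmod (A $ i $ j))" for A :: "complex ^ 'p ^ 'm"
    unfolding norm_vec_def by (intro order_trans[OF L2_set_le_sum] sum_mono L2_set_le_sum) (auto simp: L2_set_nonneg)
  have sum: "summable (\<lambda>n. norm (taylor_coeff V n))"
  proof (rule summable_comparison_test')
    show "summable (\<lambda>n. \<Sum>i\<in>UNIV. \<Sum>j\<in>UNIV. cmod (taylor_coeff V n $ i $ j))"
      using taylor_abs_power_series[OF rat hol] by (intro summable_sum) (simp add: abs_power_series_def)
    show "norm (norm (taylor_coeff V n)) \<le> (\<Sum>i\<in>UNIV. \<Sum>j\<in>UNIV. cmod (taylor_coeff V n $ i $ j))" for n
      using norm_le by simp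
  qed
  let ?M = "\<Sum>n. norm (taylor_coeff V n)"
  have bound: "(\<Sum>n\<in>X. norm (fourier_coeff V n)) \<le> ?M" if "finite X" for X
  proof -
    have "(\<Sum>n\<in>X. norm (fourier_coeff V n)) = (\<Sum>n\<in>X \<inter> {0..}. norm (fourier_coeff V n))"
      using that by (intro sum.mono_neutral_right) (auto simp: fourier_coeff_H_infty)
    also have "\<dots> = (\<Sum>n\<in>X \<inter> {0..}. norm (taylor_coeff V (nat n)))"
      by (intro sum.cong) (auto simp: fourier_coeff_H_infty)
    also have "\<dots> = (\<Sum>n\<in>nat ` (X \<inter> {0..}). norm (taylor_coeff V n))"
      by (subst sum.reindex) (auto simp: inj_on_def)
    also have "\<dots> \<le> ?M" using that by (intro sum_le_suminf sum) auto
    finally show ?thesis .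
  qed
  have reindex: "(\<Sum>j<n. norm (fourier_coeff V (g j))) \<le> ?M" if "inj g" for g :: "nat \<Rightarrow> int" and n
  proof -
    have "(\<Sum>j<n. norm (fourier_coeff V (g j))) = (\<Sum>k\<in>g ` {..<n}. norm (fourier_coeff V k))"
      using that by (subst sum.reindex) (auto simp: inj_on_def inj_def)
    also have "\<dots> \<le> ?M" by (rule bound) simp
    finally show ?thesis .
  qed
  have 0: "0 \<le> ?M" by (intro suminf_nonneg sum) simp
  have "schur_bounded (toeplitz_matrix V) ?M"
    unfolding schur_bounded_def toeplitz_matrix_def using 0 by (auto intro!: reindex simp: inj_def)
  moreover have "schur_bounded (hankel_matrix V) ?M"
    unfolding schur_bounded_def hankel_matrix_fourier using 0 by (auto intro!: reindex simp: inj_def)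
  ultimately show ?thesis by (rule that)
qed

lemma fourier_coeff_entry_series:
  "abs_power_series (\<lambda>n. fourier_coeff V (int n) $ i $ j) (\<lambda>t. V (cis t) $ i $ j)"
  using taylor_abs_power_series[OF rat hol] by (simp add: fourier_coeff_H_infty)

end

lemma gram_op_unit_seq:
  assumes A: "schur_bounded A M"
  shows "(\<lambda>n. \<Sum>b\<in>UNIV. A j n $ k $ b * cnj (A i n $ l $ b)) sums (gram_op A (unit_seq i l) j $ k)"
proof -
  have "block_op (block_adj A) (unit_seq i l) n = mat_adj (A i n) *v axis l 1" for n
    unfolding block_op_def by (subst suminf_finite[of "{i}"]) (auto simp: unit_seq_def block_adj_def)
  then have 1: "block_op (block_adj A) (unit_seq i l) n $ b = cnj (A i n $ l $ b)" for n b
    by (simp add: matrix_vector_mult_axis column_def mat_adj_def)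
  have "(\<lambda>n. A j n *v block_op (block_adj A) (unit_seq i l) n) sums (gram_op A (unit_seq i l) j)"
    unfolding gram_op_def block_op_def[of A]
    by (intro summable_sums schur_summable(2)[OF A] block_op_ell2[OF schur_bounded_adj[OF A]] unit_seq_ell2)
  then have "(\<lambda>n. (A j n *v block_op (block_adj A) (unit_seq i l) n) $ k) sums (gram_op A (unit_seq i l) j $ k)"
    by (rule bounded_linear.sums[OF bounded_linear_vec_nth])
  then show ?thesis by (simp add: matrix_vector_mult_def 1)
qed

text \<open>
  Both products are sums of \<open>V\<^sub>j\<^sub>-\<^sub>m
  V\<^sub>i\<^sub>-\<^sub>m\<^sup>*\<close>, the Toeplitz one over \<open>m \<ge> 0\<close> and
  the Hankel one over \<open>m < 0\<close>; together they run over all integers and give the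
  Fourier coefficient of \<open>V V\<^sup>*\<close> with index \<open>j - i\<close>.
\<close>
lemma toeplitz_plus_hankel_gram:
  fixes V :: "complex \<Rightarrow> complex ^ 'p ^ 'm"
  assumes rat: "rational_matrix_fun V" and hol: "V \<in> H_infty"
  shows "gram_op (toeplitz_matrix V) (unit_seq i l) j $ k + gram_op (hankel_matrix V) (unit_seq i l) j $ k =
    circle_coeff (\<lambda>t. \<Sum>b\<in>UNIV. V (cis t) $ k $ b * cnj (V (cis t) $ l $ b)) (int j - int i)"
proof -
  obtain M where T: "schur_bounded (toeplitz_matrix V) M" and H: "schur_bounded (hankel_matrix V) M"
    using schur_bounded_toeplitz_hankel[OF rat hol] by blast
  let ?v = "\<lambda>n. fourier_coeff V n"
  \<comment> \<open>The summation index is \<open>a = j - m\<close>; it starts at \<open>0\<close>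
    because \<open>V\<close> has no negative Fourier coefficients.\<close>
  define s where "s a = (\<Sum>b\<in>UNIV. ?v (int a) $ k $ b * cnj (?v (int a + (int i - int j)) $ l $ b))" for a
  note ser = fourier_coeff_entry_series[OF rat hol]
  have cont: "continuous_on {0..2 * pi} (\<lambda>t. V (cis t) $ a $ b)" for a b by (rule abs_power_series_continuous[OF ser])
  have contc: "continuous_on {0..2 * pi} (\<lambda>t. cnj (V (cis t) $ a $ b))" for a b
    by (intro continuous_on_cnj cont)
  have "s sums (\<Sum>b\<in>UNIV. circle_coeff (\<lambda>t. V (cis t) $ k $ b * cnj (V (cis t) $ l $ b)) (int j - int i))"
    unfolding s_def
  proof (rule sums_sum)
    fix b
    have "cnj (?v (int a + (int i - int j)) $ l $ b) = circle_coeff (\<lambda>t. cnj (V (cis t) $ l $ b)) (int j - int i - int a)" for a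
      by (simp add: circle_coeff_cnj fourier_coeff_circle_coeff[OF cont] algebra_simps)
    then show "(\<lambda>a. ?v (int a) $ k $ b * cnj (?v (int a + (int i - int j)) $ l $ b)) sums
        circle_coeff (\<lambda>t. V (cis t) $ k $ b * cnj (V (cis t) $ l $ b)) (int j - int i)"
      using circle_coeff_mult_series[OF ser contc, of k b l b "int j - int i"] by simp
  qed
  also have "(\<Sum>b\<in>UNIV. circle_coeff (\<lambda>t. V (cis t) $ k $ b * cnj (V (cis t) $ l $ b)) (int j - int i)) =
     circle_coeff (\<lambda>t. \<Sum>b\<in>UNIV. V (cis t) $ k $ b * cnj (V (cis t) $ l $ b)) (int j - int i)"
    by (rule circle_coeff_sum[symmetric]) (auto intro!: continuous_on_mult cont contc)
  finally have s: "s sums \<dots>" .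
  have "gram_op (toeplitz_matrix V) (unit_seq i l) j $ k = (\<Sum>a<Suc j. s a)"
  proof -
    have "(\<lambda>n. \<Sum>b\<in>UNIV. toeplitz_matrix V j n $ k $ b * cnj (toeplitz_matrix V i n $ l $ b)) sums
       (\<Sum>n<Suc j. \<Sum>b\<in>UNIV. toeplitz_matrix V j n $ k $ b * cnj (toeplitz_matrix V i n $ l $ b))"
      by (rule sums_finite) (auto simp: toeplitz_matrix_def fourier_coeff_H_infty[OF rat hol])
    then have "gram_op (toeplitz_matrix V) (unit_seq i l) j $ k =
       (\<Sum>n<Suc j. \<Sum>b\<in>UNIV. toeplitz_matrix V j n $ k $ b * cnj (toeplitz_matrix V i n $ l $ b))"
      using gram_op_unit_seq[OF T] sums_unique2 by blast
    also have "\<dots> = (\<Sum>n<Suc j. s (Suc j - Suc n))"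
      by (intro sum.cong) (auto simp: s_def toeplitz_matrix_def of_nat_diff algebra_simps)
    finally show ?thesis by (simp only: sum.nat_diff_reindex)
  qed
  moreover have "gram_op (hankel_matrix V) (unit_seq i l) j $ k = (\<Sum>n. s (n + Suc j))"
  proof -
    have "(\<lambda>n. \<Sum>b\<in>UNIV. hankel_matrix V j n $ k $ b * cnj (hankel_matrix V i n $ l $ b)) = (\<lambda>n. s (n + Suc j))"
      by (rule ext) (simp add: s_def hankel_matrix_fourier[OF rat hol] algebra_simps)
    then show ?thesis using gram_op_unit_seq[OF H, of j k i l] by (simp add: sums_iff)
  qed
  ultimately show ?thesis
    using suminf_split_initial_segment[OF sums_summable[OF s], of "Suc j"] sums_unique[OF s]
    by (simp add: add.commute)
qed

text \<open>
  The coordinates of \<open>E u\<close> are inner products of \<open>u\<close> with the images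
  of unit sequences, so an everywhere defined selfadjoint operator acts through its matrix.
\<close>
lemma selfadjoint_eq_block_op:
  fixes E :: "(nat \<Rightarrow> complex ^ 'm) \<Rightarrow> (nat \<Rightarrow> complex ^ 'm)"
  assumes sa: "selfadjoint_op E"
    and A: "\<And>i j k l. E (unit_seq j k) i $ l = A i j $ l $ k"
    and u: "u \<in> ell2"
  shows "block_op A u = E u"
proof (rule ext)
  note E = selfadjoint_opD(1)[OF sa] and herm = selfadjoint_opD(3)[OF sa]
  fix i
  have "(\<lambda>j. (A i j *v u j) $ l) sums (E u i $ l)" for l
  proof -
    have "E (unit_seq i l) j $ k = cnj (A i j $ l $ k)" for j k
    proof -
      have "E (unit_seq i l) j $ k = ell2_inner (E (unit_seq i l)) (unit_seq j k)"
        by (simp add: ell2_inner_unit_seq)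
      also have "\<dots> = ell2_inner (unit_seq i l) (E (unit_seq j k))"
        by (rule herm[OF unit_seq_ell2 unit_seq_ell2])
      also have "\<dots> = cnj (ell2_inner (E (unit_seq j k)) (unit_seq i l))"
        by (rule ell2_inner_commute[OF E[OF unit_seq_ell2] unit_seq_ell2])
      finally show ?thesis by (simp add: ell2_inner_unit_seq A)
    qed
    then have "cdot (u j) (E (unit_seq i l) j) = (A i j *v u j) $ l" for j
      by (simp add: cdot_def matrix_vector_mult_def mult.commute)
    moreover have "(\<lambda>j. cdot (u j) (E (unit_seq i l) j)) sums ell2_inner u (E (unit_seq i l))"
      unfolding ell2_inner_cdot by (intro summable_sums cdot_summable u E unit_seq_ell2)
    moreover have "ell2_inner u (E (unit_seq i l)) = E u i $ l"
      using herm[OF u unit_seq_ell2, of i l] by (simp add: ell2_inner_unit_seq)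
    ultimately show ?thesis by simp
  qed
  then have "(\<lambda>j. A i j *v u j) sums E u i"
    unfolding sums_def by (intro vec_tendstoI) simp
  then show "block_op A u i = E u i" by (simp add: block_op_def sums_iff)
qed

text \<open>
  Column \<open>j\<close> of a Toeplitz matrix tends to \<open>0\<close> coordinatewise as
  \<open>j\<close> grows. In a finite-dimensional space of sequences its echelon coefficients
  then tend to \<open>0\<close>, hence so do its entries on the \<open>n\<close>-th diagonal,
  which are all equal to \<open>r n\<close>.
\<close>
lemma finite_rank_toeplitz_zero:
  fixes E :: "(nat \<Rightarrow> complex ^ 'm) \<Rightarrow> (nat \<Rightarrow> complex ^ 'm)" and r :: "int \<Rightarrow> complex ^ 'm ^ 'm"
  assumes sa: "selfadjoint_op E"
    and r: "\<And>i j k l. E (unit_seq j k) i $ l = r (int i - int j) $ l $ k"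
    and fin: "cseq_edim (E ` ell2) \<noteq> \<infinity>"
  shows "r n = 0"
proof -
  note E = selfadjoint_opD(1)[OF sa] and herm = selfadjoint_opD(3)[OF sa]
  have W: "cseq.subspace (E ` ell2)"
    by (rule subspace_linear_image[OF selfadjoint_opD(2)[OF sa] ell2_subspace])
  obtain B where B: "finite B" "E ` ell2 \<subseteq> cseq.span B" using cseq_edim_basis[OF fin] by metis
  obtain Q b where Q: "finite Q" "\<And>q. q \<in> Q \<Longrightarrow> b q \<in> E ` ell2"
    "\<And>x. x \<in> E ` ell2 \<Longrightarrow> x = (\<Sum>q\<in>Q. cscale (x (fst q) $ snd q) (b q))"
    using echelon_coordinates[OF W B] by blast
  have "r n $ l $ k = 0" for l k
  proof (rule LIMSEQ_unique)
    let ?d = "\<lambda>j. E (unit_seq j k)"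
    \<comment> \<open>Row \<open>?m j\<close> and column \<open>?p j\<close> both tend to infinity
      along the diagonal with index \<open>n\<close>.\<close>
    let ?m = "\<lambda>j. j + nat n" and ?p = "\<lambda>j. j + nat (- n)"
    have eq: "r n $ l $ k = (\<Sum>q\<in>Q. ?d (?p j) (fst q) $ snd q * b q (?m j) $ l)" for j
    proof -
      have "r n $ l $ k = ?d (?p j) (?m j) $ l" by (simp add: r)
      also have "\<dots> = (\<Sum>q\<in>Q. cscale (?d (?p j) (fst q) $ snd q) (b q)) (?m j) $ l"
        by (rule arg_cong[OF Q(3)]) (simp add: unit_seq_ell2)
      finally show ?thesis by (simp only: sum_cscale_nth)
    qed
    have "(\<lambda>j. ?d (?p j) i $ a * b q (?m j) $ l) \<longlonglongrightarrow> 0 * 0" if "q \<in> Q" for q i a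
    proof (rule tendsto_mult)
      have "(\<lambda>j. cnj (E (unit_seq i a) j $ k)) \<longlonglongrightarrow> cnj (0 $ k)"
        by (intro tendsto_cnj tendsto_vec_nth ell2_tendsto_0 E unit_seq_ell2)
      moreover have "cnj (E (unit_seq i a) j $ k) = ?d j i $ a" for j
      proof -
        have "?d j i $ a = ell2_inner (E (unit_seq j k)) (unit_seq i a)" by (simp add: ell2_inner_unit_seq)
        also have "\<dots> = ell2_inner (unit_seq j k) (E (unit_seq i a))" by (rule herm[OF unit_seq_ell2 unit_seq_ell2])
        also have "\<dots> = cnj (ell2_inner (E (unit_seq i a)) (unit_seq j k))"
          by (rule ell2_inner_commute[OF E[OF unit_seq_ell2] unit_seq_ell2])
        finally show ?thesis by (simp add: ell2_inner_unit_seq)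
      qed
      ultimately have "(\<lambda>j. ?d j i $ a) \<longlonglongrightarrow> 0" by simp
      then show "(\<lambda>j. ?d (?p j) i $ a) \<longlonglongrightarrow> 0" by (rule LIMSEQ_ignore_initial_segment)
      have "E ` ell2 \<subseteq> ell2" by (rule image_subsetI) (rule E)
      then have "b q \<in> ell2" using Q(2)[OF that] by (rule subsetD)
      then have "(\<lambda>j. b q j $ l) \<longlonglongrightarrow> 0 $ l" by (intro tendsto_vec_nth ell2_tendsto_0)
      then have "(\<lambda>j. b q j $ l) \<longlonglongrightarrow> 0" by simp
      then show "(\<lambda>j. b q (?m j) $ l) \<longlonglongrightarrow> 0" by (rule LIMSEQ_ignore_initial_segment)
    qed
    then have "(\<lambda>j. \<Sum>q\<in>Q. ?d (?p j) (fst q) $ snd q * b q (?m j) $ l) \<longlonglongrightarrow> (\<Sum>q\<in>Q. 0 * 0)"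
      by (intro tendsto_sum)
    then show "(\<lambda>j :: nat. r n $ l $ k) \<longlonglongrightarrow> 0" unfolding eq[symmetric] by simp
  qed simp
  then show ?thesis by (simp add: vec_eq_iff)
qed

lemma gram_op_adj:
  assumes "schur_bounded A M" "u \<in> ell2"
  shows "(block_op A \<circ> ell2_adj (block_op A)) u = gram_op A u"
  using ell2_adj_block_op[OF assms] by (simp add: gram_op_def)

lemma cseq_edim_diff_range_finite:
  assumes "\<And>u. u \<in> S \<Longrightarrow> T u = T1 u - T2 u"
    and "cseq_edim (T1 ` S) \<noteq> \<infinity>" "cseq_edim (T2 ` S) \<noteq> \<infinity>"
  shows "cseq_edim (T ` S) \<noteq> \<infinity>"
proof -
  have "T ` S \<subseteq> cseq.span (T1 ` S \<union> T2 ` S)"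
  proof (rule image_subsetI)
    fix u assume u: "u \<in> S"
    have "T1 u - T2 u \<in> cseq.span (T1 ` S \<union> T2 ` S)"
      using u by (intro cseq.span_diff cseq.span_base) auto
    then show "T u \<in> cseq.span (T1 ` S \<union> T2 ` S)" unfolding assms(1)[OF u] .
  qed
  then have "cseq_edim (T ` S) \<le> cseq_edim (T1 ` S) + cseq_edim (T2 ` S)"
    using cseq_edim_mono_span cseq_edim_Un_le order_trans by blast
  also have "\<dots> < \<infinity>" using assms(2,3) by (simp add: plus_eq_infty_iff_enat less_le)
  finally show ?thesis by simp
qed

lemma hankel_rank_mcmillan:
  assumes rat: "rational_matrix_fun V" and hol: "V \<in> H_infty"
  shows "ell2_rank (block_op (hankel_matrix V)) = mcmillan_degree V"
proof -
  obtain M where "schur_bounded (hankel_matrix V) M"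
    using schur_bounded_toeplitz_hankel[OF rat hol] by blast
  moreover have "mcmillan_degree V = block_rank (hankel_matrix V)"
    unfolding hankel_matrix_def[abs_def] by (rule mcmillan_degree_eq_block_rank(1)[OF rat hol])
  ultimately show ?thesis
    using ell2_rank_block_op mcmillan_degree_eq_block_rank(2)[OF rat hol] by metis
qed

definition row_product :: "(complex \<Rightarrow> complex ^ 'p ^ 'm) \<Rightarrow> 'm \<Rightarrow> 'm \<Rightarrow> real \<Rightarrow> complex"
  where "row_product V l k t = (\<Sum>b\<in>UNIV. V (cis t) $ l $ b * cnj (V (cis t) $ k $ b))"

lemma row_product_eq: "(V (cis t) ** mat_adj (V (cis t))) $ l $ k = row_product V l k t"
  by (simp add: row_product_def matrix_matrix_mult_def mat_adj_def)

lemma row_product_continuous: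
  assumes rat: "rational_matrix_fun V" and hol: "V \<in> H_infty"
  shows "continuous_on {0..2 * pi} (row_product V l k)"
proof -
  have "continuous_on {0..2 * pi} (\<lambda>t. V (cis t) $ a $ b)" for a b
    by (rule abs_power_series_continuous[OF taylor_abs_power_series[OF rat hol]])
  then show ?thesis
    unfolding row_product_def[abs_def] by (intro continuous_on_sum continuous_on_mult continuous_on_cnj)
qed

lemma circle_coeff_row_product_zero:
  assumes rat: "rational_matrix_fun V" and hol: "V \<in> H_infty"
    and F: "continuous_on {0..2 * pi} F" and 0: "\<And>n. circle_coeff F n = 0"
  shows "circle_coeff (\<lambda>t. row_product V l k t * F t) n = 0"
proof -
  note ser = taylor_abs_power_series[OF rat hol]
  have cont: "continuous_on {0..2 * pi} (\<lambda>t. V (cis t) $ a $ b)" for a b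
    by (rule abs_power_series_continuous[OF ser])
  have c: "continuous_on {0..2 * pi} (\<lambda>t. cnj (V (cis t) $ k $ b) * F t)" for b
    by (intro continuous_on_mult continuous_on_cnj cont F)
  have "circle_coeff (\<lambda>t. V (cis t) $ l $ b * (cnj (V (cis t) $ k $ b) * F t)) n = 0" for b
    by (rule circle_coeff_zero_mult(1)[OF ser c circle_coeff_zero_mult(2)[OF ser F 0]])
  moreover have "(\<lambda>t. row_product V l k t * F t) =
      (\<lambda>t. \<Sum>b\<in>UNIV. V (cis t) $ l $ b * (cnj (V (cis t) $ k $ b) * F t))"
    by (simp add: row_product_def sum_distrib_right mult.assoc)
  moreover have "circle_coeff (\<lambda>t. \<Sum>b\<in>UNIV. V (cis t) $ l $ b * (cnj (V (cis t) $ k $ b) * F t)) n =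
      (\<Sum>b\<in>UNIV. circle_coeff (\<lambda>t. V (cis t) $ l $ b * (cnj (V (cis t) $ k $ b) * F t)) n)"
    by (rule circle_coeff_sum) (intro continuous_on_mult cont c, simp)
  ultimately show ?thesis by simp
qed

lemma row_product_cnj: "cnj (row_product V l k t) = row_product V k l t"
  by (simp add: row_product_def mult.commute)

text \<open>
  The difference \<open>F\<close> of the two symbols is a combination of products of power
  series and conjugates, and so is its conjugate; hence \<open>cnj F * F\<close> has mean
  \<open>0\<close>.
\<close>
lemma row_products_equal:
  assumes G: "rational_matrix_fun G" "G \<in> H_infty" and K: "rational_matrix_fun K" "K \<in> H_infty"
    and 0: "\<And>n. circle_coeff (\<lambda>t. row_product G l k t - row_product K l k t) n = 0"
    and t: "t \<in> {0..2 * pi}"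
  shows "row_product G l k t = row_product K l k t"
proof -
  let ?F = "\<lambda>t. row_product G l k t - row_product K l k t"
  note cG = row_product_continuous[OF G] and cK = row_product_continuous[OF K]
  have F: "continuous_on {0..2 * pi} ?F" by (intro continuous_on_diff cG cK)
  have "circle_coeff (\<lambda>t. row_product G k l t * ?F t - row_product K k l t * ?F t) 0 =
      circle_coeff (\<lambda>t. row_product G k l t * ?F t) 0 - circle_coeff (\<lambda>t. row_product K k l t * ?F t) 0"
    by (rule circle_coeff_diff) (intro continuous_on_mult F cG cK)+
  also have "\<dots> = 0"
    by (simp only: circle_coeff_row_product_zero[OF G F 0] circle_coeff_row_product_zero[OF K F 0] diff_self)
  finally have "circle_coeff (\<lambda>t. cnj (?F t) * ?F t) 0 = 0"
    by (simp add: row_product_cnj left_diff_distrib)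
  from circle_coeff_zero_imp[OF F this t] show ?thesis by simp
qed

theorem theorem3p2:
  fixes G :: "complex \<Rightarrow> complex ^ 'p ^ 'm"
    and K :: "complex \<Rightarrow> complex ^ 'q ^ 'm"
    and R :: "complex \<Rightarrow> complex ^ 'm ^ 'm"
    and D :: "(nat \<Rightarrow> complex ^ 'm) \<Rightarrow> (nat \<Rightarrow> complex ^ 'm)"
  defines "D \<equiv> (toeplitz G \<circ> ell2_adj (toeplitz G)) - (toeplitz K \<circ> ell2_adj (toeplitz K))"
  assumes "rational_matrix_fun G" and "G \<in> H_infty"
    and "rational_matrix_fun K" and "K \<in> H_infty"
    and "ell2_nonneg D"
    and "\<And>t::real. R (cis t) = G (cis t) ** mat_adj (G (cis t)) - K (cis t) ** mat_adj (K (cis t))"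
  shows "(ell2_rank D < \<infinity> \<longleftrightarrow> (\<forall>u\<in>ell2. toeplitz R u = 0)) \<and>
         ((\<forall>u\<in>ell2. toeplitz R u = 0) \<longleftrightarrow>
            (\<forall>t\<in>{0..2 * pi}. G (cis t) ** mat_adj (G (cis t)) = K (cis t) ** mat_adj (K (cis t)))) \<and>
         (ell2_rank D < \<infinity> \<longrightarrow>
            (\<forall>u\<in>ell2. D u = ((hankel K \<circ> ell2_adj (hankel K)) - (hankel G \<circ> ell2_adj (hankel G))) u) \<and>
            mcmillan_degree G \<le> mcmillan_degree K \<and>
            mcmillan_degree K - mcmillan_degree G \<le> ell2_rank D \<and>
            ell2_rank D \<le> mcmillan_degree K)"
proof -
  note G = assms(2,3) and K = assms(4,5) and nn = assms(6) and R = assms(7)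
  obtain M where TG: "schur_bounded (toeplitz_matrix G) M" and HG: "schur_bounded (hankel_matrix G) M"
    using schur_bounded_toeplitz_hankel[OF G] by blast
  obtain N where TK: "schur_bounded (toeplitz_matrix K) N" and HK: "schur_bounded (hankel_matrix K) N"
    using schur_bounded_toeplitz_hankel[OF K] by blast
  let ?tG = "gram_op (toeplitz_matrix G)" and ?tK = "gram_op (toeplitz_matrix K)"
  let ?hG = "gram_op (hankel_matrix G)" and ?hK = "gram_op (hankel_matrix K)"
  have D: "D u = ?tG u - ?tK u" if "u \<in> ell2" for u
    unfolding D_def toeplitz_eq fun_diff_def[of "_ \<circ> _"] gram_op_adj[OF TG that] gram_op_adj[OF TK that] ..
  have H: "((hankel K \<circ> ell2_adj (hankel K)) - (hankel G \<circ> ell2_adj (hankel G))) u = ?hK u - ?hG u"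
    if "u \<in> ell2" for u
    unfolding hankel_eq fun_diff_def[of "_ \<circ> _"] gram_op_adj[OF HG that] gram_op_adj[OF HK that] ..
  \<comment> \<open>\<open>E\<close> turns out to be the Toeplitz operator with symbol
    \<open>R\<close>.\<close>
  define E where "E = (\<lambda>u. (?tG u + ?hG u) - (?tK u + ?hK u))"
  have sE: "selfadjoint_op E"
    unfolding E_def
    by (intro selfadjoint_op_diff selfadjoint_op_add selfadjoint_gram_op[OF TG]
        selfadjoint_gram_op[OF HG] selfadjoint_gram_op[OF TK] selfadjoint_gram_op[OF HK])
  let ?f = "\<lambda>l k t. row_product G l k t - row_product K l k t"
  have Rf: "R (cis t) $ l $ k = ?f l k t" for t l k
    unfolding R by (simp add: row_product_eq)
  have contf: "continuous_on {0..2 * pi} (?f l k)" for l k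
    by (intro continuous_on_diff row_product_continuous G K)
  have coeff: "fourier_coeff R n $ l $ k = circle_coeff (?f l k) n" for n l k
    using fourier_coeff_circle_coeff[of R l k n] contf[of l k] unfolding Rf by simp
  have E_unit: "E (unit_seq j k) i $ l = fourier_coeff R (int i - int j) $ l $ k" for i j k l
    unfolding coeff circle_coeff_diff[OF row_product_continuous[OF G] row_product_continuous[OF K]]
    using toeplitz_plus_hankel_gram[OF G, of j k i l] toeplitz_plus_hankel_gram[OF K, of j k i l]
    by (simp add: E_def row_product_def[abs_def])
  have TR: "toeplitz R u = E u" if "u \<in> ell2" for u
    unfolding toeplitz_eq
    by (rule selfadjoint_eq_block_op[OF sE _ that]) (simp only: E_unit toeplitz_matrix_def)
  have rank_h: "ell2_rank ?hG = mcmillan_degree G" "ell2_rank ?hK = mcmillan_degree K"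
    using rank_gram_op[OF HG] rank_gram_op[OF HK] hankel_rank_mcmillan[OF G] hankel_rank_mcmillan[OF K]
      mcmillan_degree_eq_block_rank(2)[OF G] mcmillan_degree_eq_block_rank(2)[OF K] by simp_all
  have fin_h: "cseq_edim (?hG ` ell2) \<noteq> \<infinity>" "cseq_edim (?hK ` ell2) \<noteq> \<infinity>"
    using rank_h mcmillan_degree_eq_block_rank(2)[OF G] mcmillan_degree_eq_block_rank(2)[OF K]
    unfolding ell2_rank_def by simp_all
  have DE: "D u = ?hK u - ?hG u" if "\<forall>u\<in>ell2. toeplitz R u = 0" "u \<in> ell2" for u
  proof -
    have "E u = 0" using TR that by metis
    then show ?thesis unfolding D[OF that(2)] E_def by (simp add: algebra_simps)
  qed
  have ii_i: "ell2_rank D < \<infinity>" if "\<forall>u\<in>ell2. toeplitz R u = 0"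
    using cseq_edim_diff_range_finite[OF DE[OF that] fin_h(2,1)] unfolding ell2_rank_def by simp
  have zero: "toeplitz R u = 0" if "\<And>n. fourier_coeff R n = 0" for u
    unfolding toeplitz_def block_op_def by (simp add: that fun_eq_iff)
  \<comment> \<open>The Hankel parts have finite rank, so \<open>D\<close> and the Toeplitz operator
    with symbol \<open>R\<close> have finite rank simultaneously.\<close>
  have i_ii: "\<forall>u\<in>ell2. toeplitz R u = 0" if fin: "ell2_rank D < \<infinity>"
  proof -
    let ?h = "\<lambda>u. ?hK u - ?hG u"
    have "cseq_edim (?h ` ell2) \<noteq> \<infinity>"
      by (rule cseq_edim_diff_range_finite[OF refl fin_h(2,1)])
    moreover have "E u = D u - ?h u" if "u \<in> ell2" for u
      unfolding D[OF that] E_def by (simp add: algebra_simps)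
    ultimately have "cseq_edim (E ` ell2) \<noteq> \<infinity>"
      using fin cseq_edim_diff_range_finite[of ell2 E D ?h] unfolding ell2_rank_def by auto
    then have "fourier_coeff R n = 0" for n
      by (rule finite_rank_toeplitz_zero[OF sE E_unit])
    then show ?thesis using zero by blast
  qed
  have ii_iii: "\<forall>t\<in>{0..2 * pi}. G (cis t) ** mat_adj (G (cis t)) = K (cis t) ** mat_adj (K (cis t))"
    if 0: "\<forall>u\<in>ell2. toeplitz R u = 0"
  proof
    fix t :: real assume t: "t \<in> {0..2 * pi}"
    have "circle_coeff (?f l k) n = 0" for l k n
    proof -
      \<comment> \<open>This entry of the matrix lies on the diagonal with index
        \<open>n\<close>.\<close>
      have "E (unit_seq (nat (- n)) k) (nat n) $ l = 0"
        using 0 TR[OF unit_seq_ell2] unit_seq_ell2 by (metis zero_fun_apply zero_index)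
      moreover have "int (nat n) - int (nat (- n)) = n" by simp
      ultimately show ?thesis unfolding E_unit coeff by (simp only:)
    qed
    from row_products_equal[OF G K this t]
    show "G (cis t) ** mat_adj (G (cis t)) = K (cis t) ** mat_adj (K (cis t))"
      unfolding vec_eq_iff row_product_eq by blast
  qed
  have iii_ii: "\<forall>u\<in>ell2. toeplitz R u = 0"
    if eq: "\<forall>t\<in>{0..2 * pi}. G (cis t) ** mat_adj (G (cis t)) = K (cis t) ** mat_adj (K (cis t))"
  proof -
    have "?f l k t = 0" if "t \<in> {0..2 * pi}" for l k t
      using eq that row_product_eq[of G t l k] row_product_eq[of K t l k] by simp
    then have "integral {0..2 * pi} (\<lambda>t. ?f l k t * cis (- (of_int n * t))) = integral {0..2 * pi} (\<lambda>t. 0)" for l k n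
      by (intro integral_cong) simp
    then have "fourier_coeff R n = 0" for n
      by (simp add: vec_eq_iff coeff circle_coeff_def)
    then show ?thesis using zero by blast
  qed
  have final: "(\<forall>u\<in>ell2. D u = ((hankel K \<circ> ell2_adj (hankel K)) - (hankel G \<circ> ell2_adj (hankel G))) u) \<and>
      mcmillan_degree G \<le> mcmillan_degree K \<and> mcmillan_degree K - mcmillan_degree G \<le> ell2_rank D \<and>
      ell2_rank D \<le> mcmillan_degree K" if fin: "ell2_rank D < \<infinity>"
  proof -
    note D' = DE[OF i_ii[OF fin]]
    note rk = hankel_rank_mcmillan[OF G] hankel_rank_mcmillan[OF K]
    have f: "ell2_rank (block_op (hankel_matrix G)) \<noteq> \<infinity>" "ell2_rank (block_op (hankel_matrix K)) \<noteq> \<infinity>"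
      unfolding rk using mcmillan_degree_eq_block_rank(2) G K by blast+
    note ineq = rank_gram_difference[OF HG HK D' nn f, unfolded rk]
    obtain a b c where "mcmillan_degree G = enat a" "mcmillan_degree K = enat b" "ell2_rank D = enat c"
      using f fin unfolding rk by auto
    then have "mcmillan_degree K - mcmillan_degree G \<le> ell2_rank D" using ineq(3) by simp
    then show ?thesis using D' H ineq(1,2) by simp
  qed
  show ?thesis using ii_i i_ii ii_iii iii_ii final by blast
qed

end
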